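(* Let $\delta>0$, let $E\in(0,E_\delta)$, and let $W\in L^\infty(\mathbb R\times\mathcal S)$, $W\ge 0$, $W$ not a.e. zero, satisfy $W(x_1,x_\ell)=O\big((1+|x_1|)^{-(3+\eta)/2}\big)$ (uniformly in $x_\ell\in\mathcal S$) for some $\eta>0$. Then there exists $g_0=g_0(\delta,W)>0$ such that for all $g\in(0,g_0)$ the set $$\mathcal C_g(E)=\{k\in\mathcal B:\ |k|^2\neq E \text{ and } 1-g\Gamma_k(E)\text{ is singular (not boundedly invertible in } L^2(\mathbb R\times\mathcal S))\}$$ is a one-dimensional compact real analytic manifold contained in an annulus $\Omega_g(E)\subset\mathbb R^2$ centered at the origin, with inner and outer radii $E^{1/2}+c_-g^2$ and $E^{1/2}+c_+g^2$ respectively, where the two constants $c_\pm>0$ are independent of $g$. Namely, $\mathcal C_g(E)$ is a closed and simple (i.e. with no double point) curve which is not homotopic to a point in $\Omega_g(E)$.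
   Context: Let $a_2,a_3\in\mathbb R^2$ be fixed nonzero orthogonal vectors, $\mathcal L=\mathbb Z a_2+\mathbb Z a_3$, $\mathcal S=\{s_2a_2+s_3a_3:\ -1/2<s_j\le 1/2\}$, $b_j=2\pi a_j/|a_j|^2$, $\mathcal L^\perp=\mathbb Z b_2+\mathbb Z b_3$, $\mathcal B=\{t_2b_2+t_3b_3:\ -1/2<t_j\le 1/2\}$; $|\mathcal S|$, $|\mathcal B|$ denote areas (so $|\mathcal S||\mathcal B|=4\pi^2$). Points of $\mathbb R\times\mathcal S$ are written $x=(x_1,x_\ell)$, $\mathcal H=L^2(\mathbb R\times\mathcal S)$. For $\delta\ge 0$, $E_\delta=\frac{1}{4(1+\delta)}\min_{j=2,3}|b_j|^2$. For $k\in\mathcal B$ with $|k|^2\ne E$, $\Gamma_k(E)$ is the integral operator in $\mathcal H$ with kernel $$\gamma_k(x,y,E)=\mathrm i\beta\, W(x)W(y)\sum_{K\in\mathcal L^\perp}\frac{e^{\mathrm i\sqrt{E-|k+K|^2}\,|x_1-y_1|}}{\sqrt{E-|k+K|^2}}\,e^{\mathrm i\langle k+K,\,x_\ell-y_\ell\rangle},\qquad \beta=\frac{|\mathcal B|}{8\pi^2}=\frac1{2|\mathcal S|},$$ where $\sqrt{\cdot}$ is the square root with nonnegative imaginary part, taken positive on positive reals. (For $|k|^2>E$ this is $W(H_0(k)-E)^{-1}W$, where $H_0(k)=-\Delta$ in $\mathcal H$ with $k$-quasi-periodic boundary conditions in $x_\ell$; for $|k|^2<E$ it is the boundary value of $W(H_0(k)-E-\mathrm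 i\varepsilon)^{-1}W$ as $\varepsilon\downarrow0$.) The operator $1-g\Gamma_k(E)$ arises from the perturbation $-gW^2$ of $H_0(k)$. *)

theory Defs
  imports "HOL-Analysis.Analysis"
begin

section \<open>Square integrable functions\<close>

text \<open>
  There is no type of elements of \<open>L\<^sup>2(M)\<close>; they are represented by square integrable functions,
  and everything below is stated up to equality almost everywhere.
\<close>

definition L2_space :: "'a measure \<Rightarrow> ('a \<Rightarrow> complex) set" where
  "L2_space M = {f \<in> borel_measurable M. integrable M (\<lambda>x. (cmod (f x))\<^sup>2)}"

definition norm_L2 :: "'a measure \<Rightarrow> ('a \<Rightarrow> complex) \<Rightarrow> real" where
  "norm_L2 M f = sqrt (LINT x|M. (cmod (f x))\<^sup>2)"

text \<open>
  Linearity and boundedness together imply that such a map respects equality almost everywhere.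
\<close>

definition bounded_operator_L2 ::
  "'a measure \<Rightarrow> (('a \<Rightarrow> complex) \<Rightarrow> ('a \<Rightarrow> complex)) \<Rightarrow> bool" where
  "bounded_operator_L2 M T \<longleftrightarrow>
     (\<forall>f\<in>L2_space M. T f \<in> L2_space M) \<and>
     (\<forall>f\<in>L2_space M. \<forall>h\<in>L2_space M. AE x in M. T (\<lambda>y. f y + h y) x = T f x + T h x) \<and>
     (\<forall>f\<in>L2_space M. \<forall>c. AE x in M. T (\<lambda>y. c * f y) x = c * T f x) \<and>
     (\<exists>C. \<forall>f\<in>L2_space M. norm_L2 M (T f) \<le> C * norm_L2 M f)"

definition boundedly_invertible_L2 ::
  "'a measure \<Rightarrow> (('a \<Rightarrow> complex) \<Rightarrow> ('a \<Rightarrow> complex)) \<Rightarrow> bool" where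
  "boundedly_invertible_L2 M T \<longleftrightarrow>
     bounded_operator_L2 M T \<and>
     (\<exists>R. bounded_operator_L2 M R \<and>
        (\<forall>f\<in>L2_space M. (AE x in M. T (R f) x = f x) \<and> (AE x in M. R (T f) x = f x)))"


section \<open>One-dimensional real analytic manifolds\<close>

definition real_analytic_on :: "(real \<Rightarrow> 'a::real_normed_vector) \<Rightarrow> real set \<Rightarrow> bool" where
  "real_analytic_on \<gamma> I \<longleftrightarrow>
     (\<forall>t0\<in>I. \<exists>r>0. \<exists>c. \<forall>t. \<bar>t - t0\<bar> < r \<longrightarrow> (\<lambda>n. (t - t0) ^ n *\<^sub>R c n) sums \<gamma> t)"

text \<open>
  Embedded submanifolds: near each of its points, \<open>C\<close> is the homeomorphic image of an open set of
  parameters under a real analytic map with nonvanishing derivative.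
\<close>

definition analytic_1manifold :: "'a::euclidean_space set \<Rightarrow> bool" where
  "analytic_1manifold C \<longleftrightarrow>
     (\<forall>p\<in>C. \<exists>U I \<gamma> \<gamma>_inv. open U \<and> p \<in> U \<and> open I \<and>
        real_analytic_on \<gamma> I \<and>
        (\<forall>t\<in>I. vector_derivative \<gamma> (at t) \<noteq> 0) \<and>
        homeomorphism I (C \<inter> U) \<gamma> \<gamma>_inv)"


section \<open>The lattice, its dual, and the cells\<close>

definition planar_lattice :: "real^2 \<Rightarrow> real^2 \<Rightarrow> (real^2) set" where
  "planar_lattice u v = {of_int m *\<^sub>R u + of_int n *\<^sub>R v | m n :: int. True}"

definition cell :: "real^2 \<Rightarrow> real^2 \<Rightarrow> (real^2) set" where
  "cell u v = {s *\<^sub>R u + t *\<^sub>R v | s t :: real. -1/2 < s \<and> s \<le> 1/2 \<and> -1/2 < t \<and> t \<le> 1/2}"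

definition dual_vec :: "real^2 \<Rightarrow> real^2" where
  "dual_vec a = (2 * pi / (norm a)\<^sup>2) *\<^sub>R a"

definition dual_lattice :: "real^2 \<Rightarrow> real^2 \<Rightarrow> (real^2) set" where
  "dual_lattice a2 a3 = planar_lattice (dual_vec a2) (dual_vec a3)"

definition brillouin :: "real^2 \<Rightarrow> real^2 \<Rightarrow> (real^2) set" where
  "brillouin a2 a3 = cell (dual_vec a2) (dual_vec a3)"

definition E_bound :: "real^2 \<Rightarrow> real^2 \<Rightarrow> real \<Rightarrow> real" where
  "E_bound a2 a3 \<delta> =
     1 / (4 * (1 + \<delta>)) * min ((norm (dual_vec a2))\<^sup>2) ((norm (dual_vec a3))\<^sup>2)"

text \<open>
  Lebesgue measure on \<open>\<real> \<times> S\<close>, on the Borel sets. Every class of Lebesgue measurable functions modulo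
  null sets has a Borel representative, so \<open>L\<^sup>2\<close> and \<open>L\<^sup>\<infinity>\<close> are the usual spaces.
\<close>

definition strip_measure :: "real^2 \<Rightarrow> real^2 \<Rightarrow> (real \<times> (real^2)) measure" where
  "strip_measure a2 a3 = restrict_space lborel (UNIV \<times> cell a2 a3)"


section \<open>The integral operator\<close>

definition beta :: "real^2 \<Rightarrow> real^2 \<Rightarrow> real" where
  "beta a2 a3 = measure lborel (brillouin a2 a3) / (8 * pi\<^sup>2)"

text \<open>
  On the real axis \<^const>\<open>csqrt\<close> is the required branch: it is positive on positive reals, and
  \<open>csqrt (- r) = \<i> * sqrt r\<close> for \<open>r \<ge> 0\<close>. The lattice sum converges absolutely when
  \<open>fst x \<noteq> fst y\<close>; on the remaining null set of \<open>y\<close> the sum diverges absolutely and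
  \<^const>\<open>infsum\<close> returns \<open>0\<close>, which does not affect the integral operator.
\<close>

definition gamma_kernel ::
  "real^2 \<Rightarrow> real^2 \<Rightarrow> (real \<times> (real^2) \<Rightarrow> real) \<Rightarrow> real^2 \<Rightarrow>
   real \<times> (real^2) \<Rightarrow> real \<times> (real^2) \<Rightarrow> real \<Rightarrow> complex" where
  "gamma_kernel a2 a3 W k x y E =
     \<i> * of_real (beta a2 a3) * of_real (W x) * of_real (W y) *
     (\<Sum>\<^sub>\<infinity>K\<in>dual_lattice a2 a3.
        exp (\<i> * csqrt (of_real (E - (norm (k + K))\<^sup>2)) * of_real \<bar>fst x - fst y\<bar>)
          / csqrt (of_real (E - (norm (k + K))\<^sup>2))
        * exp (\<i> * of_real ((k + K) \<bullet> (snd x - snd y))))"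

definition Gamma_op ::
  "real^2 \<Rightarrow> real^2 \<Rightarrow> (real \<times> (real^2) \<Rightarrow> real) \<Rightarrow> real^2 \<Rightarrow> real \<Rightarrow>
   (real \<times> (real^2) \<Rightarrow> complex) \<Rightarrow> real \<times> (real^2) \<Rightarrow> complex" where
  "Gamma_op a2 a3 W k E f = (\<lambda>x. LINT y|strip_measure a2 a3. gamma_kernel a2 a3 W k x y E * f y)"

definition singular_set ::
  "real^2 \<Rightarrow> real^2 \<Rightarrow> (real \<times> (real^2) \<Rightarrow> real) \<Rightarrow> real \<Rightarrow> real \<Rightarrow> (real^2) set" where
  "singular_set a2 a3 W g E =
     {k \<in> brillouin a2 a3. (norm k)\<^sup>2 \<noteq> E \<and>
        \<not> boundedly_invertible_L2 (strip_measure a2 a3)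
            (\<lambda>f x. f x - of_real g * Gamma_op a2 a3 W k E f x)}"

definition annulus :: "real \<Rightarrow> real \<Rightarrow> (real^2) set" where
  "annulus r R = {p. r < norm p \<and> norm p < R}"

end

theory Submission
  imports Defs "HOL-Complex_Analysis.Complex_Analysis"
begin

text \<open>
  Put \<open>\<kappa> = (|k|\<^sup>2 - E)\<^sup>1\<^sup>/\<^sup>2\<close>. Up to conjugation with plane waves, \<open>\<Gamma>\<^sub>k = (\<beta> / \<kappa>) W \<otimes> W + M\<close>, where \<open>M\<close> collects the
  regular part \<open>(exp (-\<kappa> |x\<^sub>1 - y\<^sub>1|) - 1) / \<kappa>\<close> of the mode \<open>K = 0\<close> and the modes \<open>K \<noteq> 0\<close>. For these
  \<open>|k + K|\<^sup>2 - E\<close> is bounded below by a multiple of \<open>|K|\<^sup>2\<close>, so orthogonality of the exponentials on the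
  cell and the decay of \<open>W\<close> bound \<open>\<integral> |M(x, y)|\<^sup>2 dy\<close> by \<open>C\<^sup>2 W(x)\<^sup>2 (1 + |x\<^sub>1|)\<^sup>2\<close>, uniformly in \<open>k\<close> and \<open>E\<close>. Hence
  the Neumann series of \<open>1 - g M\<close> converges pointwise (completeness of \<open>L\<^sup>2\<close> is never needed), and
  \<open>1 - g \<Gamma>\<^sub>k\<close> is singular iff \<open>\<kappa> = \<Phi>(\<kappa>, \<theta>) := g \<beta> \<langle>W, (1 - g M)\<^sup>-\<^sup>1 W\<rangle>\<close>, where \<open>\<theta>\<close> is the polar angle of \<open>k\<close>.

  Since \<open>\<Phi> = g \<beta> \<parallel>W\<parallel>\<^sup>2 (1 + O(g))\<close>, a solution has positive real part, which excludes \<open>|k|\<^sup>2 < E\<close>. On a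
  disc about \<open>g \<beta> \<parallel>W\<parallel>\<^sup>2\<close> of radius proportional to \<open>g\<close>, \<open>\<Phi>\<close> is holomorphic in \<open>\<kappa>\<close> and in \<open>\<theta>\<close>, and the Cauchy
  estimate makes it a contraction in \<open>\<kappa>\<close>. The fixed point \<open>\<kappa>(\<theta>)\<close> is holomorphic in \<open>\<theta>\<close>, as the uniform limit
  of the iterates, and real for real \<open>\<theta>\<close>, as \<open>M\<close> is Hermitian. So the singular set is the polar curve of
  radius \<open>(E + \<kappa>(\<theta>)\<^sup>2)\<^sup>1\<^sup>/\<^sup>2\<close>, which winds once around the origin.
\<close>

section \<open>Square integrable functions\<close>

text \<open>The mode \<open>K = 0\<close> dictates the decay of \<open>W\<close>: without its pole
  it is bounded only by |x1 - y1|, and |x1 - y1| <= (1 + |x1|) (1 + |y1|) asks for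
  \<open>W (1 + |x1|)\<close> to be square integrable; the exponent (3 + \<eta>) / 2 leaves the
  integrable power -1 - \<eta>. Absolute values of the other modes leave too strong a singularity at
  x1 = y1, so their square integral comes from Parseval and Fatou. \<open>\<delta>\<close> enters
  through \<open>gap \<delta>\<close>: \<open>E_bound\<close> lies \<open>2 * gap \<delta>\<close>
  below the squared inradius of the Brillouin zone. This reserve keeps the curve inside the zone,
  and half of it pays for making \<open>\<kappa>\<close> and \<open>\<theta>\<close> complex. The
  smallness conditions see E only through this reserve, so \<open>g0\<close> is independent of E;
  the annulus constants and the neighbourhoods of \<open>\<theta>\<close> are not. The numerical
  constants form one chain: \<open>\<omega> \<le> 1/9\<close> gives an error of at most
  \<open>root0 / 8\<close> for \<open>\<Phi>\<close>, a quarter of the disc radius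
  \<open>root0 / 2\<close>, and the Cauchy estimate then yields the contraction factor 1/2.\<close>

lemma cnj_borel_measurable [measurable]: "cnj \<in> borel_measurable borel"
  by (intro borel_measurable_continuous_onI continuous_intros)

lemma cis_borel_measurable [measurable]: "cis \<in> borel_measurable borel"
  by (intro borel_measurable_continuous_onI continuous_intros)

lemma fst_snd_borel_measurable [measurable]:
  "(fst :: 'a::topological_space \<times> 'b::topological_space \<Rightarrow> 'a) \<in> borel_measurable borel"
  "(snd :: 'a \<times> 'b \<Rightarrow> 'b) \<in> borel_measurable borel"
  by (intro borel_measurable_continuous_onI continuous_intros)+

lemma L2_spaceI:
  assumes "f \<in> borel_measurable M" "integrable M (\<lambda>x. (cmod (f x))\<^sup>2)"
  shows "f \<in> L2_space M"
  using assms by (simp add: L2_space_def)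

lemma L2_spaceD:
  assumes "f \<in> L2_space M"
  shows L2_space_measurable [measurable_dest]: "f \<in> borel_measurable M"
    and L2_space_integrable: "integrable M (\<lambda>x. (cmod (f x))\<^sup>2)"
  using assms by (simp_all add: L2_space_def)

lemma norm_L2_nonneg [simp]: "0 \<le> norm_L2 M f"
  by (simp add: norm_L2_def)

lemma norm_L2_sq: "(norm_L2 M f)\<^sup>2 = (LINT x|M. (cmod (f x))\<^sup>2)"
  by (simp add: norm_L2_def)

text \<open>Integrability of the product comes first: it identifies the Bochner integral of the
  modulus with the nonnegative integral, to which Cauchy-Schwarz is applied.\<close>

lemma L2_Cauchy_Schwarz:
  assumes f: "f \<in> L2_space M" and h: "h \<in> L2_space M"
  shows L2_integrable_mult: "integrable M (\<lambda>x. f x * h x)"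
    and L2_integral_norm_mult: "(LINT x|M. cmod (f x * h x)) \<le> norm_L2 M f * norm_L2 M h"
proof -
  note [measurable] = L2_space_measurable[OF f] L2_space_measurable[OF h]
  show 1: "integrable M (\<lambda>x. f x * h x)"
  proof (rule Bochner_Integration.integrable_bound)
    show "integrable M (\<lambda>x. (cmod (f x))\<^sup>2 + (cmod (h x))\<^sup>2)"
      using f h by (intro Bochner_Integration.integrable_add L2_space_integrable)
    show "AE x in M. norm (f x * h x) \<le> norm ((cmod (f x))\<^sup>2 + (cmod (h x))\<^sup>2)"
    proof (intro AE_I2)
      fix x
      have "2 * (cmod (f x) * cmod (h x)) \<le> (cmod (f x))\<^sup>2 + (cmod (h x))\<^sup>2"
        using sum_squares_bound[of "cmod (f x)" "cmod (h x)"] by (simp add: mult.assoc)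
      moreover have "0 \<le> cmod (f x) * cmod (h x)" by simp
      ultimately show "norm (f x * h x) \<le> norm ((cmod (f x))\<^sup>2 + (cmod (h x))\<^sup>2)"
        unfolding norm_mult real_norm_def by linarith
    qed
  qed measurable
  have "ennreal ((LINT x|M. cmod (f x * h x))\<^sup>2) = (\<integral>\<^sup>+x. ennreal (cmod (f x)) * ennreal (cmod (h x)) \<partial>M)\<^sup>2"
    using nn_integral_eq_integral[OF integrable_norm[OF 1]]
    by (simp add: norm_mult ennreal_mult flip: ennreal_power)
  also have "\<dots> \<le> (\<integral>\<^sup>+x. (ennreal (cmod (f x)))\<^sup>2 \<partial>M) * (\<integral>\<^sup>+x. (ennreal (cmod (h x)))\<^sup>2 \<partial>M)"
    by (rule Cauchy_Schwarz_nn_integral) measurable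
  also have "\<dots> = ennreal ((norm_L2 M f)\<^sup>2) * ennreal ((norm_L2 M h)\<^sup>2)"
    using L2_space_integrable[OF f] L2_space_integrable[OF h]
    by (simp add: ennreal_power nn_integral_eq_integral norm_L2_sq)
  also have "\<dots> = ennreal ((norm_L2 M f * norm_L2 M h)\<^sup>2)"
    by (simp add: ennreal_mult power_mult_distrib)
  finally have "(LINT x|M. cmod (f x * h x))\<^sup>2 \<le> (norm_L2 M f * norm_L2 M h)\<^sup>2"
    by simp
  then show "(LINT x|M. cmod (f x * h x)) \<le> norm_L2 M f * norm_L2 M h"
    by (rule power2_le_imp_le) simp
qed

lemma L2_norm_integral_mult:
  assumes "f \<in> L2_space M" "h \<in> L2_space M"
  shows "cmod (LINT x|M. f x * h x) \<le> norm_L2 M f * norm_L2 M h"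
  using L2_integral_norm_mult[OF assms] integral_norm_bound[of M "\<lambda>x. f x * h x"] by linarith

text \<open>Serves sums as well as the Neumann series: \<open>N f\<close> differs from
  \<open>f\<close> by at most a multiple of the weight \<open>w\<close>, which places it in
  \<open>L2_space\<close> without a limit in norm.\<close>

lemma L2_space_dominated:
  assumes h: "h \<in> borel_measurable M" and f: "f \<in> L2_space M"
    and w: "w \<in> borel_measurable M" "integrable M (\<lambda>x. (w x)\<^sup>2)"
    and le: "AE x in M. cmod (h x) \<le> a * cmod (f x) + b * w x"
  shows "h \<in> L2_space M"
    and "(norm_L2 M h)\<^sup>2 \<le> 2 * a\<^sup>2 * (norm_L2 M f)\<^sup>2 + 2 * b\<^sup>2 * (LINT x|M. (w x)\<^sup>2)"
proof -
  note [measurable] = h w(1) L2_space_measurable[OF f]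
  have int: "integrable M (\<lambda>x. 2 * a\<^sup>2 * (cmod (f x))\<^sup>2 + 2 * b\<^sup>2 * (w x)\<^sup>2)"
    using L2_space_integrable[OF f] w(2) by simp
  have le': "AE x in M. (cmod (h x))\<^sup>2 \<le> 2 * a\<^sup>2 * (cmod (f x))\<^sup>2 + 2 * b\<^sup>2 * (w x)\<^sup>2"
    using le
  proof eventually_elim
    case (elim x)
    have "(cmod (h x))\<^sup>2 \<le> (a * cmod (f x) + b * w x)\<^sup>2"
      using elim by (intro power_mono) auto
    also have "\<dots> \<le> 2 * (a * cmod (f x))\<^sup>2 + 2 * (b * w x)\<^sup>2"
      using sum_squares_bound[of "a * cmod (f x)" "b * w x"] by (simp add: power2_sum)
    finally show ?case by (simp add: power_mult_distrib)
  qed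
  have int': "integrable M (\<lambda>x. (cmod (h x))\<^sup>2)"
    by (rule Bochner_Integration.integrable_bound[OF int]) (use le' in auto)
  then show "h \<in> L2_space M" using h by (intro L2_spaceI)
  have "(LINT x|M. (cmod (h x))\<^sup>2) \<le> (LINT x|M. 2 * a\<^sup>2 * (cmod (f x))\<^sup>2 + 2 * b\<^sup>2 * (w x)\<^sup>2)"
    by (intro integral_mono_AE int int' le')
  also have "\<dots> = 2 * a\<^sup>2 * (norm_L2 M f)\<^sup>2 + 2 * b\<^sup>2 * (LINT x|M. (w x)\<^sup>2)"
    using L2_space_integrable[OF f] w(2) by (simp add: norm_L2_sq)
  finally show "(norm_L2 M h)\<^sup>2 \<le> 2 * a\<^sup>2 * (norm_L2 M f)\<^sup>2 + 2 * b\<^sup>2 * (LINT x|M. (w x)\<^sup>2)"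
    by (simp add: norm_L2_sq)
qed

lemma L2_space_add:
  assumes "f \<in> L2_space M" "h \<in> L2_space M"
  shows "(\<lambda>x. f x + h x) \<in> L2_space M"
proof (rule L2_space_dominated(1))
  note [measurable] = L2_space_measurable[OF assms(1)] L2_space_measurable[OF assms(2)]
  show "(\<lambda>x. f x + h x) \<in> borel_measurable M" "(\<lambda>x. cmod (h x)) \<in> borel_measurable M" by measurable
  show "AE x in M. cmod (f x + h x) \<le> 1 * cmod (f x) + 1 * cmod (h x)"
    by (simp add: norm_triangle_ineq)
qed (use assms in \<open>auto dest: L2_space_integrable\<close>)

lemma L2_space_cmult:
  assumes "f \<in> L2_space M"
  shows "(\<lambda>x. c * f x) \<in> L2_space M"
  using assms by (auto simp: L2_space_def norm_mult power_mult_distrib)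

lemma L2_space_diff:
  assumes "f \<in> L2_space M" "h \<in> L2_space M"
  shows "(\<lambda>x. f x - h x) \<in> L2_space M"
  using L2_space_add[OF assms(1) L2_space_cmult[OF assms(2), of "-1"]] by simp

lemma norm_L2_cmult: "norm_L2 M (\<lambda>x. c * f x) = cmod c * norm_L2 M f"
  by (simp add: norm_L2_def norm_mult power_mult_distrib real_sqrt_mult)

lemma norm_L2_triangle:
  assumes f: "f \<in> L2_space M" and h: "h \<in> L2_space M"
  shows "norm_L2 M (\<lambda>x. f x + h x) \<le> norm_L2 M f + norm_L2 M h"
proof (rule power2_le_imp_le)
  note int = L2_space_integrable[OF f] L2_space_integrable[OF h] integrable_norm[OF L2_integrable_mult[OF f h]]
  have "(norm_L2 M (\<lambda>x. f x + h x))\<^sup>2 \<le> (LINT x|M. (cmod (f x))\<^sup>2 + (cmod (h x))\<^sup>2 + 2 * cmod (f x * h x))"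
    unfolding norm_L2_sq
  proof (intro integral_mono L2_space_integrable L2_space_add f h)
    show "(cmod (f x + h x))\<^sup>2 \<le> (cmod (f x))\<^sup>2 + (cmod (h x))\<^sup>2 + 2 * cmod (f x * h x)" for x
      using power_mono[OF norm_triangle_ineq[of "f x" "h x"], of 2] by (simp add: power2_sum norm_mult mult.assoc)
  qed (use int in auto)
  also have "\<dots> \<le> (norm_L2 M f + norm_L2 M h)\<^sup>2"
    using int L2_integral_norm_mult[OF f h] by (simp add: power2_sum norm_L2_sq)
  finally show "(norm_L2 M (\<lambda>x. f x + h x))\<^sup>2 \<le> (norm_L2 M f + norm_L2 M h)\<^sup>2" .
qed simp

lemma norm_L2_eq_0D:
  assumes "f \<in> L2_space M" "norm_L2 M f = 0"
  shows "AE x in M. f x = 0"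
  using assms integral_nonneg_eq_0_iff_AE[OF L2_space_integrable[OF assms(1)]]
  by (simp add: norm_L2_def)

lemma norm_L2_AE_0:
  assumes "AE x in M. f x = 0"
  shows "norm_L2 M f = 0"
proof -
  have "(LINT x|M. (cmod (f x))\<^sup>2) = 0"
    using assms by (intro integral_eq_zero_AE) auto
  then show ?thesis by (simp add: norm_L2_def)
qed

section \<open>Kernels dominated by a square integrable weight\<close>

definition kernel_op :: "'a measure \<Rightarrow> ('a \<Rightarrow> 'a \<Rightarrow> complex) \<Rightarrow> ('a \<Rightarrow> complex) \<Rightarrow> 'a \<Rightarrow> complex" where
  "kernel_op M m f = (\<lambda>x. LINT y|M. m x y * f y)"

definition neumann :: "'a measure \<Rightarrow> ('a \<Rightarrow> 'a \<Rightarrow> complex) \<Rightarrow> ('a \<Rightarrow> complex) \<Rightarrow> 'a \<Rightarrow> complex" where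
  "neumann M m f = (\<lambda>x. \<Sum>n. (kernel_op M m ^^ n) f x)"

text \<open>Each row \<open>m x\<close> has norm at most \<open>w x\<close>, for every point
  \<open>x\<close> and not merely almost every one. This is a Hilbert-Schmidt condition that also
  gives \<open>T f\<close> a controlled value at every point, so the later identities hold pointwise
  on the space.\<close>

locale dominated_kernel = sigma_finite_measure M for M :: "'a measure" +
  fixes m :: "'a \<Rightarrow> 'a \<Rightarrow> complex" and w :: "'a \<Rightarrow> real"
  assumes kernel_measurable [measurable]: "(\<lambda>(x, y). m x y) \<in> borel_measurable (M \<Otimes>\<^sub>M M)"
    and w_measurable [measurable]: "w \<in> borel_measurable M"
    and w_nonneg: "0 \<le> w x"
    and w_integrable: "integrable M (\<lambda>x. (w x)\<^sup>2)"
    and kernel_integrable: "x \<in> space M \<Longrightarrow> integrable M (\<lambda>y. (cmod (m x y))\<^sup>2)"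
    and kernel_bound: "x \<in> space M \<Longrightarrow> (LINT y|M. (cmod (m x y))\<^sup>2) \<le> (w x)\<^sup>2"
begin

definition \<omega> :: real where "\<omega> = sqrt (LINT x|M. (w x)\<^sup>2)"

lemma \<omega>_nonneg [simp]: "0 \<le> \<omega>"
  by (simp add: \<omega>_def)

lemma \<omega>_sq: "\<omega>\<^sup>2 = (LINT x|M. (w x)\<^sup>2)"
  by (simp add: \<omega>_def)

lemma w_L2: "(\<lambda>x. complex_of_real (w x)) \<in> L2_space M"
  using w_integrable by (auto intro!: L2_spaceI)

lemma kernel_L2:
  assumes "x \<in> space M"
  shows "m x \<in> L2_space M" "norm_L2 M (m x) \<le> w x"
proof -
  have "m x \<in> borel_measurable M"
    using measurable_Pair2[OF kernel_measurable assms] by simp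
  then show "m x \<in> L2_space M"
    using kernel_integrable[OF assms] by (rule L2_spaceI)
  show "norm_L2 M (m x) \<le> w x"
    using kernel_bound[OF assms] w_nonneg[of x] by (simp add: norm_L2_def real_le_lsqrt)
qed

abbreviation T where "T \<equiv> kernel_op M m"

lemma T_integrable:
  assumes "f \<in> L2_space M" "x \<in> space M"
  shows "integrable M (\<lambda>y. m x y * f y)"
  using L2_integrable_mult[OF kernel_L2(1)[OF assms(2)] assms(1)] .

lemma T_integral_norm:
  assumes "f \<in> L2_space M" "x \<in> space M"
  shows "(LINT y|M. cmod (m x y * f y)) \<le> w x * norm_L2 M f"
  using L2_integral_norm_mult[OF kernel_L2(1)[OF assms(2)] assms(1)]
    mult_right_mono[OF kernel_L2(2)[OF assms(2)], of "norm_L2 M f"] by simp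

lemma T_bound:
  assumes "f \<in> L2_space M" "x \<in> space M"
  shows "cmod (T f x) \<le> w x * norm_L2 M f"
  unfolding kernel_op_def by (rule order_trans[OF integral_norm_bound T_integral_norm[OF assms]])

lemma T_measurable:
  assumes "f \<in> borel_measurable M"
  shows "T f \<in> borel_measurable M"
  unfolding kernel_op_def using assms by measurable

lemma T_L2:
  assumes "f \<in> L2_space M"
  shows "T f \<in> L2_space M" "norm_L2 M (T f) \<le> \<omega> * norm_L2 M f"
proof -
  note [measurable] = L2_space_measurable[OF assms]
  have le: "(cmod (T f x))\<^sup>2 \<le> (w x)\<^sup>2 * (norm_L2 M f)\<^sup>2" if "x \<in> space M" for x
    using power_mono[OF T_bound[OF assms that], of 2] by (simp add: power_mult_distrib)
  have meas: "T f \<in> borel_measurable M"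
    by (rule T_measurable) measurable
  have int: "integrable M (\<lambda>x. (w x)\<^sup>2 * (norm_L2 M f)\<^sup>2)"
    using w_integrable by simp
  have int': "integrable M (\<lambda>x. (cmod (T f x))\<^sup>2)"
    by (rule Bochner_Integration.integrable_bound[OF int]) (use le meas in auto)
  with meas show "T f \<in> L2_space M" by (rule L2_spaceI)
  have "(LINT x|M. (cmod (T f x))\<^sup>2) \<le> (LINT x|M. (w x)\<^sup>2 * (norm_L2 M f)\<^sup>2)"
    by (intro integral_mono int int' le)
  also have "\<dots> = (\<omega> * norm_L2 M f)\<^sup>2"
    by (simp add: power_mult_distrib \<omega>_sq)
  finally show "norm_L2 M (T f) \<le> \<omega> * norm_L2 M f"
    by (simp add: norm_L2_def[of M "T f"] real_le_lsqrt)
qed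

lemma T_iter_L2:
  assumes "f \<in> L2_space M"
  shows "(T ^^ n) f \<in> L2_space M \<and> norm_L2 M ((T ^^ n) f) \<le> \<omega> ^ n * norm_L2 M f"
proof (induction n)
  case (Suc n)
  have "norm_L2 M (T ((T ^^ n) f)) \<le> \<omega> * norm_L2 M ((T ^^ n) f)"
    using Suc T_L2 by blast
  also have "\<dots> \<le> \<omega> * (\<omega> ^ n * norm_L2 M f)"
    using Suc by (intro mult_left_mono) auto
  finally show ?case
    using Suc T_L2 by (simp add: mult.assoc)
qed (use assms in simp)

text \<open>The outermost application converts the norm of the inner iterate into a pointwise bound,
  hence \<open>Suc n\<close> on the left against the power \<open>n\<close> on the right.\<close>

lemma T_iter_bound:
  assumes "f \<in> L2_space M" "x \<in> space M"
  shows "cmod ((T ^^ Suc n) f x) \<le> w x * norm_L2 M f * \<omega> ^ n"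
proof -
  have "cmod ((T ^^ Suc n) f x) \<le> w x * norm_L2 M ((T ^^ n) f)"
    using T_bound[OF conjunct1[OF T_iter_L2[OF assms(1)]] assms(2)] by simp
  also have "\<dots> \<le> w x * (\<omega> ^ n * norm_L2 M f)"
    using T_iter_L2[OF assms(1)] w_nonneg by (intro mult_left_mono) auto
  finally show ?thesis by (simp add: mult_ac)
qed

lemma T_add:
  assumes "f \<in> L2_space M" "h \<in> L2_space M" "x \<in> space M"
  shows "T (\<lambda>y. f y + h y) x = T f x + T h x"
  using T_integrable[OF assms(1,3)] T_integrable[OF assms(2,3)]
  by (simp add: kernel_op_def distrib_left)

lemma T_cmult: "T (\<lambda>y. c * f y) x = c * T f x"
  by (simp add: kernel_op_def mult.left_commute)

text \<open>Integrals see only the space, so the images coincide even outside it. Identities known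
  on \<open>space M\<close> thereby pass through further applications of \<open>T\<close>.\<close>

lemma T_cong:
  assumes "\<And>x. x \<in> space M \<Longrightarrow> f x = h x"
  shows "T f = T h"
  unfolding kernel_op_def by (intro ext Bochner_Integration.integral_cong) (auto simp: assms)

lemma T_iter_cmult: "(T ^^ n) (\<lambda>y. c * f y) x = c * (T ^^ n) f x"
proof (induction n arbitrary: x)
  case (Suc n)
  have "(T ^^ n) (\<lambda>y. c * f y) = (\<lambda>y. c * (T ^^ n) f y)"
    using Suc by blast
  then show ?case by (simp add: T_cmult)
qed simp

lemma T_iter_add:
  assumes "f \<in> L2_space M" "h \<in> L2_space M" "x \<in> space M"
  shows "(T ^^ n) (\<lambda>y. f y + h y) x = (T ^^ n) f x + (T ^^ n) h x"
  using assms(3)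
proof (induction n arbitrary: x)
  case (Suc n)
  have "T ((T ^^ n) (\<lambda>y. f y + h y)) = T (\<lambda>y. (T ^^ n) f y + (T ^^ n) h y)"
    by (rule T_cong) (use Suc in auto)
  then show ?case using Suc.prems T_iter_L2 assms by (simp add: T_add)
qed simp

end

section \<open>Neumann series of a small kernel\<close>

locale small_kernel = dominated_kernel +
  assumes \<omega>_less_1: "\<omega> < 1"
begin

abbreviation N where "N \<equiv> neumann M m"

lemma summable_geom: "summable (\<lambda>n. c * \<omega> ^ n)"
  using \<omega>_less_1 by (intro summable_mult summable_geometric) simp

lemma N_summable_norm:
  assumes "f \<in> L2_space M" "x \<in> space M"
  shows "summable (\<lambda>n. cmod ((T ^^ n) f x))"
\<comment> \<open>The zeroth iterate is \<open>f x\<close> itself, over which \<open>w\<close> has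
  no control; the geometric comparison starts at the first iterate.\<close>
proof (subst summable_Suc_iff[symmetric], rule summable_comparison_test')
  show "summable (\<lambda>n. w x * norm_L2 M f * \<omega> ^ n)" by (rule summable_geom)
  show "norm (cmod ((T ^^ Suc n) f x)) \<le> w x * norm_L2 M f * \<omega> ^ n" for n
    using T_iter_bound[OF assms] by simp
qed

lemmas N_summable = summable_norm_cancel[OF N_summable_norm]

lemma N_split:
  assumes "f \<in> L2_space M" "x \<in> space M"
  shows "N f x = f x + (\<Sum>n. (T ^^ Suc n) f x)"
  using suminf_split_head[OF N_summable[OF assms]] by (simp add: neumann_def)

lemma N_bound:
  assumes "f \<in> L2_space M" "x \<in> space M"
  shows "cmod (N f x - f x) \<le> w x * norm_L2 M f / (1 - \<omega>)"
proof -
  have s: "summable (\<lambda>n. cmod ((T ^^ Suc n) f x))"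
    by (subst summable_Suc_iff) (rule N_summable_norm[OF assms])
  have "cmod (\<Sum>n. (T ^^ Suc n) f x) \<le> (\<Sum>n. cmod ((T ^^ Suc n) f x))"
    by (rule summable_norm[OF s])
  also have "\<dots> \<le> (\<Sum>n. w x * norm_L2 M f * \<omega> ^ n)"
    by (intro suminf_le s summable_geom T_iter_bound assms)
  also have "\<dots> = w x * norm_L2 M f / (1 - \<omega>)"
    using \<omega>_less_1 by (subst suminf_mult) (auto simp: suminf_geometric summable_geometric)
  finally show ?thesis by (simp add: N_split[OF assms])
qed

lemma N_measurable:
  assumes "f \<in> L2_space M"
  shows "N f \<in> borel_measurable M"
proof -
  have [measurable]: "(T ^^ n) f \<in> borel_measurable M" for n
    using T_iter_L2[OF assms] L2_space_measurable by blast
  show ?thesis unfolding neumann_def by measurable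
qed

lemma N_L2:
  assumes "f \<in> L2_space M"
  shows "N f \<in> L2_space M"
    and "(norm_L2 M (N f))\<^sup>2 \<le> (2 + 2 * (\<omega> / (1 - \<omega>))\<^sup>2) * (norm_L2 M f)\<^sup>2"
proof -
  have le: "AE x in M. cmod (N f x) \<le> 1 * cmod (f x) + (norm_L2 M f / (1 - \<omega>)) * w x"
  proof (intro AE_I2)
    fix x assume "x \<in> space M"
    from N_bound[OF assms this] norm_triangle_sub[of "N f x" "f x"]
    show "cmod (N f x) \<le> 1 * cmod (f x) + (norm_L2 M f / (1 - \<omega>)) * w x" by (simp add: mult_ac)
  qed
  note * = L2_space_dominated[OF N_measurable[OF assms] assms w_measurable w_integrable le]
  show "N f \<in> L2_space M" by (fact *(1))
  show "(norm_L2 M (N f))\<^sup>2 \<le> (2 + 2 * (\<omega> / (1 - \<omega>))\<^sup>2) * (norm_L2 M f)\<^sup>2"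
    using *(2) by (simp add: \<omega>_sq[symmetric] algebra_simps power_divide)
qed

text \<open>A row may be integrated against the series term by term, as the integrals of the moduli
  are dominated by a geometric series; this shifts the index by one. Hence \<open>N\<close> is a
  right inverse of \<open>1 - T\<close>.\<close>

lemma T_N:
  assumes f: "f \<in> L2_space M" and x: "x \<in> space M"
  shows "T (N f) x = N f x - f x"
proof -
  let ?g = "\<lambda>n y. m x y * (T ^^ n) f y"
  have int: "integrable M (?g n)" for n
    using T_integrable[OF _ x] T_iter_L2[OF f] by blast
  have sum1: "AE y in M. summable (\<lambda>n. norm (?g n y))"
    using N_summable_norm[OF f] by (auto simp: norm_mult intro!: summable_mult)
  have sum2: "summable (\<lambda>n. LINT y|M. norm (?g n y))"
  proof (rule summable_comparison_test')
    show "summable (\<lambda>n. w x * norm_L2 M f * \<omega> ^ n)" by (rule summable_geom)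
    show "norm (LINT y|M. norm (?g n y)) \<le> w x * norm_L2 M f * \<omega> ^ n" for n
    proof -
      have "(LINT y|M. norm (?g n y)) \<le> w x * norm_L2 M ((T ^^ n) f)"
        using T_integral_norm[OF _ x] T_iter_L2[OF f] by blast
      also have "\<dots> \<le> w x * (\<omega> ^ n * norm_L2 M f)"
        using T_iter_L2[OF f] w_nonneg by (intro mult_left_mono) auto
      finally show ?thesis by (simp add: mult_ac)
    qed
  qed
  have "T (N f) x = (LINT y|M. (\<Sum>n. ?g n y))"
    unfolding kernel_op_def neumann_def
    by (intro Bochner_Integration.integral_cong refl suminf_mult[symmetric] N_summable[unfolded kernel_op_def] f)
  also have "\<dots> = (\<Sum>n. LINT y|M. ?g n y)"
    by (rule integral_suminf[OF int sum1 sum2])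
  also have "\<dots> = (\<Sum>n. (T ^^ Suc n) f x)"
    by (simp add: kernel_op_def)
  finally show ?thesis by (simp add: N_split[OF f x])
qed

text \<open>The series telescopes, and its terms tend to 0 because the series for \<open>f\<close>
  converges. Hence \<open>N\<close> is also a left inverse of \<open>1 - T\<close>.\<close>

lemma N_minus_T:
  assumes f: "f \<in> L2_space M" and x: "x \<in> space M"
  shows "N (\<lambda>y. f y - T f y) x = f x"
proof -
  have "(T ^^ n) (\<lambda>y. f y - T f y) x = (T ^^ n) f x - (T ^^ Suc n) f x" for n
    using T_iter_add[OF f L2_space_cmult[OF T_L2(1)[OF f], of "-1"] x, of n]
      T_iter_cmult[of n "-1" "T f" x] by (simp add: funpow_swap1)
  then have "N (\<lambda>y. f y - T f y) x = (\<Sum>n. (T ^^ n) f x - (T ^^ Suc n) f x)"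
    by (simp add: neumann_def)
  also have "\<dots> = f x"
    using telescope_sums'[OF summable_LIMSEQ_zero[OF N_summable[OF f x]]]
    by (simp add: sums_iff)
  finally show ?thesis .
qed

lemma N_add:
  assumes "f \<in> L2_space M" "h \<in> L2_space M" "x \<in> space M"
  shows "N (\<lambda>y. f y + h y) x = N f x + N h x"
  unfolding neumann_def using suminf_add[OF N_summable N_summable] assms
  by (simp add: T_iter_add)

lemma N_cmult:
  assumes "f \<in> L2_space M" "x \<in> space M"
  shows "N (\<lambda>y. c * f y) x = c * N f x"
  unfolding neumann_def using suminf_mult[OF N_summable] assms
  by (simp add: T_iter_cmult)

end

section \<open>Rank one perturbations\<close>

lemma norm_L2_le_imp_bounded:
  assumes "\<And>f. f \<in> L2_space M \<Longrightarrow> (norm_L2 M (T f))\<^sup>2 \<le> C * (norm_L2 M f)\<^sup>2"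
  shows "\<exists>C. \<forall>f\<in>L2_space M. norm_L2 M (T f) \<le> C * norm_L2 M f"
proof (intro exI ballI)
  fix f assume f: "f \<in> L2_space M"
  have "(norm_L2 M (T f))\<^sup>2 \<le> \<bar>C\<bar> * (norm_L2 M f)\<^sup>2"
    by (rule order_trans[OF assms[OF f]]) (simp add: mult_right_mono)
  also have "\<dots> = (sqrt \<bar>C\<bar> * norm_L2 M f)\<^sup>2"
    by (simp add: power_mult_distrib)
  finally show "norm_L2 M (T f) \<le> sqrt \<bar>C\<bar> * norm_L2 M f"
    by (rule power2_le_imp_le) simp
qed

context small_kernel
begin

lemma T_bounded: "bounded_operator_L2 M T"
  unfolding bounded_operator_L2_def
  using T_L2 by (auto simp: T_add T_cmult intro!: exI[of _ \<omega>])

lemma N_bounded: "bounded_operator_L2 M N"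
  unfolding bounded_operator_L2_def
  using N_L2 by (auto simp: N_add N_cmult intro!: norm_L2_le_imp_bounded)

end

text \<open>One shape for two operators: the rank one perturbation itself, with
  \<open>A = T\<close>, and its inverse, with \<open>A = N\<close>. In the inverse the functional is
  composed with \<open>N\<close>, so \<open>l\<close> is kept abstract instead of being an
  integral.\<close>

lemma bounded_operator_L2_add_functional:
  assumes A: "bounded_operator_L2 M A" and u: "u \<in> L2_space M"
    and l_add: "\<And>f h. \<lbrakk>f \<in> L2_space M; h \<in> L2_space M\<rbrakk> \<Longrightarrow> l (\<lambda>y. f y + h y) = l f + l h"
    and l_cmult: "\<And>f c. f \<in> L2_space M \<Longrightarrow> l (\<lambda>y. c * f y) = c * l f"
    and l_le: "\<And>f. f \<in> L2_space M \<Longrightarrow> cmod (l f) \<le> B * norm_L2 M f"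
  shows "bounded_operator_L2 M (\<lambda>f x. a * f x + b * A f x + l f * u x)"
proof -
  obtain C where A_L2: "\<And>f. f \<in> L2_space M \<Longrightarrow> A f \<in> L2_space M"
    and A_add: "\<And>f h. f \<in> L2_space M \<Longrightarrow> h \<in> L2_space M \<Longrightarrow> AE x in M. A (\<lambda>y. f y + h y) x = A f x + A h x"
    and A_cmult: "\<And>f c. f \<in> L2_space M \<Longrightarrow> AE x in M. A (\<lambda>y. c * f y) x = c * A f x"
    and C: "\<And>f. f \<in> L2_space M \<Longrightarrow> norm_L2 M (A f) \<le> C * norm_L2 M f"
    using A unfolding bounded_operator_L2_def by blast
  let ?B = "\<lambda>f x. a * f x + b * A f x + l f * u x"
  have L2: "?B f \<in> L2_space M" if "f \<in> L2_space M" for f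
    by (intro L2_space_add L2_space_cmult that A_L2 u)
  have le: "norm_L2 M (?B f) \<le> (cmod a + cmod b * C + B * norm_L2 M u) * norm_L2 M f"
    if f: "f \<in> L2_space M" for f
  proof -
    have "norm_L2 M (?B f) \<le> norm_L2 M (\<lambda>x. a * f x + b * A f x) + norm_L2 M (\<lambda>x. l f * u x)"
      by (intro norm_L2_triangle L2_space_add L2_space_cmult f A_L2 u)
    also have "\<dots> \<le> norm_L2 M (\<lambda>x. a * f x) + norm_L2 M (\<lambda>x. b * A f x) + norm_L2 M (\<lambda>x. l f * u x)"
      by (intro add_right_mono norm_L2_triangle L2_space_cmult f A_L2)
    also have "\<dots> = cmod a * norm_L2 M f + cmod b * norm_L2 M (A f) + cmod (l f) * norm_L2 M u"
      by (simp add: norm_L2_cmult)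
    also have "\<dots> \<le> cmod a * norm_L2 M f + cmod b * (C * norm_L2 M f) + (B * norm_L2 M f) * norm_L2 M u"
      by (intro add_mono order_refl mult_left_mono mult_right_mono C l_le f) auto
    finally show ?thesis by (simp add: algebra_simps)
  qed
  have add: "AE x in M. ?B (\<lambda>y. f y + h y) x = ?B f x + ?B h x" if "f \<in> L2_space M" "h \<in> L2_space M" for f h
    using A_add[OF that] by eventually_elim (simp add: l_add[OF that] algebra_simps)
  have cm: "AE x in M. ?B (\<lambda>y. k * f y) x = k * ?B f x" if "f \<in> L2_space M" for f k
    using A_cmult[OF that, of k] by eventually_elim (simp add: l_cmult[OF that] algebra_simps)
  show ?thesis
    unfolding bounded_operator_L2_def using L2 add cm le by blast
qed

text \<open>Outside \<open>L2_space\<close> and outside the space the values of an operator are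
  arbitrary, so formulas determine it only there. The almost everywhere clauses transfer because
  sums and multiples stay in \<open>L2_space\<close>.\<close>

lemma bounded_operator_L2_cong:
  assumes "bounded_operator_L2 M A" and "\<And>f x. f \<in> L2_space M \<Longrightarrow> x \<in> space M \<Longrightarrow> B f x = A f x"
  shows "bounded_operator_L2 M B"
proof -
  have 1: "B f \<in> L2_space M \<longleftrightarrow> A f \<in> L2_space M" if "f \<in> L2_space M" for f
    using assms(2)[OF that] by (simp add: L2_space_def cong: measurable_cong Bochner_Integration.integrable_cong)
  have 2: "norm_L2 M (B f) = norm_L2 M (A f)" if "f \<in> L2_space M" for f
    using assms(2)[OF that] by (simp add: norm_L2_def cong: Bochner_Integration.integral_cong)
  have 3: "(AE x in M. B (\<lambda>y. f y + h y) x = B f x + B h x) \<longleftrightarrow> (AE x in M. A (\<lambda>y. f y + h y) x = A f x + A h x)"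
    if "f \<in> L2_space M" "h \<in> L2_space M" for f h
    using that by (intro AE_cong) (simp add: assms(2) L2_space_add)
  have 4: "(AE x in M. B (\<lambda>y. c * f y) x = c * B f x) \<longleftrightarrow> (AE x in M. A (\<lambda>y. c * f y) x = c * A f x)"
    if "f \<in> L2_space M" for f c
    using that by (intro AE_cong) (simp add: assms(2) L2_space_cmult)
  show ?thesis
    using assms(1) unfolding bounded_operator_L2_def by (simp add: 1 2 3 4)
qed

text \<open>
  With \<open>N = (1 - T)\<^sup>-\<^sup>1\<close>, the operator is \<open>(1 - T) (1 - c N u \<otimes> v)\<close>, which is invertible iff
  \<open>1 - c \<langle>v, N u\<rangle>\<close> is nonzero (Sherman--Morrison).
\<close>

lemma (in small_kernel) boundedly_invertible_rank_one_iff: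
  assumes u: "u \<in> L2_space M" and v: "v \<in> L2_space M"
    and A: "\<And>f x. f \<in> L2_space M \<Longrightarrow> x \<in> space M \<Longrightarrow>
              A f x = f x - T f x - c * u x * (LINT y|M. v y * f y)"
  shows "boundedly_invertible_L2 M A \<longleftrightarrow> c * (LINT x|M. v x * N u x) \<noteq> 1"
proof -
  define l where "l f = (LINT y|M. v y * f y)" for f
  have l_diff: "l (\<lambda>y. f y - h y) = l f - l h" if "f \<in> L2_space M" "h \<in> L2_space M" for f h
    using L2_integrable_mult[OF v] that by (simp add: l_def right_diff_distrib)
  have l_add: "l (\<lambda>y. f y + h y) = l f + l h" if "f \<in> L2_space M" "h \<in> L2_space M" for f h
    using L2_integrable_mult[OF v] that by (simp add: l_def distrib_left)
  have l_cmult: "l (\<lambda>y. c * f y) = c * l f" for f c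
    by (simp add: l_def mult.left_commute)
  have A': "A f x = f x - T f x - c * u x * l f" if "f \<in> L2_space M" "x \<in> space M" for f x
    using A[OF that] by (simp add: l_def)
  have bA: "bounded_operator_L2 M A"
  proof (rule bounded_operator_L2_cong)
    show "bounded_operator_L2 M (\<lambda>f x. 1 * f x + (-1) * T f x + (- c * l f) * u x)"
      using L2_norm_integral_mult[OF v]
      by (intro bounded_operator_L2_add_functional[where B = "cmod c * norm_L2 M v"] T_bounded u)
        (auto simp: l_add l_cmult norm_mult mult.assoc distrib_left l_def[symmetric] intro!: mult_left_mono)
  qed (simp add: A')
  define d where "d = 1 - c * l (N u)"
  have Nu: "N u \<in> L2_space M" by (rule N_L2(1)[OF u])
  show ?thesis
  proof (cases "d = 0")
    case True
    \<comment> \<open>For \<open>d = 0\<close> the function \<open>N u\<close> lies in the kernel of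
      \<open>A\<close>.\<close>
    have AN: "A (N u) x = 0" if "x \<in> space M" for x
      using True by (simp add: A'[OF Nu that] T_N[OF u that] d_def algebra_simps)
    have "\<not> boundedly_invertible_L2 M A"
    proof
      assume "boundedly_invertible_L2 M A"
      then obtain R where R: "bounded_operator_L2 M R"
        and RA: "\<And>f. f \<in> L2_space M \<Longrightarrow> AE x in M. R (A f) x = f x"
        unfolding boundedly_invertible_L2_def by blast
      obtain C where C: "\<And>f. f \<in> L2_space M \<Longrightarrow> norm_L2 M (R f) \<le> C * norm_L2 M f"
        and R_L2: "\<And>f. f \<in> L2_space M \<Longrightarrow> R f \<in> L2_space M"
        using R unfolding bounded_operator_L2_def by blast
      have ANu: "A (N u) \<in> L2_space M"
        using bA Nu unfolding bounded_operator_L2_def by blast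
      \<comment> \<open>A bounded left inverse sends the null function \<open>A (N u)\<close> to a
        null function, so \<open>N u\<close> vanishes almost everywhere; then
        \<open>l (N u) = 0\<close>, that is \<open>d = 1\<close>.\<close>
      have "norm_L2 M (A (N u)) = 0"
        by (rule norm_L2_AE_0) (simp add: AN)
      then have "norm_L2 M (R (A (N u))) = 0"
        using C[OF ANu] norm_L2_nonneg[of M "R (A (N u))"] by simp
      from norm_L2_eq_0D[OF R_L2[OF ANu] this] RA[OF Nu]
      have "AE x in M. v x * N u x = 0" by eventually_elim simp
      then have "l (N u) = 0" unfolding l_def by (rule integral_eq_zero_AE)
      with True show False by (simp add: d_def)
    qed
    with True show ?thesis by (simp add: d_def l_def)
  next
    case False
    \<comment> \<open>The inverse of \<open>1 - c N u \<otimes> v\<close> by the Sherman-Morrison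
      formula, applied to \<open>N f\<close>.\<close>
    define R where "R f x = N f x + c / d * N u x * l (N f)" for f x
    have R_L2: "R f \<in> L2_space M" if "f \<in> L2_space M" for f
    proof -
      have "(\<lambda>x. N f x + (c / d * l (N f)) * N u x) \<in> L2_space M"
        by (intro L2_space_add L2_space_cmult N_L2(1) that u)
      then show ?thesis unfolding R_def by (simp add: mult_ac)
    qed
    have lR: "l (R f) = l (N f) / d" if f: "f \<in> L2_space M" for f
    proof -
      have "l (R f) = l (\<lambda>x. N f x + (c / d * l (N f)) * N u x)"
        by (simp add: R_def[abs_def] mult_ac)
      also have "\<dots> = l (N f) + c / d * l (N f) * l (N u)"
        using l_add[OF N_L2(1)[OF f] L2_space_cmult[OF Nu, of "c / d * l (N f)"]]
        by (simp only: l_cmult)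
      also have "\<dots> = l (N f) / d"
        using False by (simp add: d_def field_simps)
      finally show ?thesis .
    qed
    have AR: "A (R f) x = f x" if f: "f \<in> L2_space M" and x: "x \<in> space M" for f x
    proof -
      have "T (R f) x = T (\<lambda>x. N f x + (c / d * l (N f)) * N u x) x"
        by (simp add: R_def[abs_def] mult_ac)
      also have "\<dots> = (N f x - f x) + (c / d * l (N f)) * (N u x - u x)"
        using T_add[OF N_L2(1)[OF f] L2_space_cmult[OF Nu, of "c / d * l (N f)"] x]
        by (simp only: T_cmult T_N[OF f x] T_N[OF u x])
      finally have TR: "T (R f) x = (N f x - f x) + (c / d * l (N f)) * (N u x - u x)" .
      have "A (R f) x = (N f x + c / d * N u x * l (N f)) - ((N f x - f x) + (c / d * l (N f)) * (N u x - u x))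
          - c * u x * (l (N f) / d)"
        by (simp only: A'[OF R_L2[OF f] x] lR[OF f] TR) (simp add: R_def)
      also have "\<dots> = f x" by (simp add: algebra_simps diff_divide_distrib)
      finally show ?thesis .
    qed
    have RA: "R (A f) x = f x" if f: "f \<in> L2_space M" and x: "x \<in> space M" for f x
    proof -
      let ?h = "\<lambda>y. (f y - T f y) + (- c * l f) * u y"
      have fT: "(\<lambda>y. f y - T f y) \<in> L2_space M"
        by (intro L2_space_diff f T_L2(1))
      have N1: "N (A f) y = f y + (- c * l f) * N u y" if y: "y \<in> space M" for y
      proof -
        have "T (A f) = T ?h" by (rule T_cong) (simp add: A' f)
        \<comment> \<open>\<open>A f\<close> and \<open>?h\<close> agree on the space only: the
          zeroth power uses this at \<open>y\<close>, all others the equality of the images under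
          \<open>T\<close>.\<close>
        then have "(T ^^ n) (A f) y = (T ^^ n) ?h y" for n
          using A'[OF f y] by (cases n) (auto simp: funpow_Suc_right simp del: funpow.simps)
        then have "N (A f) y = N ?h y" by (simp add: neumann_def)
        also have "\<dots> = f y + (- c * l f) * N u y"
          using N_add[OF fT L2_space_cmult[OF u, of "- c * l f"] y]
          by (simp only: N_cmult[OF u y] N_minus_T[OF f y])
        finally show ?thesis .
      qed
      have "l (N (A f)) = l (\<lambda>y. f y + (- c * l f) * N u y)"
        unfolding l_def by (intro Bochner_Integration.integral_cong) (simp_all add: N1[unfolded l_def])
      also have "\<dots> = l f + - c * l f * l (N u)"
        using l_add[OF f L2_space_cmult[OF Nu, of "- c * l f"]] by (simp only: l_cmult)
      also have "\<dots> = l f * d" by (simp add: d_def algebra_simps)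
      finally show ?thesis
        using False by (simp add: R_def N1[OF x])
    qed
    have bR: "bounded_operator_L2 M R"
    proof -
      obtain C where C: "\<And>f. f \<in> L2_space M \<Longrightarrow> norm_L2 M (N f) \<le> C * norm_L2 M f"
        using N_bounded unfolding bounded_operator_L2_def by blast
      have "bounded_operator_L2 M (\<lambda>f x. 0 * f x + 1 * N f x + (c / d * l (N f)) * N u x)"
      proof (rule bounded_operator_L2_add_functional[OF N_bounded Nu, where B = "cmod (c / d) * (norm_L2 M v * C)"])
        fix f h :: "'a \<Rightarrow> complex" and k :: complex
        assume f: "f \<in> L2_space M"
        have "l (N (\<lambda>y. k * f y)) = l (\<lambda>y. k * N f y)"
          unfolding l_def by (intro Bochner_Integration.integral_cong) (simp_all add: N_cmult f)
        then show "c / d * l (N (\<lambda>y. k * f y)) = k * (c / d * l (N f))"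
          by (simp add: l_cmult)
        have "cmod (l (N f)) \<le> norm_L2 M v * norm_L2 M (N f)"
          unfolding l_def by (rule L2_norm_integral_mult[OF v N_L2(1)[OF f]])
        also have "\<dots> \<le> norm_L2 M v * (C * norm_L2 M f)"
          by (intro mult_left_mono C f) simp
        finally show "cmod (c / d * l (N f)) \<le> cmod (c / d) * (norm_L2 M v * C) * norm_L2 M f"
          unfolding norm_mult mult.assoc by (intro mult_left_mono) auto
        assume h: "h \<in> L2_space M"
        have "l (N (\<lambda>y. f y + h y)) = l (\<lambda>y. N f y + N h y)"
          unfolding l_def by (intro Bochner_Integration.integral_cong) (simp_all add: N_add f h)
        then show "c / d * l (N (\<lambda>y. f y + h y)) = c / d * l (N f) + c / d * l (N h)"
          by (simp only: l_add N_L2(1) f h distrib_left)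
      qed
      then show ?thesis by (simp add: R_def[abs_def] mult_ac)
    qed
    have "boundedly_invertible_L2 M A"
      unfolding boundedly_invertible_L2_def using bA bR AR RA by (intro conjI exI[of _ R]) auto
    with False show ?thesis by (auto simp: d_def l_def)
  qed
qed

section \<open>Holomorphic dependence on a parameter\<close>

text \<open>Rounding \<open>t\<close> down to a multiple of \<open>1 / (n + 1)\<close> leaves
  countably many slices, each measurable, and continuity in \<open>t\<close> recovers
  \<open>f\<close> in the limit. This is the joint measurability that exchanging a circle integral
  with an integral over \<open>M\<close> requires.\<close>

lemma borel_measurable_Caratheodory:
  fixes f :: "real \<Rightarrow> 'a \<Rightarrow> 'b::metric_space"
  assumes cont: "\<And>y. y \<in> space M \<Longrightarrow> continuous_on UNIV (\<lambda>t. f t y)"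
    and meas: "\<And>t. f t \<in> borel_measurable M"
  shows "(\<lambda>(t, y). f t y) \<in> borel_measurable (borel \<Otimes>\<^sub>M M)"
proof (rule borel_measurable_LIMSEQ_metric)
  let ?a = "\<lambda>n t. real_of_int \<lfloor>real (Suc n) * t\<rfloor> / real (Suc n)"
  show "(\<lambda>(t, y). f (?a n t) y) \<in> borel_measurable (borel \<Otimes>\<^sub>M M)" for n
  proof -
    have "(\<lambda>p. f (real_of_int \<lfloor>real (Suc n) * fst p\<rfloor> / real (Suc n)) (snd p)) \<in> borel_measurable (borel \<Otimes>\<^sub>M M)"
      by (rule measurable_compose_countable[where f = "\<lambda>i p. f (real_of_int i / real (Suc n)) (snd p)"
            and g = "\<lambda>p. \<lfloor>real (Suc n) * fst p\<rfloor>"])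
        (use meas in measurable)
    then show ?thesis by (simp add: case_prod_beta')
  qed
  show "(\<lambda>n. (\<lambda>(t, y). f (?a n t) y) p) \<longlonglongrightarrow> (case p of (t, y) \<Rightarrow> f t y)"
    if "p \<in> space (borel \<Otimes>\<^sub>M M)" for p
  proof -
    obtain t y where p: "p = (t, y)" by (cases p)
    have y: "y \<in> space M" using that p by (simp add: space_pair_measure)
    have "(\<lambda>n. ?a n t) \<longlonglongrightarrow> t"
    proof (rule LIMSEQ_I)
      fix e :: real assume "e > 0"
      then obtain n0 where n0: "inverse (real (Suc n0)) < e" using reals_Archimedean by blast
      have "norm (?a n t - t) < e" if "n \<ge> n0" for n
      proof -
        have "norm (?a n t - t) = \<bar>real_of_int \<lfloor>real (Suc n) * t\<rfloor> - real (Suc n) * t\<bar> / real (Suc n)"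
        proof -
          have "?a n t - t = (real_of_int \<lfloor>real (Suc n) * t\<rfloor> - real (Suc n) * t) / real (Suc n)"
            by (simp add: diff_divide_distrib del: of_nat_Suc)
          then show ?thesis by (simp only: real_norm_def abs_divide abs_of_nat)
        qed
        also have "\<dots> \<le> inverse (real (Suc n))"
        proof -
          have "\<bar>real_of_int \<lfloor>real (Suc n) * t\<rfloor> - real (Suc n) * t\<bar> \<le> 1" by linarith
          then show ?thesis by (simp add: divide_right_mono inverse_eq_divide)
        qed
        also have "\<dots> \<le> inverse (real (Suc n0))" using that by simp
        finally show ?thesis using n0 by simp
      qed
      then show "\<exists>no. \<forall>n\<ge>no. norm (?a n t - t) < e" by blast
    qed
    then have "(\<lambda>n. (\<lambda>t. f t y) (?a n t)) \<longlonglongrightarrow> (\<lambda>t. f t y) t"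
    proof (rule isCont_tendsto_compose[rotated])
      show "isCont (\<lambda>t. f t y) t"
        using cont[OF y] by (simp add: continuous_on_eq_continuous_at)
    qed
    then show ?thesis unfolding p prod.case .
  qed
qed

text \<open>Subtracting the Cauchy formulas at \<open>w\<close> and \<open>z\<close> leaves the
  factor \<open>(w - z) / ((\<zeta> - w) (\<zeta> - z))\<close>, where \<open>\<zeta> - w\<close>
  has modulus at least \<open>r / 2\<close> on the circle. The mean of the modulus of
  \<open>g\<close>, not its maximum, is kept on the right, since a mean can be integrated in a
  further variable by Tonelli.\<close>

lemma holomorphic_difference_bound:
  assumes hol: "g holomorphic_on cball z r" and r: "r > 0" and w: "dist z w \<le> r / 2"
  shows "cmod (g w - g z) \<le> 2 / r * cmod (w - z) * integral {0..1} (\<lambda>t. cmod (g (circlepath z r t)))"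
proof -
  let ?c = "circlepath z r"
  have w': "cmod (w - z) \<le> r / 2" using w by (simp add: dist_norm norm_minus_commute)
  have "((\<lambda>u. g u / (u - w) - g u / (u - z)) has_contour_integral
      (2 * of_real pi * \<i> * g w - 2 * of_real pi * \<i> * g z)) ?c"
    by (intro has_contour_integral_diff Cauchy_integral_circlepath_simple hol) (use w' r in auto)
  then have has: "((\<lambda>t. (g (?c t) / (?c t - w) - g (?c t) / (?c t - z)) * vector_derivative ?c (at t within {0..1}))
      has_integral (2 * of_real pi * \<i> * (g w - g z))) {0..1}"
    by (simp add: has_contour_integral_def right_diff_distrib)
  have cont: "continuous_on {0..1} (\<lambda>t. cmod (g (?c t)))"
  proof (intro continuous_intros)
    show "continuous_on {0..1} (\<lambda>t. g (?c t))"
    proof (rule continuous_on_compose2[OF holomorphic_on_imp_continuous_on[OF hol]])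
      show "continuous_on {0..1} ?c" unfolding circlepath by (intro continuous_intros)
      show "?c ` {0..1} \<subseteq> cball z r" using r by (auto simp: circlepath dist_norm norm_mult)
    qed
  qed
  have "cmod (2 * of_real pi * \<i> * (g w - g z)) \<le>
      integral {0..1} (\<lambda>t. 2 * pi * (2 / r * cmod (w - z)) * cmod (g (?c t)))"
  proof (subst integral_unique[OF has, symmetric], intro integral_norm_bound_integral)
    show "(\<lambda>t. 2 * pi * (2 / r * cmod (w - z)) * cmod (g (?c t))) integrable_on {0..1}"
      by (intro integrable_continuous_interval continuous_intros cont)
    fix t :: real assume t: "t \<in> {0..1}"
    have n: "cmod (?c t - z) = r" using r by (simp add: circlepath norm_mult)
    have n2: "r / 2 \<le> cmod (?c t - w)"
      using norm_triangle_ineq[of "?c t - w" "w - z"] w' n by simp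
    have ne: "?c t \<noteq> z" "?c t \<noteq> w" using n n2 r by auto
    have eq: "g (?c t) / (?c t - w) - g (?c t) / (?c t - z) = g (?c t) * (w - z) / ((?c t - w) * (?c t - z))"
      using ne by (simp add: field_simps)
    have d: "cmod (vector_derivative ?c (at t within {0..1})) = 2 * pi * r"
      using t r by (simp add: vector_derivative_circlepath01 norm_mult)
    have "cmod ((g (?c t) / (?c t - w) - g (?c t) / (?c t - z)) * vector_derivative ?c (at t within {0..1}))
        = cmod (g (?c t)) * cmod (w - z) / (cmod (?c t - w) * r) * (2 * pi * r)"
      by (simp add: eq norm_mult norm_divide n d)
    also have "\<dots> = cmod (g (?c t)) * cmod (w - z) * (2 * pi) / cmod (?c t - w)"
      using r by simp
    also have "\<dots> \<le> cmod (g (?c t)) * cmod (w - z) * (2 * pi) / (r / 2)"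
      using n2 r ne by (intro divide_left_mono mult_pos_pos) auto
    finally show "cmod ((g (?c t) / (?c t - w) - g (?c t) / (?c t - z)) * vector_derivative ?c (at t within {0..1}))
       \<le> 2 * pi * (2 / r * cmod (w - z)) * cmod (g (?c t))"
      by (simp add: field_simps)
  qed (use has in \<open>auto intro: has_integral_integrable\<close>)
  also have "\<dots> = 2 * pi * (2 / r * cmod (w - z) * integral {0..1} (\<lambda>t. cmod (g (?c t))))"
    by (simp add: integral_mult_right mult.assoc)
  also have "cmod (2 * of_real pi * \<i> * (g w - g z)) = 2 * pi * cmod (g w - g z)"
    by (simp add: norm_mult)
  finally show ?thesis by (rule mult_left_le_imp_le) simp
qed

text \<open>
  No domination uniform in the parameter is required: the difference quotients at \<open>z\<close> are dominated
  by the average of \<open>\<bar>f\<bar>\<close> over a circle about \<open>z\<close>, which is integrable by Tonelli.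
\<close>

lemma holomorphic_on_lebesgue_integral:
  fixes f :: "complex \<Rightarrow> 'a \<Rightarrow> complex"
  assumes "sigma_finite_measure M" and D: "open D"
    and hol: "\<And>y. y \<in> space M \<Longrightarrow> (\<lambda>z. f z y) holomorphic_on D"
    and int: "\<And>z. z \<in> D \<Longrightarrow> integrable M (f z)"
    and bound: "\<And>z. z \<in> D \<Longrightarrow> (LINT y|M. cmod (f z y)) \<le> B"
  shows "(\<lambda>z. LINT y|M. f z y) holomorphic_on D"
proof -
  interpret sigma_finite_measure M by fact
  interpret P: pair_sigma_finite lborel M by unfold_locales
  have "\<exists>F'. ((\<lambda>z. LINT y|M. f z y) has_field_derivative F') (at z)" if z: "z \<in> D" for z
  proof -
    obtain r where r: "r > 0" and rD: "cball z r \<subseteq> D"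
      using D z open_contains_cball by blast
    define c where "c = circlepath z r"
    have cD: "c t \<in> D" for t
      using rD r by (auto simp: c_def circlepath dist_norm norm_mult subset_iff)
    have c_cont: "continuous_on UNIV c" unfolding c_def circlepath by (intro continuous_intros)
    have fc_cont: "continuous_on UNIV (\<lambda>t. f (c t) y)" if "y \<in> space M" for y
      by (rule continuous_on_compose2[OF holomorphic_on_imp_continuous_on[OF hol[OF that]] c_cont]) (use cD in auto)
    have [measurable]: "(\<lambda>(t, y). f (c t) y) \<in> borel_measurable (borel \<Otimes>\<^sub>M M)"
      using int cD by (intro borel_measurable_Caratheodory fc_cont) auto
    define H where "H y = integral {0..1} (\<lambda>t. cmod (f (c t) y))" for y
    have H_eq: "ennreal (H y) = (\<integral>\<^sup>+t. indicator {0..1} t * ennreal (cmod (f (c t) y)) \<partial>lborel)" if "y \<in> space M" for y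
    proof -
      have "((\<lambda>t. cmod (f (c t) y)) has_integral H y) {0..1}"
        unfolding H_def by (intro integrable_integral integrable_continuous_interval continuous_intros
            continuous_on_subset[OF fc_cont[OF that]]) simp
      moreover have "(\<lambda>t. cmod (f (c t) y)) \<in> borel_measurable borel"
        by (intro borel_measurable_continuous_onI continuous_intros fc_cont that)
      ultimately have "(\<integral>\<^sup>+t. ennreal (cmod (f (c t) y)) * indicator {0..1} t \<partial>lborel) = ennreal (H y)"
        by (intro nn_integral_has_integral_lebesgue') auto
      then show ?thesis by (simp add: mult.commute)
    qed
    have H_nonneg: "0 \<le> H y" for y
      unfolding H_def by (cases "(\<lambda>t. cmod (f (c t) y)) integrable_on {0..1}")
        (auto intro: Henstock_Kurzweil_Integration.integral_nonneg simp: not_integrable_integral)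
    have H_meas [measurable]: "H \<in> borel_measurable M"
    proof -
      have "(\<lambda>y. enn2real (\<integral>\<^sup>+t. indicator {0..1} t * ennreal (cmod (f (c t) y)) \<partial>lborel)) \<in> borel_measurable M"
        by measurable
      also have "?this \<longleftrightarrow> ?thesis"
        by (intro measurable_cong) (simp add: H_eq[symmetric] H_nonneg)
      finally show ?thesis .
    qed
    have H_int: "integrable M H"
    proof (rule integrableI_bounded)
      have "(\<integral>\<^sup>+y. ennreal (norm (H y)) \<partial>M) =
          (\<integral>\<^sup>+y. (\<integral>\<^sup>+t. indicator {0..1} t * ennreal (cmod (f (c t) y)) \<partial>lborel) \<partial>M)"
        by (intro nn_integral_cong) (simp add: H_eq[symmetric] H_nonneg)
      also have "\<dots> = (\<integral>\<^sup>+t. (\<integral>\<^sup>+y. indicator {0..1} t * ennreal (cmod (f (c t) y)) \<partial>M) \<partial>lborel)"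
        by (rule P.Fubini') measurable
      also have "\<dots> \<le> (\<integral>\<^sup>+(t::real). indicator {0..1} t * ennreal B \<partial>lborel)"
      proof (intro nn_integral_mono)
        fix t
        have "(\<integral>\<^sup>+y. ennreal (cmod (f (c t) y)) \<partial>M) = ennreal (LINT y|M. cmod (f (c t) y))"
          by (rule nn_integral_eq_integral) (use int cD in auto)
        also have "\<dots> \<le> ennreal B" by (intro ennreal_leI bound cD)
        finally show "(\<integral>\<^sup>+y. indicator {0..1} t * ennreal (cmod (f (c t) y)) \<partial>M) \<le> indicator {0..1} t * ennreal B"
          by (auto split: split_indicator)
      qed
      also have "\<dots> = ennreal B"
        by (simp add: mult.commute[of "indicator _ _"] nn_integral_cmult)
      finally show "(\<integral>\<^sup>+y. ennreal (norm (H y)) \<partial>M) < \<infinity>"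
        by (simp add: top.not_eq_extremum le_less_trans)
    qed simp
    define F' where "F' = (LINT y|M. deriv (\<lambda>z. f z y) z)"
    \<comment> \<open>Dominated convergence works along sequences, so the limit is tested on
      sequences; the radius \<open>r / 2\<close> is the range of
      \<open>holomorphic_difference_bound\<close>.\<close>
    have "((\<lambda>w. ((LINT y|M. f w y) - (LINT y|M. f z y)) / (w - z)) \<longlongrightarrow> F') (at z within ball z (r/2))"
      unfolding tendsto_at_iff_sequentially
    proof (intro allI impI)
      fix X :: "nat \<Rightarrow> complex"
      assume X: "\<forall>i. X i \<in> ball z (r/2) - {z}" and lim: "X \<longlonglongrightarrow> z"
      have XD: "X i \<in> D" "dist z (X i) \<le> r / 2" "X i \<noteq> z" for i
        using X[rule_format, of i] rD r by (auto simp: subset_iff dist_commute)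
      have quot: "(\<lambda>i. LINT y|M. (f (X i) y - f z y) / (X i - z)) \<longlonglongrightarrow> F'"
        unfolding F'_def
      proof (rule integral_dominated_convergence[where w = "\<lambda>y. 2 / r * H y"])
        show "integrable M (\<lambda>y. 2 / r * H y)" using H_int by simp
        have l: "(\<lambda>i. (f (X i) y - f z y) / (X i - z)) \<longlonglongrightarrow> deriv (\<lambda>z. f z y) z" if "y \<in> space M" for y
        proof -
          have "((\<lambda>z. f z y) has_field_derivative deriv (\<lambda>z. f z y) z) (at z)"
            by (rule holomorphic_derivI[OF hol[OF that] D z])
          then have "((\<lambda>w. (f w y - f z y) / (w - z)) \<longlongrightarrow> deriv (\<lambda>z. f z y) z) (at z)"
            by (simp add: has_field_derivative_iff)
          then show ?thesis
            using XD lim by (auto simp: tendsto_at_iff_sequentially o_def)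
        qed
        then show "AE y in M. (\<lambda>i. (f (X i) y - f z y) / (X i - z)) \<longlonglongrightarrow> deriv (\<lambda>z. f z y) z" by simp
        have [measurable]: "f (X i) \<in> borel_measurable M" "f z \<in> borel_measurable M" for i
          using int XD z by auto
        show "(\<lambda>y. (f (X i) y - f z y) / (X i - z)) \<in> borel_measurable M" for i by measurable
        \<comment> \<open>The derivative in the parameter is measurable in \<open>y\<close> as a
          pointwise limit of difference quotients.\<close>
        show "(\<lambda>y. deriv (\<lambda>z. f z y) z) \<in> borel_measurable M"
          by (rule borel_measurable_LIMSEQ_metric[OF _ l]) measurable
        show "AE y in M. norm ((f (X i) y - f z y) / (X i - z)) \<le> 2 / r * H y" for i
        proof (intro AE_I2)
          fix y assume y: "y \<in> space M"
          have "cmod (f (X i) y - f z y) \<le> 2 / r * cmod (X i - z) * H y"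
            unfolding H_def c_def
            by (intro holomorphic_difference_bound holomorphic_on_subset[OF hol[OF y] rD] r XD)
          then show "norm ((f (X i) y - f z y) / (X i - z)) \<le> 2 / r * H y"
            using XD(3)[of i] by (simp add: norm_divide divide_le_eq mult_ac)
        qed
      qed
      have eq: "(LINT y|M. (f (X i) y - f z y) / (X i - z)) =
          ((LINT y|M. f (X i) y) - (LINT y|M. f z y)) / (X i - z)" for i
        by (simp only: integral_divide_zero Bochner_Integration.integral_diff[OF int[OF XD(1), of i] int[OF z]])
      from quot[unfolded eq] show "((\<lambda>w. ((LINT y|M. f w y) - (LINT y|M. f z y)) / (w - z)) \<circ> X) \<longlonglongrightarrow> F'"
        unfolding o_def .
    qed
    then have "((\<lambda>z. LINT y|M. f z y) has_field_derivative F') (at z within ball z (r/2))"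
      by (simp add: has_field_derivative_iff)
    moreover have "at z within ball z (r/2) = at z"
      using r by (intro at_within_open) auto
    ultimately show ?thesis by (intro exI[of _ F']) simp
  qed
  then show ?thesis by (auto simp: holomorphic_on_open[OF D])
qed

lemma holomorphic_on_suminf:
  fixes f :: "nat \<Rightarrow> complex \<Rightarrow> complex"
  assumes D: "open D" and hol: "\<And>i. f i holomorphic_on D"
    and "summable c" and "\<And>i z. z \<in> D \<Longrightarrow> cmod (f i z) \<le> c i"
  shows "(\<lambda>z. \<Sum>i. f i z) holomorphic_on D"
proof (rule holomorphic_uniform_sequence[OF D])
  have lim: "uniform_limit D (\<lambda>n z. \<Sum>i<n. f i z) (\<lambda>z. \<Sum>i. f i z) sequentially"
    using assms(3,4) by (intro Weierstrass_m_test)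
  show "(\<lambda>z. \<Sum>i<n. f i z) holomorphic_on D" for n by (intro holomorphic_on_sum hol)
  show "\<exists>d>0. cball z d \<subseteq> D \<and> uniform_limit (cball z d) (\<lambda>n z. \<Sum>i<n. f i z) (\<lambda>z. \<Sum>i. f i z) sequentially"
    if "z \<in> D" for z
    using D that lim by (meson open_contains_cball uniform_limit_on_subset)
qed

lemma holomorphic_on_csqrt_Re_pos:
  assumes hol: "f holomorphic_on D" and pos: "\<And>z. z \<in> D \<Longrightarrow> 0 < Re (f z)"
  shows "(\<lambda>z. csqrt (f z)) holomorphic_on D"
proof (rule holomorphic_on_compose_gen[OF hol holomorphic_on_csqrt, unfolded o_def])
  show "f ` D \<subseteq> - \<real>\<^sub>\<le>\<^sub>0"
  proof
    fix w assume "w \<in> f ` D"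
    then have "0 < Re w" using pos by blast
    then show "w \<in> - \<real>\<^sub>\<le>\<^sub>0" by (simp add: complex_nonpos_Reals_iff)
  qed
qed

text \<open>Under each integral \<open>b y * a y = 1\<close> cancels, so every iterate of the
  conjugated kernel is \<open>a\<close> times the original one. With plane waves for
  \<open>a\<close> and \<open>b\<close> this removes all dependence on \<open>k\<close> except that
  through \<open>\<kappa>\<close> and the symbol.\<close>

lemma neumann_conjugate:
  assumes "\<And>x. a x * b x = 1" and "summable (\<lambda>n. (kernel_op M m ^^ n) f x)"
  shows "neumann M (\<lambda>x y. a x * m x y * b y) (\<lambda>x. a x * f x) x = a x * neumann M m f x"
proof -
  have 1: "kernel_op M (\<lambda>x y. a x * m x y * b y) (\<lambda>x. a x * h x) = (\<lambda>x. a x * kernel_op M m h x)" for h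
  proof
    fix x
    have "a x * m x y * b y * (a y * h y) = a x * (m x y * h y)" for y
      using assms(1)[of y] by (metis (no_types, lifting) mult.assoc mult.left_commute mult.right_neutral)
    then show "kernel_op M (\<lambda>x y. a x * m x y * b y) (\<lambda>x. a x * h x) x = a x * kernel_op M m h x"
      by (simp only: kernel_op_def integral_mult_right_zero)
  qed
  have 2: "(kernel_op M (\<lambda>x y. a x * m x y * b y) ^^ n) (\<lambda>x. a x * f x) = (\<lambda>x. a x * (kernel_op M m ^^ n) f x)" for n
    by (induction n) (simp_all add: 1)
  show ?thesis
    using assms(2) by (simp add: neumann_def 2 suminf_mult)
qed

section \<open>Matrix elements of the Neumann series\<close>

context small_kernel
begin

text \<open>Turns the matrix element into a numerical series of iterated integrals; holomorphy and
  reality are checked on its terms and passed to the sum.\<close>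

lemma sums_integral_N:
  assumes f: "f \<in> L2_space M" and v: "v \<in> L2_space M"
  shows "(\<lambda>n. LINT x|M. v x * (T ^^ n) f x) sums (LINT x|M. v x * N f x)"
proof -
  have int: "integrable M (\<lambda>x. v x * (T ^^ n) f x)" for n
    using L2_integrable_mult[OF v] T_iter_L2[OF f] by blast
  have 1: "AE x in M. summable (\<lambda>n. norm (v x * (T ^^ n) f x))"
    using N_summable_norm[OF f] by (auto simp: norm_mult intro!: summable_mult)
  have 2: "summable (\<lambda>n. LINT x|M. norm (v x * (T ^^ n) f x))"
  proof (rule summable_comparison_test')
    show "summable (\<lambda>n. norm_L2 M v * norm_L2 M f * \<omega> ^ n)" by (rule summable_geom)
    show "norm (LINT x|M. norm (v x * (T ^^ n) f x)) \<le> norm_L2 M v * norm_L2 M f * \<omega> ^ n" for n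
    proof -
      have "(LINT x|M. norm (v x * (T ^^ n) f x)) \<le> norm_L2 M v * norm_L2 M ((T ^^ n) f)"
        using L2_integral_norm_mult[OF v] T_iter_L2[OF f] by blast
      also have "\<dots> \<le> norm_L2 M v * (\<omega> ^ n * norm_L2 M f)"
        using T_iter_L2[OF f] by (intro mult_left_mono) auto
      finally show ?thesis by (simp add: mult_ac)
    qed
  qed
  have "(LINT x|M. (\<Sum>n. v x * (T ^^ n) f x)) = (LINT x|M. v x * N f x)"
    unfolding neumann_def by (intro Bochner_Integration.integral_cong refl suminf_mult N_summable f)
  then show ?thesis using sums_integral[OF int 1 2] by simp
qed

text \<open>The difference \<open>N f - f\<close> begins with the first iterate and so carries a
  factor \<open>\<omega>\<close>. This first-order smallness confines \<open>Phi\<close> to a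
  neighbourhood of \<open>b * Q\<close>.\<close>

lemma integral_N_bound:
  assumes f: "f \<in> L2_space M" and v: "v \<in> L2_space M"
  shows "cmod ((LINT x|M. v x * N f x) - (LINT x|M. v x * f x)) \<le> norm_L2 M v * norm_L2 M f * (\<omega> / (1 - \<omega>))"
proof -
  let ?d = "\<lambda>x. N f x - f x"
  have d: "?d \<in> L2_space M" by (intro L2_space_diff N_L2 f)
  have "(LINT x|M. v x * N f x) - (LINT x|M. v x * f x) = (LINT x|M. v x * ?d x)"
    using L2_integrable_mult[OF v N_L2(1)[OF f]] L2_integrable_mult[OF v f]
    by (simp add: right_diff_distrib)
  also have "cmod \<dots> \<le> norm_L2 M v * norm_L2 M ?d"
    by (rule L2_norm_integral_mult[OF v d])
  also have "\<dots> \<le> norm_L2 M v * (norm_L2 M f / (1 - \<omega>) * \<omega>)"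
  proof (intro mult_left_mono norm_L2_nonneg)
    have "(LINT x|M. (cmod (?d x))\<^sup>2) \<le> (LINT x|M. (norm_L2 M f / (1 - \<omega>))\<^sup>2 * (w x)\<^sup>2)"
    proof (intro integral_mono L2_space_integrable d)
      show "integrable M (\<lambda>x. (norm_L2 M f / (1 - \<omega>))\<^sup>2 * (w x)\<^sup>2)" using w_integrable by simp
      show "(cmod (?d x))\<^sup>2 \<le> (norm_L2 M f / (1 - \<omega>))\<^sup>2 * (w x)\<^sup>2" if "x \<in> space M" for x
        using power_mono[OF N_bound[OF f that], of 2] by (simp add: power_mult_distrib power_divide mult_ac)
    qed
    also have "\<dots> = (norm_L2 M f / (1 - \<omega>) * \<omega>)\<^sup>2"
      by (simp only: power_mult_distrib \<omega>_sq integral_mult_right_zero)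
    finally show "norm_L2 M ?d \<le> norm_L2 M f / (1 - \<omega>) * \<omega>"
      using \<omega>_less_1 by (simp add: norm_L2_def[of M ?d] real_le_lsqrt)
  qed
  finally show ?thesis by (simp only: times_divide_eq_left times_divide_eq_right)
qed

end

text \<open>One weight \<open>w\<close> serves for all parameters: it bounds every iterated integral
  uniformly in \<open>z\<close>, so that holomorphy passes through the integrals, and majorizes the
  Neumann series by a geometric one.\<close>

lemma holomorphic_on_neumann:
  fixes m :: "complex \<Rightarrow> 'a \<Rightarrow> 'a \<Rightarrow> complex"
  assumes D: "open D"
    and kernel: "\<And>z. z \<in> D \<Longrightarrow> small_kernel M (m z) w"
    and hol: "\<And>x y. x \<in> space M \<Longrightarrow> y \<in> space M \<Longrightarrow> (\<lambda>z. m z x y) holomorphic_on D"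
    and f: "f \<in> L2_space M" and v: "v \<in> L2_space M"
  shows "(\<lambda>z. LINT x|M. v x * neumann M (m z) f x) holomorphic_on D"
proof (cases "D = {}")
  case True
  then show ?thesis by (simp add: holomorphic_on_def ball_empty)
next
  case False
  \<comment> \<open>The point \<open>z0\<close> gives access to the facts free of the parameter:
    sigma-finiteness and \<open>K0.\<omega>\<close>, a number determined by
    \<open>w\<close>.\<close>
  then obtain z0 where "z0 \<in> D" by blast
  then interpret K0: small_kernel M "m z0" w by (rule kernel)
  have sf: "sigma_finite_measure M" by unfold_locales
  have iter: "(\<lambda>z. (kernel_op M (m z) ^^ n) f x) holomorphic_on D" if "x \<in> space M" for n x
    using that
  proof (induction n arbitrary: x)
    case (Suc n)
    show ?case unfolding funpow.simps o_def kernel_op_def[of M _ "(kernel_op M _ ^^ n) f"]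
    proof (rule holomorphic_on_lebesgue_integral[OF sf D])
      show "(\<lambda>z. m z x y * (kernel_op M (m z) ^^ n) f y) holomorphic_on D" if "y \<in> space M" for y
        using Suc that by (intro holomorphic_intros hol)
      fix z assume "z \<in> D"
      then interpret K: small_kernel M "m z" w by (rule kernel)
      show "integrable M (\<lambda>y. m z x y * (kernel_op M (m z) ^^ n) f y)"
        using K.T_integrable Suc.prems K.T_iter_L2[OF f] by blast
      have "(LINT y|M. cmod (m z x y * (kernel_op M (m z) ^^ n) f y)) \<le> w x * norm_L2 M ((K.T ^^ n) f)"
        using K.T_integral_norm Suc.prems K.T_iter_L2[OF f] by blast
      also have "\<dots> \<le> w x * (K0.\<omega> ^ n * norm_L2 M f)"
        using K.T_iter_L2[OF f, of n] K.w_nonneg[of x] by (intro mult_left_mono) (auto simp: K.\<omega>_def K0.\<omega>_def)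
      finally show "(LINT y|M. cmod (m z x y * (kernel_op M (m z) ^^ n) f y)) \<le> w x * (K0.\<omega> ^ n * norm_L2 M f)" .
    qed
  qed simp
  have coeff: "(\<lambda>z. LINT x|M. v x * (kernel_op M (m z) ^^ n) f x) holomorphic_on D" for n
  proof (rule holomorphic_on_lebesgue_integral[OF sf D])
    show "(\<lambda>z. v x * (kernel_op M (m z) ^^ n) f x) holomorphic_on D" if "x \<in> space M" for x
      using that by (intro holomorphic_intros iter)
    fix z assume "z \<in> D"
    then interpret K: small_kernel M "m z" w by (rule kernel)
    show "integrable M (\<lambda>x. v x * (kernel_op M (m z) ^^ n) f x)"
      using L2_integrable_mult[OF v] K.T_iter_L2[OF f] by blast
    have "(LINT x|M. cmod (v x * (K.T ^^ n) f x)) \<le> norm_L2 M v * norm_L2 M ((K.T ^^ n) f)"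
      using L2_integral_norm_mult[OF v] K.T_iter_L2[OF f] by blast
    also have "\<dots> \<le> norm_L2 M v * (K0.\<omega> ^ n * norm_L2 M f)"
      using K.T_iter_L2[OF f, of n] by (intro mult_left_mono) (auto simp: K.\<omega>_def K0.\<omega>_def)
    finally show "(LINT x|M. cmod (v x * (K.T ^^ n) f x)) \<le> norm_L2 M v * (K0.\<omega> ^ n * norm_L2 M f)" .
  qed
  have "(\<lambda>z. \<Sum>n. LINT x|M. v x * (kernel_op M (m z) ^^ n) f x) holomorphic_on D"
  proof (rule holomorphic_on_suminf[OF D coeff])
    show "summable (\<lambda>n. norm_L2 M v * norm_L2 M f * K0.\<omega> ^ n)" by (rule K0.summable_geom)
    fix n z assume "z \<in> D"
    then interpret K: small_kernel M "m z" w by (rule kernel)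
    have "cmod (LINT x|M. v x * (K.T ^^ n) f x) \<le> norm_L2 M v * norm_L2 M ((K.T ^^ n) f)"
      using L2_norm_integral_mult[OF v] K.T_iter_L2[OF f] by blast
    also have "\<dots> \<le> norm_L2 M v * (K0.\<omega> ^ n * norm_L2 M f)"
      using K.T_iter_L2[OF f, of n] by (intro mult_left_mono) (auto simp: K.\<omega>_def K0.\<omega>_def)
    finally show "cmod (LINT x|M. v x * (K.T ^^ n) f x) \<le> norm_L2 M v * norm_L2 M f * K0.\<omega> ^ n"
      by (simp add: mult_ac)
  qed
  also have "?this \<longleftrightarrow> ?thesis"
  proof (intro holomorphic_cong refl)
    fix z assume "z \<in> D"
    then interpret K: small_kernel M "m z" w by (rule kernel)
    show "(\<Sum>n. LINT x|M. v x * (K.T ^^ n) f x) = (LINT x|M. v x * neumann M (m z) f x)"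
      using K.sums_integral_N[OF f v] by (simp add: sums_iff)
  qed
  finally show ?thesis .
qed

text \<open>By Fubini \<open>T\<close> is symmetric for the pairing of \<open>h\<close> with
  \<open>cnj k\<close>. Moving the iterates across shows each term of the series to be real, and the
  real axis is closed.\<close>

lemma (in small_kernel) neumann_hermitian_real:
  assumes herm: "\<And>x y. x \<in> space M \<Longrightarrow> y \<in> space M \<Longrightarrow> m y x = cnj (m x y)"
    and f: "f \<in> L2_space M" and f_real: "\<And>x. cnj (f x) = f x"
  shows "(LINT x|M. f x * N f x) \<in> \<real>"
proof -
  interpret P: pair_sigma_finite M M by unfold_locales
  have sym: "(LINT x|M. h x * cnj (T k x)) = (LINT y|M. T h y * cnj (k y))"
    if h: "h \<in> L2_space M" and k: "k \<in> L2_space M" for h k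
  proof -
    note [measurable] = L2_space_measurable[OF h] L2_space_measurable[OF k]
    have int: "integrable (M \<Otimes>\<^sub>M M) (\<lambda>(x, y). h x * cnj (m x y * k y))"
    proof (rule P.Fubini_integrable)
      show "AE x in M. integrable M (\<lambda>y. (\<lambda>(x, y). h x * cnj (m x y * k y)) (x, y))"
        unfolding prod.case by (intro AE_I2 integrable_mult_right integrable_cnj T_integrable k)
      \<comment> \<open>By Cauchy-Schwarz in \<open>y\<close> the inner integral is at most
        \<open>w x * norm_L2 M k\<close>; what remains is a product of the square integrable
        functions \<open>h\<close> and \<open>w\<close>.\<close>
      have dom: "integrable M (\<lambda>x. cmod (h x * w x) * norm_L2 M k)"
        by (intro integrable_mult_left integrable_norm L2_integrable_mult h w_L2)
      have "integrable M (\<lambda>x. cmod (h x) * (LINT y|M. cmod (m x y * k y)))"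
      proof (rule Bochner_Integration.integrable_bound[OF dom])
        show "(\<lambda>x. cmod (h x) * (LINT y|M. cmod (m x y * k y))) \<in> borel_measurable M"
          by measurable
        show "AE x in M. norm (cmod (h x) * (LINT y|M. cmod (m x y * k y))) \<le> norm (cmod (h x * w x) * norm_L2 M k)"
        proof (intro AE_I2)
          fix x assume x: "x \<in> space M"
          have "cmod (h x) * (LINT y|M. cmod (m x y * k y)) \<le> cmod (h x) * (w x * norm_L2 M k)"
            by (intro mult_left_mono T_integral_norm k x) simp
          moreover have "0 \<le> (LINT y|M. cmod (m x y * k y))"
            by (intro Bochner_Integration.integral_nonneg) simp
          ultimately show "norm (cmod (h x) * (LINT y|M. cmod (m x y * k y))) \<le> norm (cmod (h x * w x) * norm_L2 M k)"
            by (simp only: real_norm_def abs_mult abs_norm_cancel norm_mult norm_of_real abs_of_nonneg w_nonneg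
                norm_L2_nonneg mult.assoc)
        qed
      qed
      then show "integrable M (\<lambda>x. LINT y|M. norm ((\<lambda>(x, y). h x * cnj (m x y * k y)) (x, y)))"
        by (simp only: prod.case norm_mult complex_mod_cnj integral_mult_right_zero)
    qed measurable
    have "(LINT x|M. h x * cnj (T k x)) = (LINT x|M. LINT y|M. h x * cnj (m x y * k y))"
      unfolding kernel_op_def by (simp only: Bochner_Integration.integral_cnj[symmetric] integral_mult_right_zero)
    also have "\<dots> = (LINT y|M. LINT x|M. h x * cnj (m x y * k y))"
      by (rule P.Fubini_integral[OF int, symmetric])
    also have "\<dots> = (LINT y|M. T h y * cnj (k y))"
    proof (intro Bochner_Integration.integral_cong refl)
      fix y assume y: "y \<in> space M"
      have "(LINT x|M. h x * cnj (m x y * k y)) = (LINT x|M. m y x * h x * cnj (k y))"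
        by (intro Bochner_Integration.integral_cong refl) (simp only: herm[OF _ y] complex_cnj_mult mult_ac)
      then show "(LINT x|M. h x * cnj (m x y * k y)) = T h y * cnj (k y)"
        by (simp only: kernel_op_def integral_mult_left_zero)
    qed
    finally show ?thesis .
  qed
  have iter: "(LINT x|M. h x * cnj ((T ^^ n) k x)) = (LINT x|M. (T ^^ n) h x * cnj (k x))"
    if "h \<in> L2_space M" "k \<in> L2_space M" for h k n
    using that
  proof (induction n arbitrary: k)
    case (Suc n)
    have "(LINT x|M. h x * cnj ((T ^^ Suc n) k x)) = (LINT x|M. h x * cnj ((T ^^ n) (T k) x))"
      by (simp add: funpow_swap1)
    also have "\<dots> = (LINT x|M. (T ^^ n) h x * cnj (T k x))"
      by (rule Suc.IH[OF Suc.prems(1) T_L2(1)[OF Suc.prems(2)]])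
    also have "\<dots> = (LINT x|M. T ((T ^^ n) h) x * cnj (k x))"
      by (rule sym[OF conjunct1[OF T_iter_L2[OF Suc.prems(1)]] Suc.prems(2)])
    finally show ?case by simp
  qed simp
  have "cnj (LINT x|M. f x * (T ^^ n) f x) = (LINT x|M. f x * (T ^^ n) f x)" for n
  proof -
    have "cnj (LINT x|M. f x * (T ^^ n) f x) = (LINT x|M. cnj (f x * (T ^^ n) f x))"
      by (rule Bochner_Integration.integral_cnj[symmetric])
    also have "\<dots> = (LINT x|M. f x * cnj ((T ^^ n) f x))"
      by (simp only: complex_cnj_mult f_real)
    also have "\<dots> = (LINT x|M. (T ^^ n) f x * f x)"
      by (simp only: iter[OF f f] f_real)
    finally show ?thesis by (simp only: mult.commute)
  qed
  then have "(LINT x|M. f x * (T ^^ n) f x) \<in> \<real>" for n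
    by (simp only: Reals_cnj_iff)
  then have "(\<Sum>i<n. LINT x|M. f x * (T ^^ i) f x) \<in> \<real>" for n
    by (intro sum_in_Reals)
  moreover have "(\<lambda>n. \<Sum>i<n. LINT x|M. f x * (T ^^ i) f x) \<longlonglongrightarrow> (LINT x|M. f x * N f x)"
    using sums_integral_N[OF f f] by (simp only: sums_def)
  ultimately show ?thesis
    by (intro Lim_in_closed_set[OF closed_complex_Reals, where F = sequentially]) auto
qed

section \<open>Holomorphic fixed points\<close>

text \<open>Holomorphy of \<open>\<Phi>\<close> is asked in \<open>k\<close> alone, for the Cauchy
  estimate, and along holomorphic functions \<open>\<kappa>\<close>, which is what keeps the
  iterates holomorphic. The whole ball is mapped into the concentric ball of radius
  \<open>\<rho> / 4\<close>, so every fixed point in the ball already lies where the map contracts.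
  Reality is stated for a single \<open>z\<close> because it will hold at real angles.\<close>

lemma holomorphic_fixed_point:
  fixes \<Phi> :: "complex \<Rightarrow> complex \<Rightarrow> complex" and \<kappa>0 :: complex
  assumes D: "open D" and \<rho>: "\<rho> > 0"
    and hol: "\<And>\<kappa>. \<lbrakk>\<kappa> holomorphic_on D; \<And>z. z \<in> D \<Longrightarrow> \<kappa> z \<in> ball \<kappa>0 \<rho>\<rbrakk> \<Longrightarrow> (\<lambda>z. \<Phi> (\<kappa> z) z) holomorphic_on D"
    and hol': "\<And>z. z \<in> D \<Longrightarrow> (\<lambda>k. \<Phi> k z) holomorphic_on ball \<kappa>0 \<rho>"
    and bound: "\<And>k z. \<lbrakk>z \<in> D; k \<in> ball \<kappa>0 \<rho>\<rbrakk> \<Longrightarrow> cmod (\<Phi> k z - \<kappa>0) \<le> \<rho> / 4"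
  obtains K where "K holomorphic_on D" "\<And>z. z \<in> D \<Longrightarrow> K z \<in> ball \<kappa>0 \<rho>"
    "\<And>z k. \<lbrakk>z \<in> D; k \<in> ball \<kappa>0 \<rho>\<rbrakk> \<Longrightarrow> \<Phi> k z = k \<longleftrightarrow> k = K z"
    "\<And>z. \<lbrakk>z \<in> D; \<kappa>0 \<in> \<real>; \<And>k. \<lbrakk>k \<in> \<real>; k \<in> ball \<kappa>0 \<rho>\<rbrakk> \<Longrightarrow> \<Phi> k z \<in> \<real>\<rbrakk> \<Longrightarrow> K z \<in> \<real>"
proof -
  let ?B = "cball \<kappa>0 (\<rho> / 4)"
  have B: "k \<in> ball \<kappa>0 \<rho>" if "k \<in> ?B" for k
    using that \<rho> by auto
  have maps: "\<Phi> k z \<in> ?B" if "z \<in> D" "k \<in> ball \<kappa>0 \<rho>" for z k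
    using bound[OF that] by (simp add: dist_norm norm_minus_commute)
  have lip: "dist (\<Phi> k z) (\<Phi> l z) \<le> 1/2 * dist k l" if z: "z \<in> D" and kl: "k \<in> ?B" "l \<in> ?B" for z k l
  proof -
    have h: "(\<lambda>k. \<Phi> k z - \<kappa>0) holomorphic_on ball \<kappa>0 \<rho>"
      by (rule holomorphic_on_diff[OF hol'[OF z] holomorphic_on_const])
    have der: "((\<lambda>k. \<Phi> k z - \<kappa>0) has_field_derivative deriv (\<lambda>k. \<Phi> k z - \<kappa>0) k) (at k within ?B)"
      if "k \<in> ?B" for k
      by (rule has_field_derivative_at_within[OF holomorphic_derivI[OF h open_ball B[OF that]]])
    have db: "cmod (deriv (\<lambda>k. \<Phi> k z - \<kappa>0) k) \<le> 1/2" if k: "k \<in> ?B" for k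
    proof -
      have sub: "cball k (\<rho> / 2) \<subseteq> ball \<kappa>0 \<rho>"
      proof
        fix x assume "x \<in> cball k (\<rho> / 2)"
        then show "x \<in> ball \<kappa>0 \<rho>"
          using k \<rho> dist_triangle[of \<kappa>0 x k] by simp
      qed
      \<comment> \<open>A circle of radius \<open>\<rho> / 2\<close> about a point of
        \<open>?B\<close> stays in the ball, so the derivative is at most
        \<open>(\<rho> / 4) / (\<rho> / 2) = 1/2\<close>.\<close>
      have "cmod ((deriv ^^ 1) (\<lambda>k. \<Phi> k z - \<kappa>0) k) \<le> fact 1 * (\<rho> / 4) / (\<rho> / 2) ^ 1"
      proof (rule Cauchy_inequality)
        show "(\<lambda>k. \<Phi> k z - \<kappa>0) holomorphic_on ball k (\<rho> / 2)"
          by (rule holomorphic_on_subset[OF h order_trans[OF ball_subset_cball sub]])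
        show "continuous_on (cball k (\<rho> / 2)) (\<lambda>k. \<Phi> k z - \<kappa>0)"
          by (rule holomorphic_on_imp_continuous_on[OF holomorphic_on_subset[OF h sub]])
        show "cmod (\<Phi> x z - \<kappa>0) \<le> \<rho> / 4" if "cmod (k - x) = \<rho> / 2" for x
          using that sub by (intro bound z) (auto simp: dist_norm subset_iff)
      qed (use \<rho> in simp)
      then show ?thesis using \<rho> by simp
    qed
    have "cmod ((\<Phi> k z - \<kappa>0) - (\<Phi> l z - \<kappa>0)) \<le> 1/2 * cmod (k - l)"
      by (rule field_differentiable_bound[OF convex_cball der db kl])
    then show ?thesis by (simp add: dist_norm)
  qed
  have "\<exists>!k. k \<in> ?B \<and> \<Phi> k z = k" if z: "z \<in> D" for z
    by (rule Banach_fix[where c = "1/2"]) (use \<rho> maps[OF z B] lip[OF z] in \<open>auto simp: complete_eq_closed\<close>)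
  then obtain K where K: "\<And>z. z \<in> D \<Longrightarrow> K z \<in> ?B" "\<And>z. z \<in> D \<Longrightarrow> \<Phi> (K z) z = K z"
    and K_uniq: "\<And>z k. \<lbrakk>z \<in> D; k \<in> ?B; \<Phi> k z = k\<rbrakk> \<Longrightarrow> k = K z"
    by metis
  define k where "k n z = ((\<lambda>k. \<Phi> k z) ^^ n) \<kappa>0" for n z
  have k0: "k 0 z = \<kappa>0" and kS: "k (Suc n) z = \<Phi> (k n z) z" for n z
    by (simp_all add: k_def)
  have kB: "k n z \<in> ?B" if "z \<in> D" for n z
  proof (induction n)
    case 0
    then show ?case using \<rho> by (simp add: k0)
  next
    case (Suc n)
    then show ?case unfolding kS by (intro maps that B)
  qed
  have k_hol: "k n holomorphic_on D" for n
  proof (induction n)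
    case 0
    then show ?case by (simp add: k0[abs_def])
  next
    case (Suc n)
    then show ?case using hol[OF Suc B[OF kB]] by (simp add: kS[abs_def])
  qed
  have k_conv: "dist (k n z) (K z) \<le> (1/2) ^ n * (\<rho> / 4)" if z: "z \<in> D" for n z
  proof (induction n)
    case 0
    then show ?case using K(1)[OF z] by (simp add: k0)
  next
    case (Suc n)
    have "dist (k (Suc n) z) (K z) = dist (\<Phi> (k n z) z) (\<Phi> (K z) z)"
      by (simp add: kS K(2)[OF z])
    also have "\<dots> \<le> 1/2 * dist (k n z) (K z)"
      by (rule lip[OF z kB[OF z] K(1)[OF z]])
    finally show ?case using Suc by simp
  qed
  have ulim: "uniform_limit D k K sequentially"
  proof (rule uniform_limitI)
    fix e :: real assume "e > 0"
    have "(\<lambda>n. (1/2) ^ n * (\<rho> / 4)) \<longlonglongrightarrow> 0 * (\<rho> / 4)"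
      by (intro tendsto_intros LIMSEQ_power_zero) simp
    then have "\<forall>\<^sub>F n in sequentially. (1/2) ^ n * (\<rho> / 4) < e"
      using \<open>e > 0\<close> by (intro order_tendstoD(2)) simp_all
    then show "\<forall>\<^sub>F n in sequentially. \<forall>x\<in>D. dist (k n x) (K x) < e"
      by eventually_elim (meson k_conv le_less_trans)
  qed
  show ?thesis
  proof
    show "K holomorphic_on D"
    proof (rule holomorphic_uniform_sequence[OF D k_hol])
      show "\<exists>d>0. cball z d \<subseteq> D \<and> uniform_limit (cball z d) k K sequentially" if "z \<in> D" for z
        using D that ulim by (meson open_contains_cball uniform_limit_on_subset)
    qed
    show "K z \<in> ball \<kappa>0 \<rho>" if "z \<in> D" for z using B K(1) that by blast
    show "\<Phi> k z = k \<longleftrightarrow> k = K z" if "z \<in> D" "k \<in> ball \<kappa>0 \<rho>" for z k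
      using K_uniq[OF that(1), of k] K(2)[OF that(1)] maps[OF that] by metis
    show "K z \<in> \<real>" if z: "z \<in> D" and r: "\<kappa>0 \<in> \<real>" and re: "\<And>k. \<lbrakk>k \<in> \<real>; k \<in> ball \<kappa>0 \<rho>\<rbrakk> \<Longrightarrow> \<Phi> k z \<in> \<real>" for z
    proof -
      have "k n z \<in> \<real>" for n
      proof (induction n)
        case 0
        then show ?case by (simp add: k0 r)
      next
        case (Suc n)
        then show ?case unfolding kS by (intro re B kB z)
      qed
      then show ?thesis
        using tendsto_uniform_limitI[OF ulim z]
        by (intro Lim_in_closed_set[OF closed_complex_Reals, where F = sequentially]) auto
    qed
  qed
qed

section \<open>Analytic polar curves\<close>

unbundle no fps_syntax

definition dir :: "real \<Rightarrow> real^2" where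
  "dir t = cos t *\<^sub>R axis 1 1 + sin t *\<^sub>R axis 2 1"

definition rot_dir :: "real \<Rightarrow> real^2" where
  "rot_dir t = - sin t *\<^sub>R axis 1 1 + cos t *\<^sub>R axis 2 1"

lemma inner_axis_12 [simp]:
  "axis 1 (1::real) \<bullet> (axis 1 1 :: real^2) = 1" "axis 2 (1::real) \<bullet> (axis 2 1 :: real^2) = 1"
  "axis 1 (1::real) \<bullet> (axis 2 1 :: real^2) = 0" "axis 2 (1::real) \<bullet> (axis 1 1 :: real^2) = 0"
  by (simp_all add: inner_axis_axis)

lemma dir_components [simp]: "dir t $ 1 = cos t" "dir t $ 2 = sin t"
  by (simp_all add: dir_def axis_def)

lemma vec2_expand: "(p::real^2) = p $ 1 *\<^sub>R axis 1 1 + p $ 2 *\<^sub>R axis 2 1"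
  by (simp add: vec_eq_iff forall_2 axis_def)

lemma inner_dir: "dir s \<bullet> dir t = cos (s - t)" "rot_dir s \<bullet> dir t = sin (t - s)"
  "dir s \<bullet> rot_dir t = sin (s - t)" "rot_dir s \<bullet> rot_dir t = cos (s - t)"
  by (simp_all add: dir_def rot_dir_def inner_add_left inner_add_right cos_diff sin_diff algebra_simps)

lemma norm_dir [simp]: "norm (dir t) = 1"
  by (simp add: norm_eq_sqrt_inner inner_dir)

lemma dir_derivative: "(dir has_vector_derivative rot_dir t) (at t within S)"
  unfolding dir_def[abs_def] rot_dir_def
  by (auto intro!: derivative_eq_intros simp: has_real_derivative_iff_has_vector_derivative[symmetric])

lemma continuous_on_dir [continuous_intros]:
  fixes f :: "real \<Rightarrow> real"
  shows "continuous_on S f \<Longrightarrow> continuous_on S (\<lambda>x. dir (f x))"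
  unfolding dir_def by (intro continuous_intros)

lemma dir_eq_iff: "dir s = dir t \<longleftrightarrow> cos s = cos t \<and> sin s = sin t"
proof
  assume "dir s = dir t"
  then show "cos s = cos t \<and> sin s = sin t" by (metis dir_components)
qed (simp add: dir_def)

lemma vec2_polar:
  obtains t where "(p::real^2) = norm p *\<^sub>R dir t"
proof -
  have n: "(norm p)\<^sup>2 = (p $ 1)\<^sup>2 + (p $ 2)\<^sup>2"
    by (simp add: norm_eq_sqrt_inner inner_vec_def sum_2 power2_eq_square)
  show ?thesis
  proof (cases "p = 0")
    case False
    then have "(p $ 1 / norm p)\<^sup>2 + (p $ 2 / norm p)\<^sup>2 = 1"
      by (simp add: power_divide add_divide_distrib[symmetric] n[symmetric])
    then obtain t where "p $ 1 / norm p = cos t" "p $ 2 / norm p = sin t"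
      by (rule sincos_total_2pi)
    then have "p = norm p *\<^sub>R dir t"
      using False by (subst vec2_expand[of p]) (simp add: dir_def scaleR_add_right field_simps)
    then show ?thesis by (rule that)
  qed (use that[of 0] in simp)
qed

text \<open>
  Analyticity of a real function is expressed by local holomorphic extensions, which are stable
  under the composition with square roots and circular functions needed below.
\<close>

definition extends_holomorphically :: "(real \<Rightarrow> real) \<Rightarrow> real \<Rightarrow> bool" where
  "extends_holomorphically h t0 \<longleftrightarrow>
     (\<exists>F e. 0 < e \<and> F holomorphic_on ball (of_real t0) e \<and> (\<forall>t. \<bar>t - t0\<bar> < e \<longrightarrow> F (of_real t) = of_real (h t)))"

lemma extends_holomorphically_mult:
  assumes "extends_holomorphically f t0" "extends_holomorphically h t0"
  shows "extends_holomorphically (\<lambda>t. f t * h t) t0"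
proof -
  obtain F d where F: "0 < d" "F holomorphic_on ball (of_real t0) d" "\<And>t. \<bar>t - t0\<bar> < d \<Longrightarrow> F (of_real t) = of_real (f t)"
    using assms(1) unfolding extends_holomorphically_def by blast
  obtain H e where H: "0 < e" "H holomorphic_on ball (of_real t0) e" "\<And>t. \<bar>t - t0\<bar> < e \<Longrightarrow> H (of_real t) = of_real (h t)"
    using assms(2) unfolding extends_holomorphically_def by blast
  have "(\<lambda>z. F z * H z) holomorphic_on ball (of_real t0) (min d e)"
    using F(2) H(2) by (intro holomorphic_on_mult) (auto elim: holomorphic_on_subset)
  then show ?thesis unfolding extends_holomorphically_def
    using F H by (intro exI[of _ "\<lambda>z. F z * H z"] exI[of _ "min d e"]) auto
qed

lemma extends_holomorphically_cos_sin:
  "extends_holomorphically cos t0" "extends_holomorphically sin t0"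
proof -
  have "cos holomorphic_on ball (complex_of_real t0) 1" "sin holomorphic_on ball (complex_of_real t0) 1"
    by (intro holomorphic_intros)+
  then show "extends_holomorphically cos t0" "extends_holomorphically sin t0"
    unfolding extends_holomorphically_def
    by (intro exI[of _ cos] exI[of _ sin] exI[of _ "1::real"]; simp add: cos_of_real sin_of_real)+
qed

text \<open>The Taylor coefficients of the extension are not shown to be real: as
  \<open>t - t0\<close> is real, the real parts of the terms already form a real power series for
  \<open>h\<close>.\<close>

lemma extends_holomorphically_power_series:
  assumes "extends_holomorphically h t0"
  obtains e a where "e > 0" "\<And>t. \<bar>t - t0\<bar> < e \<Longrightarrow> (\<lambda>n. (t - t0) ^ n * a n) sums h t"
proof -
  obtain F e where F: "0 < e" "F holomorphic_on ball (of_real t0) e" "\<And>t. \<bar>t - t0\<bar> < e \<Longrightarrow> F (of_real t) = of_real (h t)"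
    using assms unfolding extends_holomorphically_def by blast
  define c where "c n = (deriv ^^ n) F (of_real t0) / fact n" for n
  have "(\<lambda>n. (t - t0) ^ n * Re (c n)) sums h t" if t: "\<bar>t - t0\<bar> < e" for t
  proof -
    have "complex_of_real t \<in> ball (complex_of_real t0) e"
      using t by (simp add: dist_commute[of _ "of_real t"] dist_real_def)
    then have "(\<lambda>n. c n * (of_real t - of_real t0) ^ n) sums F (of_real t)"
      unfolding c_def by (rule holomorphic_power_series[OF F(2)])
    moreover have "(of_real t - of_real t0) ^ n = complex_of_real ((t - t0) ^ n)" for n
      by simp
    ultimately have "(\<lambda>n. c n * of_real ((t - t0) ^ n)) sums of_real (h t)"
      by (simp only: F(3)[OF t])
    then have "(\<lambda>n. Re (c n * of_real ((t - t0) ^ n))) sums Re (of_real (h t))"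
      by (rule sums_Re)
    moreover have "Re (z * of_real x) = x * Re z" for z x
      by simp
    ultimately show ?thesis by (simp only: Re_complex_of_real)
  qed
  then show ?thesis by (rule that[OF F(1)])
qed

lemma extends_holomorphically_differentiable:
  assumes "extends_holomorphically h t0"
  obtains h' where "(h has_vector_derivative h') (at t0)"
proof -
  obtain F e where F: "0 < e" "F holomorphic_on ball (of_real t0) e" "\<And>t. \<bar>t - t0\<bar> < e \<Longrightarrow> F (of_real t) = of_real (h t)"
    using assms unfolding extends_holomorphically_def by blast
  have "(F has_field_derivative deriv F (of_real t0)) (at (of_real t0))"
    using F by (intro holomorphic_derivI[OF F(2)]) auto
  then have "((\<lambda>t. F (of_real t)) has_vector_derivative deriv F (of_real t0)) (at t0)"
    by (rule has_vector_derivative_real_field)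
  then have "((\<lambda>t. Re (F (of_real t))) has_vector_derivative Re (deriv F (of_real t0))) (at t0)"
    by (rule bounded_linear.has_vector_derivative[OF bounded_linear_Re])
  then have "(h has_vector_derivative Re (deriv F (of_real t0))) (at t0)"
    by (rule has_vector_derivative_transform_within_open[where S = "ball t0 e"])
      (use F in \<open>auto simp: dist_real_def abs_minus_commute\<close>)
  then show ?thesis by (rule that)
qed

lemma real_analytic_on_polar:
  assumes "\<And>t. extends_holomorphically r t"
  shows "real_analytic_on (\<lambda>t. r t *\<^sub>R dir t) I"
  unfolding real_analytic_on_def
proof
  fix t0
  obtain d a where a: "d > 0" "\<And>t. \<bar>t - t0\<bar> < d \<Longrightarrow> (\<lambda>n. (t - t0) ^ n * a n) sums (r t * cos t)"
    using extends_holomorphically_power_series[OF extends_holomorphically_mult[OF assms extends_holomorphically_cos_sin(1)]] by metis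
  obtain e b where b: "e > 0" "\<And>t. \<bar>t - t0\<bar> < e \<Longrightarrow> (\<lambda>n. (t - t0) ^ n * b n) sums (r t * sin t)"
    using extends_holomorphically_power_series[OF extends_holomorphically_mult[OF assms extends_holomorphically_cos_sin(2)]] by metis
  have "(\<lambda>n. (t - t0) ^ n *\<^sub>R (a n *\<^sub>R axis 1 1 + b n *\<^sub>R axis 2 1)) sums (r t *\<^sub>R dir t)"
    if "\<bar>t - t0\<bar> < min d e" for t
    using sums_add[OF sums_scaleR_left[OF a(2)[of t], of "axis 1 1 :: real^2"] sums_scaleR_left[OF b(2)[of t], of "axis 2 1"]] that
    by (simp add: dir_def scaleR_add_right)
  then show "\<exists>d>0. \<exists>c. \<forall>t. \<bar>t - t0\<bar> < d \<longrightarrow> (\<lambda>n. (t - t0) ^ n *\<^sub>R c n) sums (r t *\<^sub>R dir t)"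
    using a(1) b(1) by (intro exI[of _ "min d e"] conjI exI[of _ "\<lambda>n. a n *\<^sub>R axis 1 1 + b n *\<^sub>R axis 2 1"]) auto
qed

text \<open>Periodicity is expressed through \<open>dir\<close> because the fixed point equation
  sees an angle only through its cosine and sine; uniqueness of the root then gives
  \<open>r_cong\<close> at once.\<close>

locale polar_curve =
  fixes r :: "real \<Rightarrow> real"
  assumes r_pos: "0 < r t"
    and r_cong: "dir s = dir t \<Longrightarrow> r s = r t"
    and r_ext: "extends_holomorphically r t"
begin

definition \<gamma> :: "real \<Rightarrow> real^2" where "\<gamma> t = r t *\<^sub>R dir t"

lemma norm_\<gamma>: "norm (\<gamma> t) = r t"
  using r_pos[of t] by (simp add: \<gamma>_def)

lemma \<gamma>_eq_iff: "\<gamma> s = \<gamma> t \<longleftrightarrow> dir s = dir t"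
proof
  assume eq: "\<gamma> s = \<gamma> t"
  then have "r s = r t" by (metis norm_\<gamma>)
  then show "dir s = dir t" using eq r_pos[of t] by (simp add: \<gamma>_def)
next
  assume "dir s = dir t"
  with r_cong[OF this] show "\<gamma> s = \<gamma> t" by (simp add: \<gamma>_def)
qed

lemma continuous_r: "continuous_on S r"
proof (intro continuous_at_imp_continuous_on ballI)
  fix t
  obtain r' where "(r has_vector_derivative r') (at t)"
    using extends_holomorphically_differentiable[OF r_ext] by metis
  then show "isCont r t" by (rule has_vector_derivative_continuous)
qed

lemma continuous_\<gamma>: "continuous_on S \<gamma>"
  unfolding \<gamma>_def[abs_def] by (intro continuous_intros continuous_r)

lemma manifold: "analytic_1manifold (range \<gamma>)"
  unfolding analytic_1manifold_def
proof
  fix p assume "p \<in> range \<gamma>"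
  then obtain t0 where p: "p = \<gamma> t0" by blast
  \<comment> \<open>In the half plane around the direction \<open>dir t0\<close> the angle relative
    to \<open>t0\<close> is the arctangent of a quotient of coordinates, and \<open>I\<close> is the
    range of angles that this covers.\<close>
  define U where "U = {x. 0 < x \<bullet> dir t0}"
  define I where "I = {t0 - pi/2 <..< t0 + pi/2}"
  define \<theta> where "\<theta> x = t0 + arctan ((x \<bullet> rot_dir t0) / (x \<bullet> dir t0))" for x
  have inner: "\<gamma> t \<bullet> dir t0 = r t * cos (t - t0)" "\<gamma> t \<bullet> rot_dir t0 = r t * sin (t - t0)" for t
    by (simp_all add: \<gamma>_def inner_dir)
  have "open U"
    unfolding U_def by (intro open_Collect_less continuous_intros)
  moreover have "p \<in> U"
    using r_pos[of t0] by (simp add: U_def p inner)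
  moreover have "open I" by (simp add: I_def)
  moreover have "real_analytic_on \<gamma> I"
    unfolding \<gamma>_def[abs_def] by (intro real_analytic_on_polar r_ext)
  moreover have "vector_derivative \<gamma> (at t) \<noteq> 0" for t
  proof -
    obtain r' where "(r has_vector_derivative r') (at t)"
      using extends_holomorphically_differentiable[OF r_ext] by metis
    then have "(\<gamma> has_vector_derivative (r t *\<^sub>R rot_dir t + r' *\<^sub>R dir t)) (at t)"
      unfolding \<gamma>_def[abs_def]
      by (intro has_vector_derivative_scaleR dir_derivative) (simp add: has_real_derivative_iff_has_vector_derivative)
    \<comment> \<open>Whatever \<open>r'\<close> is, the component of the velocity along
      \<open>rot_dir t\<close> is the radius, so the curve is regular.\<close>
    then have "vector_derivative \<gamma> (at t) \<bullet> rot_dir t = r t"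
      by (simp add: vector_derivative_at inner_add_left inner_dir)
    then show ?thesis using r_pos[of t] by auto
  qed
  moreover have "homeomorphism I (range \<gamma> \<inter> U) \<gamma> \<theta>"
  proof
    show "continuous_on I \<gamma>" by (rule continuous_\<gamma>)
    show "continuous_on (range \<gamma> \<inter> U) \<theta>"
      unfolding \<theta>_def by (intro continuous_intros) (auto simp: U_def)
    show "\<gamma> ` I \<subseteq> range \<gamma> \<inter> U"
    proof -
      have "0 < \<gamma> t \<bullet> dir t0" if "t \<in> I" for t
        using that r_pos[of t] cos_gt_zero_pi[of "t - t0"] by (simp add: I_def inner)
      then show ?thesis by (auto simp: U_def)
    qed
    show "\<theta> ` (range \<gamma> \<inter> U) \<subseteq> I"
      using arctan_lbound arctan_ubound by (auto simp: \<theta>_def I_def)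
    have tan: "\<theta> (\<gamma> t) = t0 + arctan (tan (t - t0))" for t
      using r_pos[of t] by (simp add: \<theta>_def inner tan_def)
    show "\<theta> (\<gamma> t) = t" if "t \<in> I" for t
      using that by (simp add: tan I_def arctan_tan)
    show "\<gamma> (\<theta> y) = y" if yU: "y \<in> range \<gamma> \<inter> U" for y
    proof -
      \<comment> \<open>The angle \<open>t\<close> of a point of the curve need not lie in
        \<open>I\<close>. Equal tangents and positive cosines give \<open>u\<close> and
        \<open>t - t0\<close> the same sine and cosine, which suffices for
        \<open>\<gamma>\<close>.\<close>
      obtain t where y: "y = \<gamma> t" using yU by blast
      define u where "u = arctan (tan (t - t0))"
      have c: "0 < cos (t - t0)"
        using yU r_pos[of t] by (auto simp: U_def y inner zero_less_mult_iff)
      have cu: "0 < cos u" unfolding u_def using arctan_lbound arctan_ubound by (intro cos_gt_zero_pi)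
      have tu: "tan u = tan (t - t0)" by (simp add: u_def tan_arctan)
      have "(cos u)\<^sup>2 = inverse (1 + (tan u)\<^sup>2)" "(cos (t - t0))\<^sup>2 = inverse (1 + (tan (t - t0))\<^sup>2)"
        using cu c tan_sec[of u] tan_sec[of "t - t0"] by (simp_all add: power_inverse)
      then have "(cos u)\<^sup>2 = (cos (t - t0))\<^sup>2" by (simp add: tu)
      then have cc: "cos u = cos (t - t0)"
        using cu c by (simp add: power2_eq_iff_nonneg)
      then have ss: "sin u = sin (t - t0)"
        using tu c by (simp add: tan_def)
      have "cos (t0 + u) = cos (t0 + (t - t0))" "sin (t0 + u) = sin (t0 + (t - t0))"
        unfolding cos_add sin_add cc ss by simp_all
      then have "dir (t0 + u) = dir t"
        by (simp add: dir_eq_iff)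
      then have "\<gamma> (t0 + u) = \<gamma> t" by (simp add: \<gamma>_eq_iff)
      then show ?thesis by (simp add: y tan u_def)
    qed
  qed
  ultimately show "\<exists>U I \<gamma>' \<theta>. open U \<and> p \<in> U \<and> open I \<and> real_analytic_on \<gamma>' I \<and>
      (\<forall>t\<in>I. vector_derivative \<gamma>' (at t) \<noteq> 0) \<and> homeomorphism I (range \<gamma> \<inter> U) \<gamma>' \<theta>"
    by blast
qed

section \<open>The closed loop and its winding number\<close>

definition loop :: "real \<Rightarrow> real^2" where "loop s = \<gamma> (2 * pi * s)"

lemma path_loop: "path loop"
  unfolding path_def loop_def[abs_def]
  by (rule continuous_on_compose2[OF continuous_\<gamma>[of UNIV]]) (auto intro!: continuous_intros)

lemma closed_loop: "pathfinish loop = pathstart loop"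
  by (simp add: pathfinish_def pathstart_def loop_def \<gamma>_eq_iff dir_eq_iff)

lemma simple_loop: "simple_path loop"
  unfolding simple_path_def loop_free_def
proof (intro conjI path_loop ballI impI)
  fix x y :: real assume xy: "x \<in> {0..1}" "y \<in> {0..1}" and "loop x = loop y"
  then have "cos (2 * pi * x) = cos (2 * pi * y) \<and> sin (2 * pi * x) = sin (2 * pi * y)"
    by (simp add: loop_def \<gamma>_eq_iff dir_eq_iff)
  then obtain n :: int where "2 * pi * x = 2 * pi * y + 2 * pi * n"
    using sin_cos_eq_iff by metis
  then have "2 * pi * x = 2 * pi * (y + of_int n)" by (simp add: algebra_simps)
  then have n: "x = y + of_int n" by simp
  then have "of_int n \<le> (1::real)" "(-1::real) \<le> of_int n" using xy by auto
  then have "n = -1 \<or> n = 0 \<or> n = 1" by linarith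
  then show "x = y \<or> x = 0 \<and> y = 1 \<or> x = 1 \<and> y = 0"
    using n xy by auto
qed

lemma path_image_loop: "path_image loop = range \<gamma>"
proof
  show "path_image loop \<subseteq> range \<gamma>" by (auto simp: path_image_def loop_def)
  show "range \<gamma> \<subseteq> path_image loop"
  proof
    fix p assume "p \<in> range \<gamma>"
    then obtain t where p: "p = \<gamma> t" by blast
    have "dir (2 * pi * frac (t / (2 * pi))) = dir t"
      unfolding dir_eq_iff conj_commute[of "cos _ = _"] sin_cos_eq_iff
      by (intro exI[of _ "- \<lfloor>t / (2 * pi)\<rfloor>"]) (simp add: frac_def algebra_simps)
    then have "p = loop (frac (t / (2 * pi)))"
      by (simp add: p loop_def \<gamma>_eq_iff)
    moreover have "frac (t / (2 * pi)) \<in> {0..1}"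
      using frac_lt_1[of "t / (2 * pi)"] by (simp add: less_imp_le)
    ultimately show "p \<in> path_image loop" by (auto simp: path_image_def)
  qed
qed

text \<open>A contraction in a set omitting 0 is a contraction in the punctured plane and forces
  winding number 0. Sliding each point along its own ray deforms the loop into the unit circle,
  which has winding number 1.\<close>

lemma loop_not_null_homotopic:
  assumes "0 \<notin> \<Omega>"
  shows "\<not> (\<exists>p\<in>\<Omega>. homotopic_loops \<Omega> loop (\<lambda>t. p))"
proof
  assume "\<exists>p\<in>\<Omega>. homotopic_loops \<Omega> loop (\<lambda>t. p)"
  then obtain p where p: "homotopic_loops \<Omega> loop (\<lambda>t. p)" by blast
  define \<phi> :: "real^2 \<Rightarrow> complex" where "\<phi> x = Complex (x $ 1) (x $ 2)" for x
  have "continuous_on \<Omega> \<phi>"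
    unfolding \<phi>_def by (intro continuous_intros)
  moreover have "\<phi> \<in> \<Omega> \<rightarrow> - {0}"
  proof
    fix x assume "x \<in> \<Omega>"
    then have "x \<noteq> 0" using assms by auto
    then show "\<phi> x \<in> - {0}"
      using vec2_expand[of x] by (auto simp: \<phi>_def complex_eq_iff)
  qed
  ultimately have "homotopic_loops (- {0}) (\<phi> \<circ> loop) (\<lambda>t. \<phi> p)"
    using homotopic_loops_continuous_image[OF p] by (simp add: o_def)
  then have path: "path (\<phi> \<circ> loop)" and "winding_number (\<phi> \<circ> loop) 0 = 0"
    using winding_number_homotopic_loops_null_eq[of "\<phi> \<circ> loop" 0]
      homotopic_loops_imp_path[of "- {0}" "\<phi> \<circ> loop"] homotopic_loops_imp_subset[of "- {0}" "\<phi> \<circ> loop"] by blast+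
  moreover have hom: "homotopic_loops (- {0}) (\<phi> \<circ> loop) (circlepath 0 1)"
  proof (rule homotopic_loops_linear)
    show "pathfinish (\<phi> \<circ> loop) = pathstart (\<phi> \<circ> loop)"
      using closed_loop by (simp add: pathfinish_def pathstart_def)
    fix t :: real
    have c: "circlepath 0 1 t = cis (2 * pi * t)"
      by (simp add: circlepath cis_conv_exp mult_ac)
    have l: "(\<phi> \<circ> loop) t = of_real (r (2 * pi * t)) * cis (2 * pi * t)"
      by (simp add: \<phi>_def loop_def \<gamma>_def complex_eq_iff)
    show "closed_segment ((\<phi> \<circ> loop) t) (circlepath 0 1 t) \<subseteq> - {0}"
    proof
      fix x assume "x \<in> closed_segment ((\<phi> \<circ> loop) t) (circlepath 0 1 t)"
      then obtain u where u: "0 \<le> u" "u \<le> 1"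
        and x: "x = (1 - u) *\<^sub>R (\<phi> \<circ> loop) t + u *\<^sub>R circlepath 0 1 t"
        by (auto simp: closed_segment_def)
      have x': "x = of_real ((1 - u) * r (2 * pi * t) + u) * cis (2 * pi * t)"
        by (simp only: x c l) (simp add: scaleR_conv_of_real algebra_simps)
      have "(1 - u) * r (2 * pi * t) + u > 0"
        using u r_pos[of "2 * pi * t"] by (cases "u = 1") (auto intro!: add_pos_nonneg)
      then show "x \<in> - {0}"
        unfolding x' Compl_iff singleton_iff mult_eq_0_iff of_real_eq_0_iff by simp
    qed
  qed (use path in auto)
  ultimately show False
    using winding_number_homotopic_loops[OF hom] winding_number_circlepath_centre[of 1 0] by simp
qed

end

section \<open>Rectangular lattices\<close>

locale orthogonal_pair =
  fixes u v :: "real^2"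
  assumes u_nz: "u \<noteq> 0" and v_nz: "v \<noteq> 0" and orth: "u \<bullet> v = 0"
begin

lemma orth': "v \<bullet> u = 0"
  using orth by (simp add: inner_commute)

lemma inner_pos: "0 < u \<bullet> u" "0 < v \<bullet> v"
  using u_nz v_nz by auto

definition coord1 :: "real^2 \<Rightarrow> real" where "coord1 p = (p \<bullet> u) / (u \<bullet> u)"
definition coord2 :: "real^2 \<Rightarrow> real" where "coord2 p = (p \<bullet> v) / (v \<bullet> v)"

lemma coord1_linear [simp]: "coord1 (p + q) = coord1 p + coord1 q" "coord1 (c *\<^sub>R p) = c * coord1 p" "coord1 u = 1" "coord1 v = 0"
  and coord2_linear [simp]: "coord2 (p + q) = coord2 p + coord2 q" "coord2 (c *\<^sub>R p) = c * coord2 p" "coord2 u = 0" "coord2 v = 1"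
  using inner_pos orth orth' by (simp_all add: coord1_def coord2_def inner_add_left add_divide_distrib)

lemma coord1_diff [simp]: "coord1 (p - q) = coord1 p - coord1 q" and coord2_diff [simp]: "coord2 (p - q) = coord2 p - coord2 q"
  by (simp_all add: coord1_def coord2_def inner_diff_left diff_divide_distrib)

lemma expand: "p = coord1 p *\<^sub>R u + coord2 p *\<^sub>R v"
proof -
  define r where "r = p - (coord1 p *\<^sub>R u + coord2 p *\<^sub>R v)"
  have "r \<bullet> u = 0" "r \<bullet> v = 0"
    using inner_pos orth orth' by (simp_all add: r_def inner_diff_left inner_add_left coord1_def coord2_def)
  then have r: "r $ 1 * u $ 1 + r $ 2 * u $ 2 = 0" "r $ 1 * v $ 1 + r $ 2 * v $ 2 = 0"
    by (simp_all add: inner_vec_def sum_2)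
  let ?d = "u $ 1 * v $ 2 - u $ 2 * v $ 1"
  have o: "u $ 1 * v $ 1 + u $ 2 * v $ 2 = 0"
    using orth by (simp add: inner_vec_def sum_2)
  \<comment> \<open>Lagrange's identity: nonzero orthogonal vectors have nonzero determinant, and a
    remainder orthogonal to both vanishes by Cramer's rule.\<close>
  have "?d\<^sup>2 + (u $ 1 * v $ 1 + u $ 2 * v $ 2)\<^sup>2 = (u \<bullet> u) * (v \<bullet> v)"
    by (simp add: inner_vec_def sum_2 power2_eq_square algebra_simps)
  then have "?d\<^sup>2 > 0" using inner_pos o by simp
  then have d: "?d \<noteq> 0" by auto
  have "r $ 1 * ?d = v $ 2 * (r $ 1 * u $ 1 + r $ 2 * u $ 2) - u $ 2 * (r $ 1 * v $ 1 + r $ 2 * v $ 2)"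
    by (simp add: algebra_simps)
  moreover have "r $ 2 * ?d = u $ 1 * (r $ 1 * v $ 1 + r $ 2 * v $ 2) - v $ 1 * (r $ 1 * u $ 1 + r $ 2 * u $ 2)"
    by (simp add: algebra_simps)
  ultimately have "r $ 1 = 0" "r $ 2 = 0" using d r by auto
  then have "r = 0" by (simp add: vec_eq_iff forall_2)
  then show ?thesis by (simp add: r_def)
qed

lemma cell_iff: "p \<in> cell u v \<longleftrightarrow> -1/2 < coord1 p \<and> coord1 p \<le> 1/2 \<and> -1/2 < coord2 p \<and> coord2 p \<le> 1/2"
proof
  assume "p \<in> cell u v"
  then obtain a b where "p = a *\<^sub>R u + b *\<^sub>R v" "-1/2 < a" "a \<le> 1/2" "-1/2 < b" "b \<le> 1/2"
    by (auto simp: cell_def)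
  then show "-1/2 < coord1 p \<and> coord1 p \<le> 1/2 \<and> -1/2 < coord2 p \<and> coord2 p \<le> 1/2" by simp
next
  assume "-1/2 < coord1 p \<and> coord1 p \<le> 1/2 \<and> -1/2 < coord2 p \<and> coord2 p \<le> 1/2"
  then show "p \<in> cell u v" using expand[of p] by (auto simp: cell_def)
qed

lemma coord1_measurable [measurable]: "coord1 \<in> borel_measurable borel"
  and coord2_measurable [measurable]: "coord2 \<in> borel_measurable borel"
  unfolding coord1_def[abs_def] coord2_def[abs_def] by measurable

lemma cell_borel [measurable]: "cell u v \<in> sets borel"
proof -
  have "cell u v = {p \<in> space borel. -1/2 < coord1 p \<and> coord1 p \<le> 1/2 \<and> -1/2 < coord2 p \<and> coord2 p \<le> 1/2}"
    by (auto simp: cell_iff)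
  also have "\<dots> \<in> sets borel" by measurable
  finally show ?thesis .
qed

lemma bounded_cell: "bounded (cell u v)"
proof (rule boundedI)
  fix p assume "p \<in> cell u v"
  then have "\<bar>coord1 p\<bar> \<le> 1" "\<bar>coord2 p\<bar> \<le> 1" by (auto simp: cell_iff)
  then have "\<bar>coord1 p\<bar> * norm u + \<bar>coord2 p\<bar> * norm v \<le> 1 * norm u + 1 * norm v"
    by (intro add_mono mult_right_mono) auto
  moreover have "norm p \<le> \<bar>coord1 p\<bar> * norm u + \<bar>coord2 p\<bar> * norm v"
    using norm_triangle_ineq[of "coord1 p *\<^sub>R u" "coord2 p *\<^sub>R v"] expand[of p] by simp
  ultimately show "norm p \<le> norm u + norm v" by simp
qed

lemma emeasure_cell: "emeasure lborel (cell u v) < \<infinity>"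
  using bounded_cell by (rule emeasure_bounded_finite)

lemma in_cell_if_small:
  assumes "norm p < norm u / 2" "norm p < norm v / 2"
  shows "p \<in> cell u v"
proof -
  have "\<bar>p \<bullet> x\<bar> < (1/2) * (x \<bullet> x)" if "norm p < norm x / 2" for x
  proof -
    have "norm x > 0" using that norm_ge_zero[of p] by linarith
    then have "norm p * norm x < norm x / 2 * norm x"
      by (rule mult_strict_right_mono[OF that])
    then show ?thesis
      using Cauchy_Schwarz_ineq2[of p x] by (simp add: dot_square_norm power2_eq_square)
  qed
  from this[OF assms(1)] this[OF assms(2)]
  have "\<bar>coord1 p\<bar> < 1/2" "\<bar>coord2 p\<bar> < 1/2"
    using inner_pos by (simp_all add: coord1_def coord2_def abs_divide pos_divide_less_eq)
  then show ?thesis by (auto simp: cell_iff)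
qed

lemma measure_cell_pos: "0 < measure lborel (cell u v)"
proof -
  define e where "e = min (norm u / 2) (norm v / 2)"
  have e: "e > 0" using u_nz v_nz by (simp add: e_def)
  have sub: "ball 0 e \<subseteq> cell u v"
    by (auto simp: e_def intro: in_cell_if_small)
  have "0 < measure lborel (ball (0::real^2) e)"
    using content_ball_pos[OF e, of "0::real^2"] by (simp add: measure_completion)
  also have "\<dots> \<le> measure lborel (cell u v)"
    using emeasure_cell by (intro measure_mono_fmeasurable sub) (auto intro: fmeasurableI)
  finally show ?thesis .
qed

lemma norm_sq: "(norm (a *\<^sub>R u + b *\<^sub>R v))\<^sup>2 = a\<^sup>2 * (norm u)\<^sup>2 + b\<^sup>2 * (norm v)\<^sup>2"
proof -
  have "(norm (a *\<^sub>R u + b *\<^sub>R v))\<^sup>2 = (a *\<^sub>R u + b *\<^sub>R v) \<bullet> (a *\<^sub>R u + b *\<^sub>R v)"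
    by (simp add: dot_square_norm)
  also have "\<dots> = a\<^sup>2 * (u \<bullet> u) + b\<^sup>2 * (v \<bullet> v)"
    using orth orth' by (simp add: inner_add_left inner_add_right power2_eq_square)
  finally show ?thesis by (simp add: dot_square_norm)
qed

end

text \<open>Not the squared length of the lattice vector with index \<open>(m, n)\<close>, but comparable to it.\<close>

definition sqlen :: "int \<times> int \<Rightarrow> real" where
  "sqlen \<nu> = (of_int (fst \<nu>))\<^sup>2 + (of_int (snd \<nu>))\<^sup>2"

lemma sqlen_nonneg [simp]: "0 \<le> sqlen \<nu>"
  by (simp add: sqlen_def)

lemma sqlen_ge_1:
  assumes "\<nu> \<noteq> (0, 0)"
  shows "1 \<le> sqlen \<nu>"
proof -
  have "(fst \<nu>)\<^sup>2 + (snd \<nu>)\<^sup>2 > 0"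
    using assms by (cases \<nu>) (auto simp: sum_power2_gt_zero_iff)
  then have "1 \<le> real_of_int ((fst \<nu>)\<^sup>2 + (snd \<nu>)\<^sup>2)" by linarith
  then show ?thesis by (simp add: sqlen_def)
qed

text \<open>Shifting a coordinate of modulus at most 1/2 by an integer leaves at least half of the
  modulus of that integer; squaring gives the factor 1/4, which is attained at coordinate 1/2 and
  shift -1.\<close>

lemma (in orthogonal_pair) norm_cell_shift:
  assumes k: "k \<in> cell u v" and c: "0 \<le> c" "c \<le> (norm u)\<^sup>2" "c \<le> (norm v)\<^sup>2"
  shows "c / 4 * sqlen (m, n) \<le> (norm (k + (of_int m *\<^sub>R u + of_int n *\<^sub>R v)))\<^sup>2"
proof -
  have shift: "(real_of_int i)\<^sup>2 / 4 \<le> (x + of_int i)\<^sup>2" if "\<bar>x\<bar> \<le> 1/2" for x i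
  proof -
    have "\<bar>real_of_int i\<bar> / 2 \<le> \<bar>x + of_int i\<bar>"
    proof (cases "i = 0")
      case False
      then have "1 \<le> \<bar>real_of_int i\<bar>" by linarith
      then show ?thesis using that by linarith
    qed simp
    then have "(\<bar>real_of_int i\<bar> / 2)\<^sup>2 \<le> \<bar>x + of_int i\<bar>\<^sup>2"
      by (intro power_mono) auto
    then show ?thesis by (simp add: power_divide)
  qed
  have st: "\<bar>coord1 k\<bar> \<le> 1/2" "\<bar>coord2 k\<bar> \<le> 1/2" using k by (auto simp: cell_iff)
  have "k + (of_int m *\<^sub>R u + of_int n *\<^sub>R v) = (coord1 k + of_int m) *\<^sub>R u + (coord2 k + of_int n) *\<^sub>R v"
    by (subst expand[of k]) (simp add: scaleR_add_left algebra_simps)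
  then have "(norm (k + (of_int m *\<^sub>R u + of_int n *\<^sub>R v)))\<^sup>2 =
      (coord1 k + of_int m)\<^sup>2 * (norm u)\<^sup>2 + (coord2 k + of_int n)\<^sup>2 * (norm v)\<^sup>2"
    by (simp only: norm_sq)
  also have "\<dots> \<ge> (of_int m)\<^sup>2 / 4 * c + (of_int n)\<^sup>2 / 4 * c"
    using shift[OF st(1), of m] shift[OF st(2), of n] c by (intro add_mono mult_mono) auto
  finally show ?thesis by (simp add: sqlen_def algebra_simps)
qed

section \<open>Summability of inverse cubes of lattice lengths\<close>

definition lat_enum :: "nat \<Rightarrow> int \<times> int" where
  "lat_enum = from_nat_into (- {(0, 0)})"

lemma bij_lat_enum: "bij_betw lat_enum UNIV (- {(0, 0)})"
proof -
  have "infinite (UNIV :: (int \<times> int) set)"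
    by (simp add: finite_prod)
  then have "infinite (- {(0, 0)} :: (int \<times> int) set)"
    by (simp add: Compl_eq_Diff_UNIV)
  then show ?thesis
    unfolding lat_enum_def by (intro bij_betw_from_nat_into) auto
qed

lemma lat_enum_nz: "lat_enum i \<noteq> (0, 0)"
  using bij_betw_apply[OF bij_lat_enum, of i] by auto

lemma summable_int_powr:
  "\<exists>C. \<forall>A::int set. finite A \<longrightarrow> (\<Sum>m\<in>A. (1 + (of_int m)\<^sup>2) powr (-3/4)) \<le> (C::real)"
proof -
  define g where "g x = (1 + x\<^sup>2) powr (-3/4)" for x :: real
  have g_nonneg: "0 \<le> g x" for x by (simp add: g_def)
  have "summable (\<lambda>n. g (real n))"
  proof (rule summable_comparison_test_ev)
    show "summable (\<lambda>n. real n powr (-3/2))" by (simp add: summable_real_powr_iff)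
    show "\<forall>\<^sub>F n in sequentially. norm (g (real n)) \<le> real n powr (-3/2)"
      using eventually_gt_at_top[of 0]
    proof eventually_elim
      case (elim n)
      have "g (real n) \<le> ((real n)\<^sup>2) powr (-3/4)"
        unfolding g_def using elim by (intro powr_mono2') auto
      also have "\<dots> = real n powr (-3/2)"
        using elim by (simp add: powr_powr flip: powr_numeral)
      finally show ?case using g_nonneg by simp
    qed
  qed
  then have S: "sum (\<lambda>n. g (real n)) F \<le> (\<Sum>n. g (real n))" if "finite F" for F
    using that g_nonneg by (intro sum_le_suminf) auto
  show ?thesis
  proof (intro exI allI impI)
    fix A :: "int set" assume A: "finite A"
    \<comment> \<open>The two halves overlap at 0, hence an inequality.\<close>
    have "(\<Sum>m\<in>A. g (of_int m)) \<le> (\<Sum>m\<in>A \<inter> {0..}. g (of_int m)) + (\<Sum>m\<in>A \<inter> {..0}. g (of_int m))"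
    proof -
      have "A = (A \<inter> {0..}) \<union> (A \<inter> {..0})" by auto
      then have "(\<Sum>m\<in>A. g (of_int m)) = (\<Sum>m\<in>(A \<inter> {0..}) \<union> (A \<inter> {..0}). g (of_int m))" by simp
      also have "\<dots> \<le> (\<Sum>m\<in>A \<inter> {0..}. g (of_int m)) + (\<Sum>m\<in>A \<inter> {..0}. g (of_int m))"
        using A g_nonneg by (subst sum.union_inter[symmetric]) (auto intro: sum_nonneg)
      finally show ?thesis .
    qed
    also have "(\<Sum>m\<in>A \<inter> {0..}. g (of_int m)) = (\<Sum>n\<in>nat ` (A \<inter> {0..}). g (real n))"
      by (subst sum.reindex) (auto simp: inj_on_def)
    also have "(\<Sum>m\<in>A \<inter> {..0}. g (of_int m)) = (\<Sum>n\<in>(\<lambda>m. nat (-m)) ` (A \<inter> {..0}). g (real n))"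
      by (subst sum.reindex) (auto simp: inj_on_def g_def)
    finally have "(\<Sum>m\<in>A. g (of_int m)) \<le> (\<Sum>n\<in>nat ` (A \<inter> {0..}). g (real n)) + (\<Sum>n\<in>(\<lambda>m. nat (-m)) ` (A \<inter> {..0}). g (real n))" .
    also have "\<dots> \<le> (\<Sum>n. g (real n)) + (\<Sum>n. g (real n))"
      using A by (intro add_mono S) auto
    finally show "(\<Sum>m\<in>A. (1 + (of_int m)\<^sup>2) powr (-3/4)) \<le> (\<Sum>n. g (real n)) + (\<Sum>n. g (real n))"
      by (simp only: g_def)
  qed
qed

text \<open>Off the origin
  \<open>(1 + m\<^sup>2) * (1 + n\<^sup>2) \<le> (2 * sqlen)\<^sup>2\<close>, so each term is
  dominated by a product of a function of \<open>m\<close> and a function of \<open>n\<close>, and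
  the double sum factorizes. The exponent is the one met in the square integral of the lattice
  kernel: two powers of the inverse length from a squared coefficient, one from integrating its
  exponential.\<close>

lemma summable_sqlen: "summable (\<lambda>i. sqlen (lat_enum i) powr (-3/2))"
proof -
  define g where "g x = (1 + x\<^sup>2) powr (-3/4)" for x :: real
  obtain C where C: "\<And>A::int set. finite A \<Longrightarrow> (\<Sum>m\<in>A. g (of_int m)) \<le> C"
    using summable_int_powr unfolding g_def by blast
  have g_nonneg: "0 \<le> g x" for x by (simp add: g_def)
  have C0: "0 \<le> C" using C[of "{}"] by simp
  define h where "h \<nu> = sqlen \<nu> powr (-3/2)" for \<nu>
  have le: "h \<nu> \<le> 2 powr (3/2) * (g (of_int (fst \<nu>)) * g (of_int (snd \<nu>)))" if "\<nu> \<noteq> (0, 0)" for \<nu>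
  proof -
    let ?m = "(real_of_int (fst \<nu>))\<^sup>2" and ?n = "(real_of_int (snd \<nu>))\<^sup>2"
    have 1: "1 \<le> sqlen \<nu>" by (rule sqlen_ge_1[OF that])
    have "(1 + ?m) * (1 + ?n) \<le> (1 + sqlen \<nu>) * (1 + sqlen \<nu>)"
      by (intro mult_mono) (auto simp: sqlen_def)
    also have "\<dots> \<le> (2 * sqlen \<nu>) * (2 * sqlen \<nu>)"
      using 1 by (intro mult_mono) auto
    finally have "(1 + ?m) * (1 + ?n) \<le> (2 * sqlen \<nu>)\<^sup>2" by (simp add: power2_eq_square)
    then have "((2 * sqlen \<nu>)\<^sup>2) powr (-3/4) \<le> ((1 + ?m) * (1 + ?n)) powr (-3/4)"
      by (intro powr_mono2') (auto intro!: mult_pos_pos add_pos_nonneg)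
    also have "((2 * sqlen \<nu>)\<^sup>2) powr (-3/4) = (2 * sqlen \<nu>) powr (-3/2)"
    proof -
      have "(y\<^sup>2) powr (-3/4) = y powr (-3/2)" if "0 < y" for y :: real
        using that by (simp add: powr_powr flip: powr_numeral)
      then show ?thesis by this (use 1 in simp)
    qed
    also have "\<dots> = 2 powr (-3/2) * h \<nu>"
      using 1 by (simp add: powr_mult h_def)
    also have "((1 + ?m) * (1 + ?n)) powr (-3/4) = g (of_int (fst \<nu>)) * g (of_int (snd \<nu>))"
      by (simp add: powr_mult g_def)
    finally have "2 powr (3/2) * (2 powr (-3/2) * h \<nu>) \<le> 2 powr (3/2) * (g (of_int (fst \<nu>)) * g (of_int (snd \<nu>)))"
      by (intro mult_left_mono) auto
    then show ?thesis by (simp add: mult.assoc[symmetric] powr_add[symmetric])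
  qed
  have "h summable_on (- {(0, 0)})"
  proof (rule nonneg_bounded_partial_sums_imp_summable_on)
    show "0 \<le> h \<nu>" for \<nu> by (simp add: h_def)
    show "\<forall>\<^sub>F X in finite_subsets_at_top (- {(0, 0)}). sum h X \<le> 2 powr (3/2) * (C * C)"
    proof (rule eventually_finite_subsets_at_top_weakI)
      fix X :: "(int \<times> int) set" assume X: "finite X" "X \<subseteq> - {(0, 0)}"
      let ?A = "fst ` X" and ?B = "snd ` X"
      have "sum h X \<le> (\<Sum>\<nu>\<in>X. 2 powr (3/2) * (g (of_int (fst \<nu>)) * g (of_int (snd \<nu>))))"
        using X by (intro sum_mono le) auto
      also have "\<dots> \<le> (\<Sum>\<nu>\<in>?A \<times> ?B. 2 powr (3/2) * (g (of_int (fst \<nu>)) * g (of_int (snd \<nu>))))"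
        using X g_nonneg by (intro sum_mono2) (auto intro!: mult_nonneg_nonneg simp: rev_image_eqI)
      also have "\<dots> = 2 powr (3/2) * ((\<Sum>m\<in>?A. g (of_int m)) * (\<Sum>n\<in>?B. g (of_int n)))"
        by (subst sum_product, subst sum.cartesian_product) (simp add: sum_distrib_left case_prod_beta')
      also have "\<dots> \<le> 2 powr (3/2) * (C * C)"
        using X C0 g_nonneg by (intro mult_left_mono mult_mono C sum_nonneg) auto
      finally show "sum h X \<le> 2 powr (3/2) * (C * C)" .
    qed
  qed
  then have "(\<lambda>i. h (lat_enum i)) summable_on UNIV"
    by (simp add: summable_on_reindex_bij_betw[OF bij_lat_enum])
  then show ?thesis
    by (subst (asm) summable_on_UNIV_nonneg_real_iff) (auto simp: h_def)
qed

section \<open>Orthogonality of the exponentials on the cell\<close>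

lemma lborel_integral_translate:
  fixes f :: "'a::euclidean_space \<Rightarrow> 'b::{banach, second_countable_topology}"
  assumes [measurable]: "f \<in> borel_measurable borel"
  shows "(LINT p|lborel. f (p + c)) = (LINT p|lborel. f p)"
proof -
  have "(LINT p|lborel. f p) = (LINT p|distr lborel borel ((+) c). f p)"
    by (simp add: lborel_distr_plus)
  also have "\<dots> = (LINT p|lborel. f (c + p))"
    by (rule integral_distr) measurable
  finally show ?thesis by (simp add: add.commute)
qed

text \<open>
  An antiperiodicity argument replaces the explicit integration of exponentials over the cell: a
  translation by \<open>\<tau> u\<close> changes the sign of \<open>f\<close>, but by periodicity not its integral over a cell.
\<close>

lemma (in orthogonal_pair) integral_cell_antiperiodic:
  fixes f :: "real^2 \<Rightarrow> complex"
  assumes [measurable]: "f \<in> borel_measurable borel" and bound: "\<And>p. cmod (f p) \<le> 1"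
    and per: "\<And>p. f (p + u) = f p" and anti: "\<And>p. f (p + \<tau> *\<^sub>R u) = - f p" and \<tau>: "0 < \<tau>" "\<tau> \<le> 1"
  shows "(LINT p|lborel. indicator (cell u v) p *\<^sub>R f p) = 0"
proof -
  \<comment> \<open>\<open>P\<close> is the strip that the translation by \<open>\<tau> u\<close>
    pushes out of the cell. The points that it moves into the cell form the cell without
    \<open>P\<close>, together with the copy of \<open>P\<close> one period \<open>u\<close>
    back.\<close>
  define P where "P = {p \<in> cell u v. 1/2 - \<tau> < coord1 p}"
  have P_eq: "P = cell u v \<inter> {p \<in> space borel. 1/2 - \<tau> < coord1 p}" by (auto simp: P_def)
  have [measurable]: "P \<in> sets borel" unfolding P_eq by measurable
  have finP: "emeasure lborel P < \<infinity>"
    using emeasure_mono[of P "cell u v" lborel] emeasure_cell by (auto simp: P_def less_top[symmetric] top_unique)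
  have ind: "indicator (cell u v) (p + \<tau> *\<^sub>R u) = (indicator (cell u v) p - indicator P p + indicator P (p + u) :: real)" for p
    using \<tau> by (auto simp: P_def cell_iff indicator_def)
  have intA: "integrable lborel (\<lambda>p. indicator A p *\<^sub>R f p)" if "A \<in> sets borel" "emeasure lborel A < \<infinity>" for A
  proof (rule Bochner_Integration.integrable_bound)
    show "integrable lborel (indicator A :: _ \<Rightarrow> real)" using that by simp
    show "AE x in lborel. norm (indicator A x *\<^sub>R f x) \<le> norm (indicator A x :: real)"
      using bound by (auto simp: indicator_def)
  qed (use that in measurable)
  have shift: "(LINT p|lborel. indicator P (p + u) *\<^sub>R f p) = (LINT p|lborel. indicator P p *\<^sub>R f p)"
    using lborel_integral_translate[of "\<lambda>p. indicator P p *\<^sub>R f p" u] by (simp add: per)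
  have int_shift: "integrable lborel (\<lambda>p. indicator P (p + u) *\<^sub>R f p)"
  proof -
    have "integrable (distr lborel borel ((+) u)) (\<lambda>p. indicator P p *\<^sub>R f p)"
      using intA[of P] finP by (simp add: lborel_distr_plus)
    then have "integrable lborel (\<lambda>p. indicator P (u + p) *\<^sub>R f (u + p))"
      by (subst (asm) integrable_distr_eq) measurable
    then show ?thesis by (simp add: add.commute[of u] per)
  qed
  let ?I = "LINT p|lborel. indicator (cell u v) p *\<^sub>R f p"
  have "?I = (LINT p|lborel. indicator (cell u v) (p + \<tau> *\<^sub>R u) *\<^sub>R f (p + \<tau> *\<^sub>R u))"
    by (rule lborel_integral_translate[symmetric]) measurable
  also have "\<dots> = - (LINT p|lborel. indicator (cell u v) p *\<^sub>R f p - indicator P p *\<^sub>R f p + indicator P (p + u) *\<^sub>R f p)"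
    unfolding ind anti by (subst Bochner_Integration.integral_minus[symmetric]) (simp add: algebra_simps)
  also have "\<dots> = - ?I"
    using intA[OF cell_borel emeasure_cell] intA[of P] finP int_shift by (simp add: shift)
  finally show ?thesis by simp
qed

lemma cis_2pi_int: "cis (2 * pi * of_int n) = 1"
  by (simp add: cis.ctr complex_eq_iff)

text \<open>A fraction \<open>1 / (2 |n|)\<close> of the period is half a wavelength and reverses
  the sign, whatever the sign of \<open>n\<close>.\<close>

lemma cis_half: "n \<noteq> 0 \<Longrightarrow> cis (2 * pi * (of_int n * (1 / (2 * \<bar>of_int n\<bar>)))) = -1"
  by (cases "n > 0") (simp_all add: cis.ctr complex_eq_iff)

locale rect_lattice = orthogonal_pair a2 a3 for a2 a3
begin

sublocale dual: orthogonal_pair "dual_vec a2" "dual_vec a3"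
  by unfold_locales (use u_nz v_nz orth in \<open>simp_all add: dual_vec_def\<close>)

definition freq :: "int \<times> int \<Rightarrow> real^2" where
  "freq \<nu> = of_int (fst \<nu>) *\<^sub>R dual_vec a2 + of_int (snd \<nu>) *\<^sub>R dual_vec a3"

lemma freq_inner: "freq \<nu> \<bullet> p = 2 * pi * (of_int (fst \<nu>) * coord1 p + of_int (snd \<nu>) * coord2 p)"
  by (simp add: freq_def dual_vec_def inner_add_left coord1_def coord2_def inner_commute dot_square_norm
      power2_eq_square algebra_simps add_divide_distrib)

lemma freq_diff: "freq \<nu> - freq \<mu> = freq (\<nu> - \<mu>)"
  by (simp add: freq_def algebra_simps)

lemma inj_freq: "inj freq"
proof (rule injI)
  fix \<nu> \<mu> assume "freq \<nu> = freq \<mu>"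
  then have "dual.coord1 (freq \<nu>) = dual.coord1 (freq \<mu>)" "dual.coord2 (freq \<nu>) = dual.coord2 (freq \<mu>)" by simp_all
  then show "\<nu> = \<mu>" by (simp add: freq_def prod_eq_iff)
qed

lemma range_freq: "range freq = dual_lattice a2 a3"
  by (auto simp: freq_def dual_lattice_def planar_lattice_def image_iff) blast

definition wave :: "int \<times> int \<Rightarrow> real^2 \<Rightarrow> complex" where
  "wave \<nu> p = cis (freq \<nu> \<bullet> p)"

lemma norm_wave [simp]: "cmod (wave \<nu> p) = 1"
  by (simp add: wave_def)

lemma wave_mult_cnj: "wave \<nu> p * cnj (wave \<mu> p) = wave (\<nu> - \<mu>) p"
  by (simp add: wave_def cis_cnj cis_mult freq_diff[symmetric] inner_diff_left)

lemma wave_measurable [measurable]: "wave \<nu> \<in> borel_measurable borel"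
  unfolding wave_def[abs_def] by measurable

lemma integral_wave:
  assumes "\<nu> \<noteq> (0, 0)"
  shows "(LINT p|lborel. indicator (cell a2 a3) p *\<^sub>R wave \<nu> (x - p)) = 0"
proof -
  obtain m n where \<nu>: "\<nu> = (m, n)" by (cases \<nu>)
  show ?thesis
  proof (cases "m = 0")
    case False
    let ?\<tau> = "1 / (2 * \<bar>of_int m\<bar>) :: real"
    have "1 \<le> \<bar>real_of_int m\<bar>" using False by linarith
    then have \<tau>: "0 < ?\<tau>" "?\<tau> \<le> 1" by (auto simp: divide_le_eq)
    have "wave \<nu> (x - (p + c *\<^sub>R a2)) = wave \<nu> (x - p) / cis (2 * pi * (of_int m * c))" for p c
      unfolding wave_def cis_divide freq_inner by (simp add: \<nu> algebra_simps)
    from this[of _ ?\<tau>] this[of _ 1] show ?thesis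
      by (intro integral_cell_antiperiodic[where \<tau> = ?\<tau>] \<tau>)
        (simp_all only: cis_half[OF False] cis_2pi_int scaleR_one mult_1_right, simp_all)
  next
    case True
    then have n: "n \<noteq> 0" using assms \<nu> by auto
    \<comment> \<open>Antiperiodicity is used along the first vector. For \<open>m = 0\<close> the
      wave oscillates only along \<open>a3\<close>, so the two vectors are exchanged; the cell is
      unaffected.\<close>
    interpret swap: orthogonal_pair a3 a2
      by unfold_locales (use u_nz v_nz orth' in auto)
    have cell: "cell a2 a3 = cell a3 a2"
      unfolding set_eq_iff cell_iff swap.cell_iff swap.coord1_def swap.coord2_def coord1_def coord2_def by blast
    let ?\<tau> = "1 / (2 * \<bar>of_int n\<bar>) :: real"
    have "1 \<le> \<bar>real_of_int n\<bar>" using n by linarith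
    then have \<tau>: "0 < ?\<tau>" "?\<tau> \<le> 1" by (auto simp: divide_le_eq)
    have "wave \<nu> (x - (p + c *\<^sub>R a3)) = wave \<nu> (x - p) / cis (2 * pi * (of_int n * c))" for p c
      unfolding wave_def cis_divide freq_inner by (simp add: \<nu> algebra_simps)
    from this[of _ ?\<tau>] this[of _ 1] show ?thesis
      unfolding cell by (intro swap.integral_cell_antiperiodic[where \<tau> = ?\<tau>] \<tau>)
        (simp_all only: cis_half[OF n] cis_2pi_int scaleR_one mult_1_right, simp_all)
  qed
qed

definition area :: real where "area = measure lborel (cell a2 a3)"

lemma integrable_cell:
  assumes "f \<in> borel_measurable borel" "\<And>p. norm (f p) \<le> B"
  shows "integrable lborel (\<lambda>p. indicator (cell a2 a3) p *\<^sub>R (f p :: complex))"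
proof (rule Bochner_Integration.integrable_bound)
  show "integrable lborel (\<lambda>p. indicator (cell a2 a3) p * B)" using emeasure_cell by simp
  show "AE x in lborel. norm (indicator (cell a2 a3) x *\<^sub>R f x) \<le> norm (indicator (cell a2 a3) x * B)"
    using assms(2) by (auto simp: indicator_def intro: order_trans[OF _ abs_ge_self])
qed (use assms(1) in measurable)

text \<open>Stated with the nonnegative integral, ready to be inserted under the integral over the
  longitudinal variable. A difference of two indices is \<open>(0, 0)\<close> exactly on the
  diagonal \<open>i = j\<close>, by injectivity of \<open>lat_enum\<close>.\<close>

lemma Parseval_cell:
  "(\<integral>\<^sup>+p. ennreal ((cmod (\<Sum>i<n. c i * wave (lat_enum i) (x - p)))\<^sup>2) * indicator (cell a2 a3) p \<partial>lborel) =
    ennreal (area * (\<Sum>i<n. (cmod (c i))\<^sup>2))"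
proof -
  let ?P = "\<lambda>p. \<Sum>i<n. c i * wave (lat_enum i) (x - p)"
  have w: "wave \<nu> (x - p) * cnj (wave \<mu> (x - p)) = wave (\<nu> - \<mu>) (x - p)" for \<nu> \<mu> p
    by (rule wave_mult_cnj)
  have meas: "(\<lambda>p. wave \<nu> (x - p)) \<in> borel_measurable borel" for \<nu> by measurable
  have sq: "complex_of_real ((cmod (?P p))\<^sup>2) = (\<Sum>i<n. \<Sum>j<n. c i * cnj (c j) * wave (lat_enum i - lat_enum j) (x - p))" for p
    unfolding complex_norm_square cnj_sum sum_product
    by (intro sum.cong refl) (simp add: w[symmetric])
  have I: "(LINT p|lborel. indicator (cell a2 a3) p *\<^sub>R wave (lat_enum i - lat_enum j) (x - p)) = (if i = j then of_real area else 0)" for i j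
  proof (cases "i = j")
    case True
    then show ?thesis using emeasure_cell
      by (simp add: wave_def freq_def area_def zero_prod_def[symmetric] scaleR_conv_of_real)
  next
    case False
    then have "lat_enum i \<noteq> lat_enum j"
      using bij_lat_enum by (auto simp: bij_betw_def inj_on_def)
    then have "lat_enum i - lat_enum j \<noteq> (0, 0)"
      by (simp add: zero_prod_def[symmetric])
    then show ?thesis using False integral_wave by simp
  qed
  have int: "integrable lborel (\<lambda>p. indicator (cell a2 a3) p *\<^sub>R wave \<nu> (x - p))" for \<nu>
    by (rule integrable_cell[where B = 1, OF meas]) simp
  have "(LINT p|lborel. indicator (cell a2 a3) p *\<^sub>R complex_of_real ((cmod (?P p))\<^sup>2)) =
      (LINT p|lborel. (\<Sum>i<n. \<Sum>j<n. c i * cnj (c j) * (indicator (cell a2 a3) p *\<^sub>R wave (lat_enum i - lat_enum j) (x - p))))"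
    unfolding sq by (simp add: scaleR_sum_right)
  also have "\<dots> = (\<Sum>i<n. \<Sum>j<n. c i * cnj (c j) * (if i = j then of_real area else 0))"
  proof -
    have "(LINT p|lborel. (\<Sum>i<n. \<Sum>j<n. k i j * F i j p)) = (\<Sum>i<n. \<Sum>j<n. k i j * (LINT p|lborel. F i j p))"
      if "\<And>i j. integrable lborel (F i j)" for k :: "nat \<Rightarrow> nat \<Rightarrow> complex" and F :: "nat \<Rightarrow> nat \<Rightarrow> real^2 \<Rightarrow> complex"
      using that by simp
    from this[OF int] show ?thesis by (simp only: I)
  qed
  also have "\<dots> = of_real (area * (\<Sum>i<n. (cmod (c i))\<^sup>2))"
    by (simp add: if_distrib[of "\<lambda>x. _ * x"] sum.delta sum_distrib_left complex_norm_square[symmetric] mult.commute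
        flip: of_real_power cong: if_cong)
  finally have "complex_of_real (LINT p|lborel. indicator (cell a2 a3) p * (cmod (?P p))\<^sup>2) = of_real (area * (\<Sum>i<n. (cmod (c i))\<^sup>2))"
    by (simp only: scaleR_conv_of_real of_real_mult[symmetric] integral_complex_of_real)
  then have eq: "(LINT p|lborel. indicator (cell a2 a3) p * (cmod (?P p))\<^sup>2) = area * (\<Sum>i<n. (cmod (c i))\<^sup>2)"
    using of_real_eq_iff by blast
  have [measurable]: "?P \<in> borel_measurable borel" by measurable
  have "norm (complex_of_real ((cmod (?P p))\<^sup>2)) \<le> (\<Sum>i<n. cmod (c i))\<^sup>2" for p
  proof -
    have "cmod (?P p) \<le> (\<Sum>i<n. cmod (c i))"
      by (rule order_trans[OF norm_sum]) (simp add: norm_mult)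
    then show ?thesis by (simp add: power_mono norm_power)
  qed
  then have "integrable lborel (\<lambda>p. indicator (cell a2 a3) p *\<^sub>R complex_of_real ((cmod (?P p))\<^sup>2))"
    by (intro integrable_cell) measurable
  then have int2: "integrable lborel (\<lambda>p. indicator (cell a2 a3) p * (cmod (?P p))\<^sup>2)"
    by (simp only: scaleR_conv_of_real of_real_mult[symmetric] complex_of_real_integrable_eq)
  have "(\<integral>\<^sup>+p. ennreal ((cmod (?P p))\<^sup>2) * indicator (cell a2 a3) p \<partial>lborel) =
      (\<integral>\<^sup>+p. ennreal (indicator (cell a2 a3) p * (cmod (?P p))\<^sup>2) \<partial>lborel)"
    by (intro nn_integral_cong) (auto simp: indicator_def)
  also have "\<dots> = ennreal (area * (\<Sum>i<n. (cmod (c i))\<^sup>2))"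
    using nn_integral_eq_integral[OF int2] by (simp add: eq)
  finally show ?thesis .
qed

end

section \<open>The lattice sum\<close>

lemma nn_integral_even:
  fixes f :: "real \<Rightarrow> ennreal"
  assumes [measurable]: "f \<in> borel_measurable borel"
  shows "(\<integral>\<^sup>+y. f \<bar>y\<bar> \<partial>lborel) = 2 * (\<integral>\<^sup>+y. f \<bar>y\<bar> * indicator {0..} y \<partial>lborel)"
proof -
  have "(\<integral>\<^sup>+y. f \<bar>y\<bar> \<partial>lborel) = (\<integral>\<^sup>+y. f \<bar>y\<bar> * indicator {0..} y + f \<bar>- y\<bar> * indicator {0..} (- y) \<partial>lborel)"
    by (intro nn_integral_cong_AE eventually_mono[OF AE_lborel_singleton[of 0]]) (auto simp: indicator_def)
  also have "\<dots> = (\<integral>\<^sup>+y. f \<bar>y\<bar> * indicator {0..} y \<partial>lborel) + (\<integral>\<^sup>+y. f \<bar>- y\<bar> * indicator {0..} (- y) \<partial>lborel)"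
    by (rule nn_integral_add) measurable
  also have "(\<integral>\<^sup>+y. f \<bar>- y\<bar> * indicator {0..} (- y) \<partial>lborel) = (\<integral>\<^sup>+y. f \<bar>y\<bar> * indicator {0..} y \<partial>lborel)"
    by (subst nn_integral_real_affine[where c = "-1" and t = 0 and f = "\<lambda>y. f \<bar>y\<bar> * indicator {0..} y"]) simp_all
  finally show ?thesis by (simp add: mult_2)
qed

lemma nn_integral_exp_abs:
  assumes a: "a > 0"
  shows "(\<integral>\<^sup>+y. ennreal (exp (- (2 * a) * \<bar>x - y\<bar>)) \<partial>lborel) = ennreal (1 / a)"
proof -
  have half: "(\<integral>\<^sup>+y. ennreal (exp (- (2 * a) * y)) * indicator {0..} y \<partial>lborel) = ennreal (1 / (2 * a))"
  proof -
    have lim: "((\<lambda>y. - exp (- (2 * a) * y) / (2 * a)) \<longlongrightarrow> - 0 / (2 * a)) at_top"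
    proof (intro tendsto_intros)
      show "((\<lambda>y. exp (- (2 * a) * y)) \<longlongrightarrow> 0) at_top"
      proof (rule filterlim_compose[OF exp_at_bot])
        show "filterlim (\<lambda>y. - (2 * a) * y) at_bot at_top"
          using a by (intro filterlim_tendsto_neg_mult_at_bot[OF tendsto_const _ filterlim_ident]) auto
      qed
    qed (use a in auto)
    have der: "((\<lambda>y. - exp (- (2 * a) * y) / (2 * a)) has_real_derivative exp (- (2 * a) * y)) (at y)" for y
      using a by (auto intro!: derivative_eq_intros)
    show ?thesis
      using nn_integral_FTC_atLeast[OF _ der _ lim, of 0] by simp
  qed
  have "(\<integral>\<^sup>+y. ennreal (exp (- (2 * a) * \<bar>x - y\<bar>)) \<partial>lborel) =
      (\<integral>\<^sup>+y. ennreal (exp (- (2 * a) * \<bar>y\<bar>)) \<partial>lborel)"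
    by (subst nn_integral_real_affine[where c = 1 and t = x]) simp_all
  also have "\<dots> = 2 * ennreal (1 / (2 * a))"
    by (subst nn_integral_even) (simp_all only: half[symmetric], auto simp: indicator_def intro!: arg_cong[where f = "(*) 2"] nn_integral_cong)
  also have "\<dots> = ennreal (1 / a)"
    using a by (simp add: ennreal_mult[symmetric] flip: ennreal_numeral)
  finally show ?thesis .
qed

text \<open>Twice the Green function of \<open>- d\<^sup>2/dr\<^sup>2 + \<sigma>\<close> on the line
  at distance \<open>r\<close>, one for each mode. The symbol \<open>\<sigma>\<close> is abstract
  because it stands for \<open>|k + K|\<^sup>2 - E\<close> and also for its complex
  continuation.\<close>

definition coef :: "(int \<times> int \<Rightarrow> complex) \<Rightarrow> nat \<Rightarrow> real \<Rightarrow> complex" where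
  "coef \<sigma> i r = exp (- csqrt (\<sigma> (lat_enum i)) * of_real r) / csqrt (\<sigma> (lat_enum i))"

text \<open>The origin is exempt because its mode carries the pole. For the others a positive real
  part keeps \<open>csqrt\<close> off its cut, and \<open>c\<close> alone determines a lower bound
  for the decay, uniformly over all such symbols.\<close>

definition elliptic :: "real \<Rightarrow> (int \<times> int \<Rightarrow> complex) \<Rightarrow> bool" where
  "elliptic c \<sigma> \<longleftrightarrow> 0 < c \<and> (\<forall>\<nu>. \<nu> \<noteq> (0, 0) \<longrightarrow> c * sqlen \<nu> \<le> Re (\<sigma> \<nu>))"

definition rate :: "real \<Rightarrow> nat \<Rightarrow> real" where
  "rate c i = sqrt (c * sqlen (lat_enum i))"

lemma rate_pos: "0 < c \<Longrightarrow> 0 < rate c i"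
  using sqlen_ge_1[OF lat_enum_nz[of i]] by (simp add: rate_def)

text \<open>The square of \<open>w\<close> has real part
  \<open>(Re w)\<^sup>2 - (Im w)\<^sup>2\<close>: an imaginary part of the symbol can only speed up
  the decay of a mode.\<close>

lemma Re_csqrt_ge: "0 \<le> Re z \<Longrightarrow> sqrt (Re z) \<le> Re (csqrt z)"
proof -
  have "Re (w\<^sup>2) \<le> (Re w)\<^sup>2" for w :: complex by (simp add: Re_power2)
  from this[of "csqrt z"] have "Re z \<le> (Re (csqrt z))\<^sup>2" by (simp del: csqrt.simps)
  then show ?thesis by (simp add: real_le_lsqrt Re_csqrt del: csqrt.simps)
qed

lemma elliptic_Re_pos: "elliptic c \<sigma> \<Longrightarrow> 0 < Re (\<sigma> (lat_enum i))"
  unfolding elliptic_def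
  using sqlen_ge_1[OF lat_enum_nz[of i]] lat_enum_nz[of i] by (smt (verit) mult_pos_pos)

lemma elliptic_Re_csqrt:
  assumes "elliptic c \<sigma>"
  shows "rate c i \<le> Re (csqrt (\<sigma> (lat_enum i)))"
proof -
  have "c * sqlen (lat_enum i) \<le> Re (\<sigma> (lat_enum i))"
    using assms lat_enum_nz[of i] unfolding elliptic_def by blast
  then have "rate c i \<le> sqrt (Re (\<sigma> (lat_enum i)))" by (simp add: rate_def)
  also have "\<dots> \<le> Re (csqrt (\<sigma> (lat_enum i)))"
    using elliptic_Re_pos[OF assms, of i] by (intro Re_csqrt_ge) simp
  finally show ?thesis .
qed

lemma norm_coef_le:
  assumes "elliptic c \<sigma>" "0 \<le> r"
  shows "cmod (coef \<sigma> i r) \<le> exp (- rate c i * r) / rate c i"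
proof -
  let ?w = "csqrt (\<sigma> (lat_enum i))"
  have pos: "0 < rate c i" using assms by (simp add: rate_pos elliptic_def)
  have le: "rate c i \<le> Re ?w" by (rule elliptic_Re_csqrt[OF assms(1)])
  have "cmod (coef \<sigma> i r) = exp (- Re ?w * r) / cmod ?w"
    by (simp add: coef_def norm_divide norm_exp_eq_Re)
  also have "\<dots> \<le> exp (- rate c i * r) / rate c i"
    using pos le assms(2) complex_Re_le_cmod[of ?w]
    by (intro frac_le) (auto intro: mult_right_mono simp del: csqrt.simps)
  finally show ?thesis .
qed

lemma rate_cube: "0 < c \<Longrightarrow> 1 / (rate c i) ^ 3 = c powr (-3/2) * sqlen (lat_enum i) powr (-3/2)"
proof -
  assume c: "0 < c"
  let ?l = "sqlen (lat_enum i)"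
  have l: "0 < ?l" using sqlen_ge_1[OF lat_enum_nz[of i]] by simp
  have "rate c i ^ 3 = ((c * ?l) powr (1/2)) powr 3"
    using c l by (simp add: rate_def powr_half_sqrt powr_numeral)
  also have "\<dots> = (c * ?l) powr (3/2)" by (simp add: powr_powr)
  finally have "1 / rate c i ^ 3 = (c * ?l) powr (-3/2)"
    by (simp add: powr_minus_divide)
  then show ?thesis using c l by (simp add: powr_mult)
qed

lemma summable_rate: "0 < c \<Longrightarrow> summable (\<lambda>i. 1 / (rate c i) ^ 3)"
  by (simp only: rate_cube) (intro summable_mult summable_sqlen)

lemma exp_minus_le: "0 < x \<Longrightarrow> exp (- x) \<le> 2 / x\<^sup>2" for x :: real
proof -
  assume x: "0 < x"
  have "x\<^sup>2 / 2 \<le> exp x" using exp_lower_Taylor_quadratic[of x] x by simp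
  then have "inverse (exp x) \<le> inverse (x\<^sup>2 / 2)"
    using x by (intro le_imp_inverse_le) auto
  then show ?thesis by (simp add: exp_minus field_simps)
qed

text \<open>The exponential is traded for two more inverse powers of the rate, which makes the sum
  over the modes converge. The price \<open>2 / r\<^sup>2\<close> is harmless at a fixed distance
  \<open>r > 0\<close>, where the bound serves for pointwise convergence.\<close>

lemma exp_rate_le:
  assumes "0 < c" "0 < r"
  shows "exp (- rate c i * r) / rate c i \<le> 2 / r\<^sup>2 * (1 / (rate c i) ^ 3)"
proof -
  have p: "0 < rate c i" by (rule rate_pos[OF assms(1)])
  have "exp (- rate c i * r) / rate c i \<le> (2 / (rate c i * r)\<^sup>2) / rate c i"
    using exp_minus_le[of "rate c i * r"] p assms by (intro divide_right_mono) auto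
  also have "\<dots> = 2 / r\<^sup>2 * (1 / (rate c i) ^ 3)"
    by (simp add: power_mult_distrib power2_eq_square power3_eq_cube)
  finally show ?thesis .
qed

context rect_lattice
begin

text \<open>Where \<open>fst x = fst y\<close> the modes lose their exponential decay. The value 0
  there, on a null set of \<open>y\<close>, keeps the kernel measurable, holomorphic in its
  parameters and Hermitian.\<close>

definition lat_kernel :: "(int \<times> int \<Rightarrow> complex) \<Rightarrow> real \<times> (real^2) \<Rightarrow> real \<times> (real^2) \<Rightarrow> complex" where
  "lat_kernel \<sigma> x y = (if fst x = fst y then 0
     else \<Sum>i. coef \<sigma> i \<bar>fst x - fst y\<bar> * wave (lat_enum i) (snd x - snd y))"

lemma norm_term_le:
  assumes "elliptic c \<sigma>" "0 < r"
  shows "cmod (coef \<sigma> i r * wave \<nu> p) \<le> 2 / r\<^sup>2 * (1 / (rate c i) ^ 3)"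
  using norm_coef_le[OF assms(1), of r i] exp_rate_le[of c r i] assms by (simp add: norm_mult elliptic_def)

lemma summable_bound:
  assumes "elliptic c \<sigma>"
  shows "summable (\<lambda>i. 2 / r\<^sup>2 * (1 / (rate c i) ^ 3))"
  using assms by (intro summable_mult summable_rate) (simp add: elliptic_def)

lemma summable_norm_terms:
  assumes "elliptic c \<sigma>" "0 < r"
  shows "summable (\<lambda>i. cmod (coef \<sigma> i r * wave (lat_enum i) p))"
  by (rule summable_comparison_test'[OF summable_bound[OF assms(1), of r]])
    (use norm_term_le[OF assms] in simp)

lemma lat_kernel_measurable:
  "(\<lambda>(x, y). lat_kernel \<sigma> x y) \<in> borel_measurable (borel \<Otimes>\<^sub>M borel)"
  unfolding lat_kernel_def[abs_def] coef_def[abs_def] by measurable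

lemma nn_integral_strip:
  assumes [measurable]: "F \<in> borel_measurable borel"
  shows "(\<integral>\<^sup>+y. F y \<partial>strip_measure a2 a3) = (\<integral>\<^sup>+y1. \<integral>\<^sup>+p. F (y1, p) * indicator (cell a2 a3) p \<partial>lborel \<partial>lborel)"
proof -
  have [measurable]: "UNIV \<times> cell a2 a3 \<in> sets (borel :: (real \<times> (real^2)) measure)"
    by (intro borel_Times) (use cell_borel in auto)
  have "(\<integral>\<^sup>+y. F y \<partial>strip_measure a2 a3) = (\<integral>\<^sup>+y. F y * indicator (UNIV \<times> cell a2 a3) y \<partial>lborel)"
    unfolding strip_measure_def by (rule nn_integral_restrict_space) simp
  also have "\<dots> = (\<integral>\<^sup>+y. F y * indicator (UNIV \<times> cell a2 a3) y \<partial>(lborel \<Otimes>\<^sub>M lborel))"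
    by (simp only: lborel_prod)
  also have "\<dots> = (\<integral>\<^sup>+y1. \<integral>\<^sup>+p. F (y1, p) * indicator (UNIV \<times> cell a2 a3) (y1, p) \<partial>lborel \<partial>lborel)"
  proof (rule lborel.nn_integral_fst[symmetric])
    have "(\<lambda>y. F y * indicator (UNIV \<times> cell a2 a3) y) \<in> borel_measurable borel" by measurable
    then show "(\<lambda>y. F y * indicator (UNIV \<times> cell a2 a3) y) \<in> borel_measurable (lborel \<Otimes>\<^sub>M lborel)"
      by (simp add: lborel_prod)
  qed
  also have "\<dots> = (\<integral>\<^sup>+y1. \<integral>\<^sup>+p. F (y1, p) * indicator (cell a2 a3) p \<partial>lborel \<partial>lborel)"
    by (simp add: indicator_times)
  finally show ?thesis .
qed

lemma area_nonneg: "0 \<le> area" by (simp add: area_def)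

text \<open>For a partial sum, Parseval over the cell removes the cross terms and the squared
  exponentials integrate to \<open>1 / rate\<close>, which leaves \<open>area\<close> times a
  partial sum of \<open>1 / rate ^ 3\<close>. Fatou's lemma carries the bound over to the full
  series.\<close>

lemma nn_integral_lat_kernel:
  assumes e: "elliptic c \<sigma>"
  shows "(\<integral>\<^sup>+y. ennreal ((cmod (lat_kernel \<sigma> x y))\<^sup>2) \<partial>strip_measure a2 a3) \<le> ennreal (area * (\<Sum>i. 1 / (rate c i) ^ 3))"
proof -
  have c: "0 < c" using e by (simp add: elliptic_def)
  define P where "P n y = (\<Sum>i<n. coef \<sigma> i \<bar>fst x - fst y\<bar> * wave (lat_enum i) (snd x - snd y))" for n y
  have P_meas [measurable]: "P n \<in> borel_measurable borel" for n
    unfolding P_def[abs_def] coef_def[abs_def] by measurable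
  have sets [measurable_cong]: "sets (strip_measure a2 a3) = sets (restrict_space borel (UNIV \<times> cell a2 a3))"
    unfolding strip_measure_def by (intro sets_restrict_space_cong) simp
  have le: "ennreal ((cmod (lat_kernel \<sigma> x y))\<^sup>2) \<le> liminf (\<lambda>n. ennreal ((cmod (P n y))\<^sup>2))" for y
  proof (cases "fst x = fst y")
    case False
    then have r: "0 < \<bar>fst x - fst y\<bar>" by simp
    have "(\<lambda>n. P n y) \<longlonglongrightarrow> lat_kernel \<sigma> x y"
      using summable_LIMSEQ[OF summable_norm_cancel[OF summable_norm_terms[OF e r]]] False
      by (simp add: P_def lat_kernel_def)
    then have "(\<lambda>n. ennreal ((cmod (P n y))\<^sup>2)) \<longlonglongrightarrow> ennreal ((cmod (lat_kernel \<sigma> x y))\<^sup>2)"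
      by (intro tendsto_ennrealI tendsto_intros)
    then show ?thesis using lim_imp_Liminf by force
  qed (simp add: lat_kernel_def)
  have bound: "(\<integral>\<^sup>+y. ennreal ((cmod (P n y))\<^sup>2) \<partial>strip_measure a2 a3) \<le> ennreal (area * (\<Sum>i. 1 / (rate c i) ^ 3))" for n
  proof -
    have "(\<integral>\<^sup>+y. ennreal ((cmod (P n y))\<^sup>2) \<partial>strip_measure a2 a3) =
        (\<integral>\<^sup>+y1. \<integral>\<^sup>+p. ennreal ((cmod (P n (y1, p)))\<^sup>2) * indicator (cell a2 a3) p \<partial>lborel \<partial>lborel)"
      by (rule nn_integral_strip) measurable
    also have "\<dots> = (\<integral>\<^sup>+y1. ennreal (area * (\<Sum>i<n. (cmod (coef \<sigma> i \<bar>fst x - y1\<bar>))\<^sup>2)) \<partial>lborel)"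
      unfolding P_def fst_conv snd_conv by (intro nn_integral_cong Parseval_cell)
    also have "\<dots> \<le> (\<integral>\<^sup>+y1. (\<Sum>i<n. ennreal (area / (rate c i)\<^sup>2) * ennreal (exp (- (2 * rate c i) * \<bar>fst x - y1\<bar>))) \<partial>lborel)"
    proof (intro nn_integral_mono)
      fix y1 :: real
      have "(cmod (coef \<sigma> i \<bar>fst x - y1\<bar>))\<^sup>2 \<le> 1 / (rate c i)\<^sup>2 * exp (- (2 * rate c i) * \<bar>fst x - y1\<bar>)" for i
      proof -
        have "(cmod (coef \<sigma> i \<bar>fst x - y1\<bar>))\<^sup>2 \<le> (exp (- rate c i * \<bar>fst x - y1\<bar>) / rate c i)\<^sup>2"
          by (intro power_mono norm_coef_le e) auto
        also have "\<dots> = 1 / (rate c i)\<^sup>2 * exp (- (2 * rate c i) * \<bar>fst x - y1\<bar>)"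
          by (simp add: power_divide exp_double[symmetric] mult_ac)
        finally show ?thesis .
      qed
      then have "area * (\<Sum>i<n. (cmod (coef \<sigma> i \<bar>fst x - y1\<bar>))\<^sup>2) \<le>
          area * (\<Sum>i<n. 1 / (rate c i)\<^sup>2 * exp (- (2 * rate c i) * \<bar>fst x - y1\<bar>))"
        by (intro mult_left_mono sum_mono area_nonneg)
      also have "\<dots> = (\<Sum>i<n. area / (rate c i)\<^sup>2 * exp (- (2 * rate c i) * \<bar>fst x - y1\<bar>))"
        by (simp add: sum_distrib_left)
      finally show "ennreal (area * (\<Sum>i<n. (cmod (coef \<sigma> i \<bar>fst x - y1\<bar>))\<^sup>2)) \<le>
          (\<Sum>i<n. ennreal (area / (rate c i)\<^sup>2) * ennreal (exp (- (2 * rate c i) * \<bar>fst x - y1\<bar>)))"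
        by (simp add: area_nonneg ennreal_mult[symmetric] sum_ennreal ennreal_leI)
    qed
    also have "\<dots> = (\<Sum>i<n. ennreal (area / (rate c i)\<^sup>2) * (\<integral>\<^sup>+y1. ennreal (exp (- (2 * rate c i) * \<bar>fst x - y1\<bar>)) \<partial>lborel))"
      by (simp add: nn_integral_sum nn_integral_cmult)
    also have "\<dots> = (\<Sum>i<n. ennreal (area / (rate c i)\<^sup>2) * ennreal (1 / rate c i))"
      by (simp only: nn_integral_exp_abs[OF rate_pos[OF c]])
    also have "\<dots> = ennreal (\<Sum>i<n. area * (1 / (rate c i) ^ 3))"
      using rate_pos[OF c] area_nonneg
      by (simp add: ennreal_mult[symmetric] sum_ennreal less_imp_le power2_eq_square power3_eq_cube)
    also have "\<dots> = ennreal (area * (\<Sum>i<n. 1 / (rate c i) ^ 3))"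
      by (simp only: sum_distrib_left)
    also have "\<dots> \<le> ennreal (area * (\<Sum>i. 1 / (rate c i) ^ 3))"
      using rate_pos[OF c] by (intro ennreal_leI mult_left_mono sum_le_suminf summable_rate c area_nonneg)
        (auto simp: less_imp_le)
    finally show ?thesis .
  qed
  have "(\<integral>\<^sup>+y. ennreal ((cmod (lat_kernel \<sigma> x y))\<^sup>2) \<partial>strip_measure a2 a3) \<le>
      (\<integral>\<^sup>+y. liminf (\<lambda>n. ennreal ((cmod (P n y))\<^sup>2)) \<partial>strip_measure a2 a3)"
    by (intro nn_integral_mono le)
  also have "\<dots> \<le> liminf (\<lambda>n. \<integral>\<^sup>+y. ennreal ((cmod (P n y))\<^sup>2) \<partial>strip_measure a2 a3)"
  proof (rule nn_integral_liminf)
    have "P n \<in> borel_measurable (strip_measure a2 a3)" for n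
      unfolding strip_measure_def by (rule measurable_restrict_space1) (use P_meas in simp)
    then show "(\<lambda>y. ennreal ((cmod (P n y))\<^sup>2)) \<in> borel_measurable (strip_measure a2 a3)" for n by measurable
  qed
  also have "\<dots> \<le> ennreal (area * (\<Sum>i. 1 / (rate c i) ^ 3))"
    by (rule Liminf_le) (use bound in auto)
  finally show ?thesis .
qed

lemma lat_kernel_holomorphic:
  assumes D: "open D" and e: "\<And>z. z \<in> D \<Longrightarrow> elliptic c (\<sigma> z)"
    and hol: "\<And>\<nu>. (\<lambda>z. \<sigma> z \<nu>) holomorphic_on D"
  shows "(\<lambda>z. lat_kernel (\<sigma> z) x y) holomorphic_on D"
proof (cases "fst x = fst y \<or> D = {}")
  case True
  then show ?thesis
  proof
    assume "fst x = fst y" then show ?thesis by (simp add: lat_kernel_def)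
  next
    assume "D = {}" then show ?thesis by (simp add: holomorphic_on_def)
  qed
next
  case False
  then obtain z0 where z0: "z0 \<in> D" by blast
  let ?r = "\<bar>fst x - fst y\<bar>"
  have r: "0 < ?r" using False by simp
  let ?f = "\<lambda>i z. coef (\<sigma> z) i ?r * wave (lat_enum i) (snd x - snd y)"
  have pos: "0 < Re (\<sigma> z (lat_enum i))" if "z \<in> D" for z i
    by (rule elliptic_Re_pos[OF e[OF that]])
  define \<kappa> where "\<kappa> i z = csqrt (\<sigma> z (lat_enum i))" for i z
  have "\<kappa> i holomorphic_on D" for i
    unfolding \<kappa>_def[abs_def] by (rule holomorphic_on_csqrt_Re_pos[OF hol pos])
  moreover have "\<kappa> i z \<noteq> 0" if "z \<in> D" for z i
    using pos[OF that, of i] by (auto simp: \<kappa>_def)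
  ultimately have f: "?f i holomorphic_on D" for i
    unfolding coef_def \<kappa>_def[symmetric] by (intro holomorphic_intros) auto
  have "(\<lambda>z. \<Sum>i. ?f i z) holomorphic_on D"
    by (rule holomorphic_on_suminf[OF D f summable_bound[OF e[OF z0], of ?r] norm_term_le[OF e r]])
  then show ?thesis using False by (simp add: lat_kernel_def)
qed

lemma lat_kernel_hermitian:
  assumes e: "elliptic c \<sigma>" and real: "\<And>\<nu>. \<sigma> \<nu> \<in> \<real>"
  shows "lat_kernel \<sigma> y x = cnj (lat_kernel \<sigma> x y)"
proof (cases "fst x = fst y")
  case False
  let ?r = "\<bar>fst x - fst y\<bar>"
  have r: "0 < ?r" using False by simp
  have c: "coef \<sigma> i ?r \<in> \<real>" for i
  proof -
    obtain a where a: "\<sigma> (lat_enum i) = of_real a" using real[of "lat_enum i"] by (auto elim: Reals_cases)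
    have "0 \<le> a" using elliptic_Re_pos[OF e, of i] by (simp add: a)
    then have "csqrt (\<sigma> (lat_enum i)) = of_real (sqrt a)" by (simp add: a)
    then show ?thesis unfolding coef_def
      by (metis Reals_of_real Reals_mult Reals_minus Reals_divide exp_in_Reals)
  qed
  have w: "wave \<nu> (snd y - snd x) = cnj (wave \<nu> (snd x - snd y))" for \<nu>
    by (simp add: wave_def cis_cnj inner_diff_right)
  have "(\<Sum>i. coef \<sigma> i ?r * wave (lat_enum i) (snd y - snd x)) =
      (\<Sum>i. cnj (coef \<sigma> i ?r * wave (lat_enum i) (snd x - snd y)))"
    unfolding w complex_cnj_mult using c by (simp add: Reals_cnj_iff)
  also have "\<dots> = cnj (\<Sum>i. coef \<sigma> i ?r * wave (lat_enum i) (snd x - snd y))"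
    by (rule bounded_linear.suminf[OF bounded_linear_cnj, symmetric])
      (rule summable_norm_cancel[OF summable_norm_terms[OF e r]])
  finally show ?thesis using False by (simp add: lat_kernel_def abs_minus_commute)
qed (simp add: lat_kernel_def)

end

section \<open>The regular part of the kernel\<close>

lemma nn_integral_le_imp_integral_le:
  assumes f: "f \<in> borel_measurable M" "\<And>x. 0 \<le> f x" and C: "0 \<le> C"
    and le: "(\<integral>\<^sup>+x. ennreal (f x) \<partial>M) \<le> ennreal C"
  shows "integrable M f" "(LINT x|M. f x) \<le> C"
proof -
  show int: "integrable M f"
    by (rule integrableI_bounded) (use f le in \<open>auto simp: le_less_trans[OF le]\<close>)
  have "ennreal (LINT x|M. f x) \<le> ennreal C"
    using nn_integral_eq_integral[OF int] f(2) le by simp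
  then show "(LINT x|M. f x) \<le> C" using C by simp
qed

lemma (in small_kernel) small_kernel_conjugate:
  assumes [measurable]: "a \<in> borel_measurable M" and a: "\<And>x. cmod (a x) = 1"
  shows "small_kernel M (\<lambda>x y. a x * m x y * cnj (a y)) w"
proof -
  have n: "cmod (a x * m x y * cnj (a y)) = cmod (m x y)" for x y
    by (simp add: norm_mult a)
  interpret c: dominated_kernel M "\<lambda>x y. a x * m x y * cnj (a y)" w
    by unfold_locales (use w_nonneg w_integrable kernel_integrable kernel_bound in \<open>simp_all add: n\<close>)
  show ?thesis
    by unfold_locales (use \<omega>_less_1 in \<open>simp add: c.\<omega>_def \<omega>_def\<close>)
qed

text \<open>The exponential is 1-Lipschitz on the closed left half plane, its derivative having
  modulus at most 1 there. The bound is free of \<open>\<kappa>\<close> and so survives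
  \<open>\<kappa>\<close> tending to 0.\<close>

lemma norm_exp_minus_1_le:
  fixes \<kappa> :: complex
  assumes "0 \<le> Re \<kappa>" "\<kappa> \<noteq> 0" "0 \<le> r"
  shows "cmod ((exp (- \<kappa> * of_real r) - 1) / \<kappa>) \<le> r"
proof -
  have "cmod (exp (- \<kappa> * of_real r) - exp 0) \<le> 1 * cmod (- \<kappa> * of_real r - 0)"
  proof (rule field_differentiable_bound[where S = "{z. Re z \<le> 0}" and f' = exp])
    show "convex {z. Re z \<le> 0}" by (rule convex_halfspace_Re_le)
    show "(exp has_field_derivative exp z) (at z within {z. Re z \<le> 0})" for z :: complex
      by (auto intro!: derivative_eq_intros)
  qed (use assms in auto)
  then show ?thesis using assms by (simp add: norm_divide norm_mult divide_le_eq mult.commute)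
qed

locale potential = rect_lattice +
  fixes W :: "real \<times> (real^2) \<Rightarrow> real" and B :: real
  assumes W_meas [measurable]: "W \<in> borel_measurable (strip_measure a2 a3)"
    and W_bound: "AE x in strip_measure a2 a3. \<bar>W x\<bar> \<le> B"
    and W_decay: "integrable (strip_measure a2 a3) (\<lambda>x. (W x * (1 + \<bar>fst x\<bar>))\<^sup>2)"
    and W_nz: "\<not> (AE x in strip_measure a2 a3. W x = 0)"
begin

abbreviation M where "M \<equiv> strip_measure a2 a3"

lemma strip_sets [measurable]: "UNIV \<times> cell a2 a3 \<in> sets (borel :: (real \<times> (real^2)) measure)"
  by (intro borel_Times) (use cell_borel in auto)

lemma id_measurable: "(\<lambda>x. x) \<in> M \<rightarrow>\<^sub>M borel"
  unfolding strip_measure_def by (rule measurable_restrict_space1) simp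

lemma fst_snd_measurable [measurable]: "fst \<in> borel_measurable M" "snd \<in> borel_measurable M"
  using measurable_compose[OF id_measurable fst_snd_borel_measurable(1)]
    measurable_compose[OF id_measurable fst_snd_borel_measurable(2)] .

sublocale strip: sigma_finite_measure M
  unfolding strip_measure_def by (rule sigma_finite_measure_restrict_space) (simp_all add: lborel.sigma_finite_measure_axioms)

lemma lat_kernel_measurable_strip [measurable]:
  "(\<lambda>(x, y). lat_kernel \<sigma> x y) \<in> borel_measurable (M \<Otimes>\<^sub>M M)"
proof -
  have "(\<lambda>p. (fst p, snd p)) \<in> M \<Otimes>\<^sub>M M \<rightarrow>\<^sub>M borel \<Otimes>\<^sub>M borel"
    using id_measurable by (intro measurable_Pair measurable_compose[OF measurable_fst] measurable_compose[OF measurable_snd])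
  from measurable_compose[OF this lat_kernel_measurable] show ?thesis
    by (simp add: case_prod_beta')
qed

definition A :: real where "A = (LINT x|M. (W x * (1 + \<bar>fst x\<bar>))\<^sup>2)"

definition Q :: real where "Q = (LINT x|M. (W x)\<^sup>2)"

text \<open>\<open>2 * A\<close> comes from the mode \<open>K = 0\<close>, the other summand from
  the remaining modes, where \<open>W y\<close> is bounded by \<open>B\<close>; the factors 2 stem
  from splitting the square of a sum.\<close>

definition kernel_const :: "real \<Rightarrow> real" where
  "kernel_const c = sqrt (2 * A + 2 * B\<^sup>2 * (area * (\<Sum>i. 1 / (rate c i) ^ 3)))"

definition weight :: "real \<Rightarrow> real \<Rightarrow> real \<times> (real^2) \<Rightarrow> real" where
  "weight c b x = \<bar>b\<bar> * kernel_const c * (\<bar>W x\<bar> * (1 + \<bar>fst x\<bar>))"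

text \<open>The L2 norm of \<open>weight c 1\<close>. Since the weight is proportional to
  \<open>|b|\<close>, smallness of the operator becomes a condition on
  \<open>|b| * amplitude c\<close>.\<close>

definition amplitude :: "real \<Rightarrow> real" where
  "amplitude c = kernel_const c * sqrt A"

text \<open>
  The kernel of \<open>g \<Gamma>\<^sub>k\<close>, with \<open>b = g \<beta>\<close>, conjugated by plane waves and without the pole \<open>b W(x) W(y) / \<kappa>\<close>.
\<close>

definition reg_kernel :: "real \<Rightarrow> complex \<Rightarrow> (int \<times> int \<Rightarrow> complex) \<Rightarrow> real \<times> (real^2) \<Rightarrow> real \<times> (real^2) \<Rightarrow> complex" where
  "reg_kernel b \<kappa> \<sigma> x y = of_real (b * W x * W y) *
     ((exp (- \<kappa> * of_real \<bar>fst x - fst y\<bar>) - 1) / \<kappa> + lat_kernel \<sigma> x y)"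

lemma A_nonneg: "0 \<le> A" by (simp add: A_def)

lemma rate_sum_nonneg: "0 < c \<Longrightarrow> 0 \<le> (\<Sum>i. 1 / (rate c i) ^ 3)"
  using rate_pos[of c] by (intro suminf_nonneg summable_rate) (auto simp: less_imp_le)

lemma kernel_const_sq:
  "0 < c \<Longrightarrow> (kernel_const c)\<^sup>2 = 2 * A + 2 * B\<^sup>2 * (area * (\<Sum>i. 1 / (rate c i) ^ 3))"
  using A_nonneg area_nonneg rate_sum_nonneg by (simp add: kernel_const_def)

lemma kernel_const_nonneg: "0 < c \<Longrightarrow> 0 \<le> kernel_const c"
  using A_nonneg area_nonneg rate_sum_nonneg[of c] by (simp add: kernel_const_def)

lemma dominated_reg_kernel:
  assumes e: "elliptic c \<sigma>" and \<kappa>: "0 \<le> Re \<kappa>" "\<kappa> \<noteq> 0"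
  shows "dominated_kernel M (reg_kernel b \<kappa> \<sigma>) (weight c b)"
proof -
  have c: "0 < c" using e by (simp add: elliptic_def)
  let ?S = "area * (\<Sum>i. 1 / (rate c i) ^ 3)"
  have meas [measurable]: "(\<lambda>(x, y). reg_kernel b \<kappa> \<sigma> x y) \<in> borel_measurable (M \<Otimes>\<^sub>M M)"
    unfolding reg_kernel_def[abs_def] by measurable
  have *: "integrable M (\<lambda>y. (cmod (reg_kernel b \<kappa> \<sigma> x y))\<^sup>2) \<and> (LINT y|M. (cmod (reg_kernel b \<kappa> \<sigma> x y))\<^sup>2) \<le> (weight c b x)\<^sup>2"
    if x: "x \<in> space M" for x
  proof -
    have [measurable]: "reg_kernel b \<kappa> \<sigma> x \<in> borel_measurable M" "lat_kernel \<sigma> x \<in> borel_measurable M"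
      using measurable_Pair2[OF meas x] measurable_Pair2[OF lat_kernel_measurable_strip x] by simp_all
    have le: "AE y in M. ennreal ((cmod (reg_kernel b \<kappa> \<sigma> x y))\<^sup>2) \<le>
        ennreal ((b * W x)\<^sup>2 * (2 * (1 + \<bar>fst x\<bar>)\<^sup>2)) * ennreal ((W y * (1 + \<bar>fst y\<bar>))\<^sup>2) +
        ennreal ((b * W x)\<^sup>2 * (2 * B\<^sup>2)) * ennreal ((cmod (lat_kernel \<sigma> x y))\<^sup>2)"
      using W_bound
    proof eventually_elim
      case (elim y)
      let ?p = "(exp (- \<kappa> * of_real \<bar>fst x - fst y\<bar>) - 1) / \<kappa>" and ?l = "lat_kernel \<sigma> x y"
      have "cmod ?p \<le> \<bar>fst x - fst y\<bar>"
        by (rule norm_exp_minus_1_le[OF \<kappa>]) simp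
      also have "\<dots> \<le> (1 + \<bar>fst x\<bar>) * (1 + \<bar>fst y\<bar>)"
      proof -
        have "\<bar>fst x - fst y\<bar> \<le> \<bar>fst x\<bar> + \<bar>fst y\<bar>" by simp
        also have "\<dots> \<le> (1 + \<bar>fst x\<bar>) * (1 + \<bar>fst y\<bar>)" by (simp add: algebra_simps)
        finally show ?thesis .
      qed
      finally have p: "(cmod ?p)\<^sup>2 \<le> ((1 + \<bar>fst x\<bar>) * (1 + \<bar>fst y\<bar>))\<^sup>2"
        by (intro power_mono) auto
      have "(cmod (?p + ?l))\<^sup>2 \<le> (cmod ?p + cmod ?l)\<^sup>2"
        by (intro power_mono norm_triangle_ineq) simp
      also have "\<dots> \<le> 2 * (cmod ?p)\<^sup>2 + 2 * (cmod ?l)\<^sup>2"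
        using sum_squares_bound[of "cmod ?p" "cmod ?l"] by (simp add: power2_sum)
      also have "\<dots> \<le> 2 * ((1 + \<bar>fst x\<bar>) * (1 + \<bar>fst y\<bar>))\<^sup>2 + 2 * (cmod ?l)\<^sup>2"
        using p by simp
      finally have pl: "(cmod (?p + ?l))\<^sup>2 \<le> 2 * ((1 + \<bar>fst x\<bar>) * (1 + \<bar>fst y\<bar>))\<^sup>2 + 2 * (cmod ?l)\<^sup>2" .
      have "(W y)\<^sup>2 \<le> B\<^sup>2" using elim by (simp add: abs_le_square_iff[symmetric])
      then have Wl: "(b * W x)\<^sup>2 * (2 * ((W y)\<^sup>2 * (cmod ?l)\<^sup>2)) \<le> (b * W x)\<^sup>2 * (2 * (B\<^sup>2 * (cmod ?l)\<^sup>2))"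
        by (intro mult_left_mono mult_right_mono) auto
      have "(cmod (reg_kernel b \<kappa> \<sigma> x y))\<^sup>2 = (b * W x)\<^sup>2 * (W y)\<^sup>2 * (cmod (?p + ?l))\<^sup>2"
        by (simp only: reg_kernel_def norm_mult norm_of_real power_mult_distrib power2_abs mult.assoc)
      also have "\<dots> \<le> (b * W x)\<^sup>2 * (W y)\<^sup>2 * (2 * ((1 + \<bar>fst x\<bar>) * (1 + \<bar>fst y\<bar>))\<^sup>2 + 2 * (cmod ?l)\<^sup>2)"
        by (intro mult_left_mono pl) simp
      also have "\<dots> = (b * W x)\<^sup>2 * (2 * (1 + \<bar>fst x\<bar>)\<^sup>2) * (W y * (1 + \<bar>fst y\<bar>))\<^sup>2 + (b * W x)\<^sup>2 * (2 * ((W y)\<^sup>2 * (cmod ?l)\<^sup>2))"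
      proof -
        have "P * y\<^sup>2 * (2 * (p * q)\<^sup>2 + 2 * l) = P * (2 * p\<^sup>2) * (y * q)\<^sup>2 + P * (2 * (y\<^sup>2 * l))" for P y p q l :: real
          by (simp add: power_mult_distrib algebra_simps)
        then show ?thesis .
      qed
      also have "\<dots> \<le> (b * W x)\<^sup>2 * (2 * (1 + \<bar>fst x\<bar>)\<^sup>2) * (W y * (1 + \<bar>fst y\<bar>))\<^sup>2 + (b * W x)\<^sup>2 * (2 * (B\<^sup>2 * (cmod ?l)\<^sup>2))"
        using Wl by simp
      finally have fin: "(cmod (reg_kernel b \<kappa> \<sigma> x y))\<^sup>2 \<le>
          (b * W x)\<^sup>2 * (2 * (1 + \<bar>fst x\<bar>)\<^sup>2) * (W y * (1 + \<bar>fst y\<bar>))\<^sup>2 + (b * W x)\<^sup>2 * (2 * B\<^sup>2) * (cmod ?l)\<^sup>2"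
        by (simp add: mult.assoc)
      show ?case
        using ennreal_leI[OF fin] by (simp add: ennreal_mult ennreal_plus)
    qed
    have "(\<integral>\<^sup>+y. ennreal ((cmod (reg_kernel b \<kappa> \<sigma> x y))\<^sup>2) \<partial>M) \<le>
       (\<integral>\<^sup>+y. ennreal ((b * W x)\<^sup>2 * (2 * (1 + \<bar>fst x\<bar>)\<^sup>2)) * ennreal ((W y * (1 + \<bar>fst y\<bar>))\<^sup>2) +
        ennreal ((b * W x)\<^sup>2 * (2 * B\<^sup>2)) * ennreal ((cmod (lat_kernel \<sigma> x y))\<^sup>2) \<partial>M)"
      by (rule nn_integral_mono_AE[OF le])
    also have "\<dots> = ennreal ((b * W x)\<^sup>2 * (2 * (1 + \<bar>fst x\<bar>)\<^sup>2)) * (\<integral>\<^sup>+y. ennreal ((W y * (1 + \<bar>fst y\<bar>))\<^sup>2) \<partial>M) +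
        ennreal ((b * W x)\<^sup>2 * (2 * B\<^sup>2)) * (\<integral>\<^sup>+y. ennreal ((cmod (lat_kernel \<sigma> x y))\<^sup>2) \<partial>M)"
      by (subst nn_integral_add) (simp_all add: nn_integral_cmult)
    also have "(\<integral>\<^sup>+y. ennreal ((W y * (1 + \<bar>fst y\<bar>))\<^sup>2) \<partial>M) = ennreal A"
      unfolding A_def by (rule nn_integral_eq_integral[OF W_decay]) simp
    also have "ennreal ((b * W x)\<^sup>2 * (2 * (1 + \<bar>fst x\<bar>)\<^sup>2)) * ennreal A +
        ennreal ((b * W x)\<^sup>2 * (2 * B\<^sup>2)) * (\<integral>\<^sup>+y. ennreal ((cmod (lat_kernel \<sigma> x y))\<^sup>2) \<partial>M) \<le>
        ennreal ((b * W x)\<^sup>2 * (2 * (1 + \<bar>fst x\<bar>)\<^sup>2)) * ennreal A +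
        ennreal ((b * W x)\<^sup>2 * (2 * B\<^sup>2)) * ennreal ?S"
      by (intro add_left_mono mult_left_mono nn_integral_lat_kernel[OF e]) simp
    also have "\<dots> = ennreal ((b * W x)\<^sup>2 * (2 * (1 + \<bar>fst x\<bar>)\<^sup>2) * A + (b * W x)\<^sup>2 * (2 * B\<^sup>2) * ?S)"
      using A_nonneg area_nonneg rate_sum_nonneg[OF c]
      by (subst (1 2) ennreal_mult[symmetric]) (auto simp: ennreal_plus[symmetric] simp del: ennreal_plus)
    also have "\<dots> \<le> ennreal ((weight c b x)\<^sup>2)"
    proof (rule ennreal_leI)
      \<comment> \<open>The lattice part does not grow in \<open>x\<close>; it is enlarged by
        \<open>(1 + |fst x|)\<^sup>2\<close> so that one weight dominates both parts.\<close>
      have "1 \<le> (1 + \<bar>fst x\<bar>)\<^sup>2" by (rule one_le_power) simp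
      then have "1 * ((b * W x)\<^sup>2 * (2 * B\<^sup>2) * ?S) \<le> (1 + \<bar>fst x\<bar>)\<^sup>2 * ((b * W x)\<^sup>2 * (2 * B\<^sup>2) * ?S)"
        using area_nonneg rate_sum_nonneg[OF c] by (intro mult_right_mono) auto
      moreover have "(weight c b x)\<^sup>2 = (b * W x)\<^sup>2 * (1 + \<bar>fst x\<bar>)\<^sup>2 * (kernel_const c)\<^sup>2"
        by (simp add: weight_def power_mult_distrib mult_ac)
      ultimately show "(b * W x)\<^sup>2 * (2 * (1 + \<bar>fst x\<bar>)\<^sup>2) * A + (b * W x)\<^sup>2 * (2 * B\<^sup>2) * ?S \<le> (weight c b x)\<^sup>2"
        unfolding kernel_const_sq[OF c] by (simp add: algebra_simps)
    qed
    finally have "(\<integral>\<^sup>+y. ennreal ((cmod (reg_kernel b \<kappa> \<sigma> x y))\<^sup>2) \<partial>M) \<le> ennreal ((weight c b x)\<^sup>2)" .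
    from nn_integral_le_imp_integral_le[OF _ _ _ this] show ?thesis by simp
  qed
  have w: "(weight c b x)\<^sup>2 = (\<bar>b\<bar> * kernel_const c)\<^sup>2 * (W x * (1 + \<bar>fst x\<bar>))\<^sup>2" for x
    by (simp add: weight_def power_mult_distrib)
  show ?thesis
  proof
    show "weight c b \<in> borel_measurable M" unfolding weight_def[abs_def] by measurable
    show "0 \<le> weight c b x" for x by (simp add: weight_def kernel_const_nonneg[OF c])
    show "integrable M (\<lambda>x. (weight c b x)\<^sup>2)" unfolding w using W_decay by simp
  qed (use * meas in auto)
qed

lemma small_reg_kernel:
  assumes e: "elliptic c \<sigma>" and \<kappa>: "0 \<le> Re \<kappa>" "\<kappa> \<noteq> 0" and b: "\<bar>b\<bar> * amplitude c < 1"
  shows "small_kernel M (reg_kernel b \<kappa> \<sigma>) (weight c b)"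
    and "dominated_kernel.\<omega> M (weight c b) = \<bar>b\<bar> * amplitude c"
proof -
  interpret dominated_kernel M "reg_kernel b \<kappa> \<sigma>" "weight c b"
    by (rule dominated_reg_kernel[OF e \<kappa>])
  have c: "0 < c" using e by (simp add: elliptic_def)
  have "(weight c b x)\<^sup>2 = (\<bar>b\<bar> * kernel_const c)\<^sup>2 * (W x * (1 + \<bar>fst x\<bar>))\<^sup>2" for x
    by (simp add: weight_def power_mult_distrib)
  then have "(LINT x|M. (weight c b x)\<^sup>2) = (\<bar>b\<bar> * kernel_const c)\<^sup>2 * A"
    by (simp add: A_def)
  then show eq: "\<omega> = \<bar>b\<bar> * amplitude c"
    by (simp add: \<omega>_def amplitude_def real_sqrt_mult kernel_const_nonneg[OF c])
  show "small_kernel M (reg_kernel b \<kappa> \<sigma>) (weight c b)"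
    by unfold_locales (use b eq in simp)
qed

abbreviation WC where "WC \<equiv> (\<lambda>x. complex_of_real (W x))"

lemma W_sq_integrable: "integrable M (\<lambda>x. (W x)\<^sup>2)"
proof (rule Bochner_Integration.integrable_bound[OF W_decay])
  show "AE x in M. norm ((W x)\<^sup>2) \<le> norm ((W x * (1 + \<bar>fst x\<bar>))\<^sup>2)"
  proof (intro AE_I2)
    fix x :: "real \<times> (real^2)"
    have "1 \<le> (1 + \<bar>fst x\<bar>)\<^sup>2" by (rule one_le_power) simp
    then have "(W x)\<^sup>2 * 1 \<le> (W x)\<^sup>2 * (1 + \<bar>fst x\<bar>)\<^sup>2" by (intro mult_left_mono) auto
    then show "norm ((W x)\<^sup>2) \<le> norm ((W x * (1 + \<bar>fst x\<bar>))\<^sup>2)" by (simp add: power_mult_distrib)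
  qed
qed measurable

lemma WC_L2: "WC \<in> L2_space M"
  by (rule L2_spaceI) (use W_sq_integrable in simp_all)

lemma norm_WC: "(norm_L2 M WC)\<^sup>2 = Q"
  by (simp add: norm_L2_sq Q_def)

lemma Q_pos: "0 < Q"
proof -
  have "Q \<noteq> 0"
    using W_nz integral_nonneg_eq_0_iff_AE[OF W_sq_integrable] by (simp add: Q_def)
  moreover have "0 \<le> Q" by (simp add: Q_def)
  ultimately show ?thesis by simp
qed

text \<open>Sherman-Morrison gives singularity in the form \<open>b / \<kappa>\<close> times the
  matrix element equal to 1. Multiplied by \<open>\<kappa>\<close> this becomes the fixed point
  equation \<open>Phi = \<kappa>\<close>, free of the pole.\<close>

definition Phi :: "real \<Rightarrow> complex \<Rightarrow> (int \<times> int \<Rightarrow> complex) \<Rightarrow> complex" where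
  "Phi b \<kappa> \<sigma> = of_real b * (LINT x|M. WC x * neumann M (reg_kernel b \<kappa> \<sigma>) WC x)"

lemma Phi_bound:
  assumes e: "elliptic c \<sigma>" and \<kappa>: "0 \<le> Re \<kappa>" "\<kappa> \<noteq> 0" and b: "0 \<le> b" "b * amplitude c \<le> 1/9"
  shows "cmod (Phi b \<kappa> \<sigma> - of_real (b * Q)) \<le> b * Q / 8"
proof -
  interpret small_kernel M "reg_kernel b \<kappa> \<sigma>" "weight c b"
    by (rule small_reg_kernel(1)[OF e \<kappa>]) (use b in simp)
  have \<omega>: "\<omega> \<le> 1/9" using small_reg_kernel(2)[OF e \<kappa>, of b] b by simp
  \<comment> \<open>This is the origin of 1/9: \<open>x / (1 - x)\<close> equals 1/8 at
    \<open>x = 1/9\<close>, and a relative error of 1/8 is a quarter of the relative radius 1/2 of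
    the disc used later.\<close>
  have "\<omega> / (1 - \<omega>) \<le> 1/8"
    using \<omega> by (simp add: divide_le_eq)
  then have Q: "Q * (\<omega> / (1 - \<omega>)) \<le> Q * (1/8)" using Q_pos by (intro mult_left_mono) auto
  have WW: "(LINT x|M. WC x * WC x) = of_real Q"
    by (simp add: Q_def power2_eq_square flip: of_real_mult)
  have "cmod ((LINT x|M. WC x * N WC x) - of_real Q) \<le> Q * (\<omega> / (1 - \<omega>))"
    using integral_N_bound[OF WC_L2 WC_L2] norm_WC[unfolded power2_eq_square] by (simp only: WW)
  also note Q
  finally have "cmod ((LINT x|M. WC x * N WC x) - of_real Q) \<le> Q / 8" by simp
  then have "b * cmod ((LINT x|M. WC x * N WC x) - of_real Q) \<le> b * (Q / 8)"
    using b by (intro mult_left_mono)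
  moreover have "Phi b \<kappa> \<sigma> - of_real (b * Q) = of_real b * ((LINT x|M. WC x * N WC x) - of_real Q)"
    by (simp add: Phi_def algebra_simps)
  ultimately show ?thesis using b by (simp add: norm_mult)
qed

lemma Phi_holomorphic:
  assumes D: "open D" and e: "\<And>z. z \<in> D \<Longrightarrow> elliptic c (\<sigma> z)"
    and hol: "\<And>\<nu>. (\<lambda>z. \<sigma> z \<nu>) holomorphic_on D" and \<kappa>hol: "\<kappa> holomorphic_on D"
    and \<kappa>: "\<And>z. z \<in> D \<Longrightarrow> 0 \<le> Re (\<kappa> z)" "\<And>z. z \<in> D \<Longrightarrow> \<kappa> z \<noteq> 0"
    and b: "\<bar>b\<bar> * amplitude c < 1"
  shows "(\<lambda>z. Phi b (\<kappa> z) (\<sigma> z)) holomorphic_on D"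
  unfolding Phi_def
proof (intro holomorphic_on_mult holomorphic_on_const holomorphic_on_neumann[OF D _ _ WC_L2 WC_L2])
  show "small_kernel M (reg_kernel b (\<kappa> z) (\<sigma> z)) (weight c b)" if "z \<in> D" for z
    by (rule small_reg_kernel(1)[OF e \<kappa> b]) (use that in auto)
  show "(\<lambda>z. reg_kernel b (\<kappa> z) (\<sigma> z) x y) holomorphic_on D" for x y
    unfolding reg_kernel_def using \<kappa>(2)
    by (intro holomorphic_on_mult holomorphic_on_const holomorphic_on_add lat_kernel_holomorphic[OF D e hol]
        holomorphic_on_divide holomorphic_on_diff holomorphic_on_exp' holomorphic_on_minus \<kappa>hol) auto
qed

lemma Phi_real:
  assumes e: "elliptic c \<sigma>" and \<kappa>: "0 < Re \<kappa>" "\<kappa> \<in> \<real>" and \<sigma>: "\<And>\<nu>. \<sigma> \<nu> \<in> \<real>"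
    and b: "\<bar>b\<bar> * amplitude c < 1"
  shows "Phi b \<kappa> \<sigma> \<in> \<real>"
proof -
  interpret small_kernel M "reg_kernel b \<kappa> \<sigma>" "weight c b"
    by (rule small_reg_kernel(1)[OF e _ _ b]) (use \<kappa> in auto)
  obtain k where k: "\<kappa> = of_real k" using \<kappa>(2) by (auto elim: Reals_cases)
  have herm: "reg_kernel b \<kappa> \<sigma> y x = cnj (reg_kernel b \<kappa> \<sigma> x y)" for x y
    unfolding reg_kernel_def lat_kernel_hermitian[OF e \<sigma>, of y x]
    by (simp add: k exp_cnj abs_minus_commute[of "fst y" "fst x"] mult_ac)
  have "(LINT x|M. WC x * N WC x) \<in> \<real>"
    by (rule neumann_hermitian_real[OF herm WC_L2]) simp
  then show ?thesis unfolding Phi_def by (intro Reals_mult) auto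
qed

end

section \<open>The singular set as a fixed point equation\<close>

context rect_lattice
begin

text \<open>The positive root of \<open>|k|\<^sup>2 - E\<close> outside the circle and a negative
  imaginary number inside it, as the prescribed branch demands. Its real part is nonnegative on both
  sides, so one kernel formula covers them.\<close>

definition kappa_of :: "real \<Rightarrow> real^2 \<Rightarrow> complex" where
  "kappa_of E k = - \<i> * csqrt (of_real (E - (norm k)\<^sup>2))"

definition sigma_of :: "real \<Rightarrow> real^2 \<Rightarrow> int \<times> int \<Rightarrow> complex" where
  "sigma_of E k \<nu> = of_real ((norm (k + freq \<nu>))\<^sup>2 - E)"

definition plane :: "real^2 \<Rightarrow> real \<times> (real^2) \<Rightarrow> complex" where
  "plane k x = cis (k \<bullet> snd x)"

lemma norm_plane [simp]: "cmod (plane k x) = 1"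
  by (simp add: plane_def)

lemma plane_cnj: "plane k x * cnj (plane k x) = 1"
  by (simp add: plane_def cis_cnj cis_mult)

lemma kappa_of_ne_0: "(norm k)\<^sup>2 \<noteq> E \<Longrightarrow> kappa_of E k \<noteq> 0"
  by (simp add: kappa_of_def del: of_real_diff csqrt.simps)

lemma kappa_of_above: "E \<le> (norm k)\<^sup>2 \<Longrightarrow> kappa_of E k = of_real (sqrt ((norm k)\<^sup>2 - E))"
  using csqrt_of_real_nonpos[of "of_real (E - (norm k)\<^sup>2)"]
  by (simp add: kappa_of_def del: of_real_diff csqrt.simps)

lemma kappa_of_below: "(norm k)\<^sup>2 \<le> E \<Longrightarrow> Re (kappa_of E k) = 0"
  using csqrt_of_real_nonneg[of "of_real (E - (norm k)\<^sup>2)"]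
  by (simp add: kappa_of_def del: of_real_diff csqrt.simps)

lemma Re_kappa_of: "0 \<le> Re (kappa_of E k)"
  by (cases "E \<le> (norm k)\<^sup>2") (simp_all add: kappa_of_above kappa_of_below del: of_real_diff)

definition lat_term :: "real \<Rightarrow> real^2 \<Rightarrow> real \<Rightarrow> real^2 \<Rightarrow> real^2 \<Rightarrow> complex" where
  "lat_term E k r v K = exp (\<i> * csqrt (of_real (E - (norm (k + K))\<^sup>2)) * of_real r)
          / csqrt (of_real (E - (norm (k + K))\<^sup>2)) * exp (\<i> * of_real ((k + K) \<bullet> v))"

lemma i_lat_term:
  assumes "csqrt (of_real (E - (norm (k + K))\<^sup>2)) = \<i> * w"
  shows "\<i> * lat_term E k r v K = exp (- w * of_real r) / w * cis (K \<bullet> v) * cis (k \<bullet> v)"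
proof -
  have "exp (\<i> * of_real ((k + K) \<bullet> v)) = cis (K \<bullet> v) * cis (k \<bullet> v)"
    by (simp only: cis_conv_exp[symmetric] cis_mult inner_add_left add.commute)
  moreover have "\<i> * (\<i> * w) = - w"
    by (simp add: mult.assoc[symmetric])
  ultimately show ?thesis
    unfolding lat_term_def assms by simp
qed

lemma i_lat_term_0: "\<i> * lat_term E k r v (freq (0, 0)) = exp (- kappa_of E k * of_real r) / kappa_of E k * cis (k \<bullet> v)"
proof -
  have "csqrt (of_real (E - (norm (k + freq (0, 0)))\<^sup>2)) = \<i> * kappa_of E k"
    by (simp add: kappa_of_def freq_def mult.assoc[symmetric] del: of_real_diff csqrt.simps)
  from i_lat_term[OF this] show ?thesis by (simp add: freq_def)
qed

lemma i_lat_term_enum: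
  assumes "elliptic c (sigma_of E k)"
  shows "\<i> * lat_term E k r v (freq (lat_enum i)) = coef (sigma_of E k) i r * wave (lat_enum i) v * cis (k \<bullet> v)"
proof -
  let ?s = "(norm (k + freq (lat_enum i)))\<^sup>2 - E"
  have pos: "0 < ?s"
    using elliptic_Re_pos[OF assms, of i] by (simp add: sigma_of_def del: of_real_diff)
  have 1: "csqrt (of_real (E - (norm (k + freq (lat_enum i)))\<^sup>2)) = \<i> * of_real (sqrt ?s)"
    using csqrt_of_real_nonpos[of "of_real (E - (norm (k + freq (lat_enum i)))\<^sup>2)"] pos
    by (simp del: of_real_diff csqrt.simps)
  have 2: "csqrt (sigma_of E k (lat_enum i)) = of_real (sqrt ?s)"
    using csqrt_of_real_nonneg[of "of_real ?s"] pos by (simp add: sigma_of_def del: of_real_diff csqrt.simps)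
  show ?thesis
    unfolding i_lat_term[OF 1] coef_def 2 wave_def ..
qed

text \<open>Unconditional and absolute summability coincide for complex families, and the waves have
  modulus 1. Hence, for given \<open>E\<close> and \<open>k\<close>, it depends on \<open>r\<close>
  alone and not on \<open>v\<close> whether \<open>infsum\<close> is a genuine sum or its default
  0.\<close>

lemma infsum_lat_term:
  assumes e: "elliptic c (sigma_of E k)"
  shows "\<i> * (\<Sum>\<^sub>\<infinity>K\<in>dual_lattice a2 a3. lat_term E k r v K) =
    (if summable (\<lambda>i. cmod (coef (sigma_of E k) i r))
     then (exp (- kappa_of E k * of_real r) / kappa_of E k + (\<Sum>i. coef (sigma_of E k) i r * wave (lat_enum i) v)) * cis (k \<bullet> v)
     else 0)"
proof -
  let ?T = "\<lambda>\<nu>. \<i> * lat_term E k r v (freq \<nu>)"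
  let ?c = "\<lambda>i. coef (sigma_of E k) i r * wave (lat_enum i) v"
  have "\<i> * (\<Sum>\<^sub>\<infinity>K\<in>dual_lattice a2 a3. lat_term E k r v K) = infsum ?T UNIV"
    unfolding range_freq[symmetric] infsum_reindex[OF inj_freq] o_def by (rule infsum_cmult_right'[symmetric])
  also have "\<dots> = (if summable (\<lambda>i. cmod (coef (sigma_of E k) i r)) then ?T (0, 0) + (\<Sum>i. ?c i) * cis (k \<bullet> v) else 0)"
  proof (cases "summable (\<lambda>i. cmod (coef (sigma_of E k) i r))")
    case True
    then have sn: "summable (\<lambda>i. norm (?c i * cis (k \<bullet> v)))" by (simp add: norm_mult)
    have "summable ?c" by (rule summable_norm_cancel) (use True in \<open>simp add: norm_mult\<close>)
    then have "(\<lambda>i. ?c i * cis (k \<bullet> v)) sums ((\<Sum>i. ?c i) * cis (k \<bullet> v))"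
      by (intro sums_mult2 summable_sums)
    from norm_summable_imp_has_sum[OF sn this]
    have "((\<lambda>i. ?T (lat_enum i)) has_sum ((\<Sum>i. ?c i) * cis (k \<bullet> v))) UNIV"
      by (simp only: i_lat_term_enum[OF e])
    then have "(?T has_sum ((\<Sum>i. ?c i) * cis (k \<bullet> v))) (- {(0, 0)})"
      by (simp only: has_sum_reindex_bij_betw[OF bij_lat_enum, where f = ?T])
    then have "infsum ?T (insert (0, 0) (- {(0, 0)})) = ?T (0, 0) + (\<Sum>i. ?c i) * cis (k \<bullet> v)"
      by (subst infsum_insert) (auto simp: infsumI has_sum_imp_summable)
    moreover have "insert (0, 0) (- {(0, 0)}) = (UNIV :: (int \<times> int) set)" by auto
    ultimately show ?thesis using True by simp
  next
    case False
    have "\<not> ?T summable_on UNIV"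
    proof
      assume "?T summable_on UNIV"
      then have "(\<lambda>\<nu>. cmod (?T \<nu>)) summable_on UNIV"
        by (simp only: summable_on_iff_abs_summable_on_complex)
      then have "(\<lambda>\<nu>. cmod (?T \<nu>)) summable_on (- {(0, 0)})"
        by (rule summable_on_subset_banach) simp
      then have "(\<lambda>i. cmod (?T (lat_enum i))) summable_on UNIV"
        by (simp only: summable_on_reindex_bij_betw[OF bij_lat_enum, of "\<lambda>\<nu>. cmod (?T \<nu>)"])
      then have "summable (\<lambda>i. cmod (?T (lat_enum i)))"
        by (simp add: summable_on_UNIV_nonneg_real_iff)
      then show False using False by (simp only: i_lat_term_enum[OF e] norm_mult norm_wave norm_cis mult_1_right)
    qed
    then have "infsum ?T UNIV = 0" by (rule infsum_not_exists)
    then show ?thesis by (simp only: False if_False)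
  qed
  finally show ?thesis
    by (simp only: i_lat_term_0 distrib_right)
qed

end

context potential
begin

lemma AE_fst_ne: "AE y in M. fst y \<noteq> (c::real)"
proof -
  have N: "{c} \<times> UNIV \<in> sets (borel :: (real \<times> (real^2)) measure)"
    by (intro borel_Times) auto
  have "emeasure (lborel :: (real \<times> (real^2)) measure) ({c} \<times> UNIV) = emeasure (lborel \<Otimes>\<^sub>M lborel) ({c} \<times> (UNIV :: (real^2) set))"
    by (simp only: lborel_prod)
  also have "\<dots> = 0"
    by (subst lborel.emeasure_pair_measure_Times) auto
  finally have "AE y in lborel. y \<notin> {c} \<times> (UNIV :: (real^2) set)"
    by (intro AE_not_in) (use N in \<open>simp add: null_sets_def\<close>)
  then have "AE y in (lborel :: (real \<times> (real^2)) measure). fst y \<noteq> c"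
    by eventually_elim (auto simp: mem_Times_iff)
  then show ?thesis
    unfolding strip_measure_def by (subst AE_restrict_space_iff) auto
qed

lemma plane_measurable [measurable]: "plane k \<in> borel_measurable M"
  unfolding plane_def[abs_def] by measurable

definition full_kernel :: "real \<Rightarrow> real^2 \<Rightarrow> real \<times> (real^2) \<Rightarrow> real \<times> (real^2) \<Rightarrow> complex" where
  "full_kernel E k x y = (let r = \<bar>fst x - fst y\<bar> in
     of_real (beta a2 a3 * W x * W y) * (plane k x * cnj (plane k y)) *
     (exp (- kappa_of E k * of_real r) / kappa_of E k + (\<Sum>i. coef (sigma_of E k) i r * wave (lat_enum i) (snd x - snd y))))"

text \<open>
  On the null set \<open>fst x = fst y\<close> the lattice sum is absolutely convergent either for all \<open>y\<close> or for
  none, so that the kernel is Borel measurable whichever is the case.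
\<close>

lemma gamma_kernel_eq:
  assumes e: "elliptic c (sigma_of E k)"
  shows "gamma_kernel a2 a3 W k x y E =
    (if fst x \<noteq> fst y \<or> summable (\<lambda>i. cmod (coef (sigma_of E k) i 0)) then full_kernel E k x y else 0)"
proof -
  let ?r = "\<bar>fst x - fst y\<bar>"
  have s: "summable (\<lambda>i. cmod (coef (sigma_of E k) i ?r)) \<longleftrightarrow> fst x \<noteq> fst y \<or> summable (\<lambda>i. cmod (coef (sigma_of E k) i 0))"
    using summable_norm_terms[OF e, of ?r 0] by (cases "fst x = fst y") (simp_all add: norm_mult)
  have p: "plane k x * cnj (plane k y) = cis (k \<bullet> (snd x - snd y))"
    by (simp add: plane_def cis_cnj cis_mult inner_diff_right)
  have "gamma_kernel a2 a3 W k x y E = of_real (beta a2 a3 * W x * W y) *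
      (\<i> * (\<Sum>\<^sub>\<infinity>K\<in>dual_lattice a2 a3. lat_term E k ?r (snd x - snd y) K))"
    unfolding gamma_kernel_def lat_term_def of_real_mult by (simp only: mult_ac)
  then show ?thesis
    unfolding infsum_lat_term[OF e] s full_kernel_def p by (simp add: mult_ac Let_def)
qed

lemma full_kernel_split:
  assumes "fst x \<noteq> fst y"
  shows "of_real g * full_kernel E k x y =
    plane k x * reg_kernel (g * beta a2 a3) (kappa_of E k) (sigma_of E k) x y * cnj (plane k y) +
    of_real (g * beta a2 a3) / kappa_of E k * (plane k x * WC x) * (WC y * cnj (plane k y))"
  using assms
  by (simp add: full_kernel_def reg_kernel_def lat_kernel_def Let_def algebra_simps diff_divide_distrib)

lemma Gamma_op_eq:
  assumes e: "elliptic c (sigma_of E k)" and k: "(norm k)\<^sup>2 \<noteq> E"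
    and b: "\<bar>g * beta a2 a3\<bar> * amplitude c < 1"
    and f: "f \<in> L2_space M" and x: "x \<in> space M"
  shows "of_real g * Gamma_op a2 a3 W k E f x =
    kernel_op M (\<lambda>x y. plane k x * reg_kernel (g * beta a2 a3) (kappa_of E k) (sigma_of E k) x y * cnj (plane k y)) f x +
    of_real (g * beta a2 a3) / kappa_of E k * (plane k x * WC x) * (LINT y|M. WC y * cnj (plane k y) * f y)"
proof -
  let ?b = "g * beta a2 a3" and ?\<kappa> = "kappa_of E k" and ?\<sigma> = "sigma_of E k"
  let ?m = "\<lambda>x y. plane k x * reg_kernel ?b ?\<kappa> ?\<sigma> x y * cnj (plane k y)"
  interpret R: small_kernel M "reg_kernel ?b ?\<kappa> ?\<sigma>" "weight c ?b"
    by (rule small_reg_kernel(1)[OF e Re_kappa_of kappa_of_ne_0[OF k] b])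
  interpret K: small_kernel M ?m "weight c ?b"
    by (rule R.small_kernel_conjugate) simp_all
  have [measurable]: "f \<in> borel_measurable M" using f by (rule L2_space_measurable)
  have v: "(\<lambda>y. WC y * cnj (plane k y)) \<in> L2_space M"
    by (rule L2_spaceI) (use W_sq_integrable in \<open>simp_all add: norm_mult\<close>)
  have full: "(\<lambda>y. full_kernel E k x y) \<in> borel_measurable M"
    unfolding full_kernel_def Let_def coef_def by measurable
  have "of_real g * Gamma_op a2 a3 W k E f x = (LINT y|M. of_real g * gamma_kernel a2 a3 W k x y E * f y)"
    unfolding Gamma_op_def by (simp add: mult.assoc)
  \<comment> \<open>The integrands can differ only where \<open>fst x = fst y\<close>, a null set in
    \<open>y\<close>.\<close>
  also have "\<dots> = (LINT y|M. ?m x y * f y + of_real ?b / ?\<kappa> * (plane k x * WC x) * (WC y * cnj (plane k y) * f y))"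
  proof (rule integral_cong_AE)
    show "(\<lambda>y. of_real g * gamma_kernel a2 a3 W k x y E * f y) \<in> borel_measurable M"
      unfolding gamma_kernel_eq[OF e] using full by measurable
    have [measurable]: "?m x \<in> borel_measurable M"
      by (rule L2_space_measurable[OF K.kernel_L2(1)[OF x]])
    show "(\<lambda>y. ?m x y * f y + of_real ?b / ?\<kappa> * (plane k x * WC x) * (WC y * cnj (plane k y) * f y)) \<in> borel_measurable M"
      by measurable
    show "AE y in M. of_real g * gamma_kernel a2 a3 W k x y E * f y =
        ?m x y * f y + of_real ?b / ?\<kappa> * (plane k x * WC x) * (WC y * cnj (plane k y) * f y)"
      using AE_fst_ne[of "fst x"]
    proof eventually_elim
      case (elim y)
      then have ne: "fst x \<noteq> fst y" by simp
      then have "of_real g * gamma_kernel a2 a3 W k x y E = of_real g * full_kernel E k x y"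
        by (simp add: gamma_kernel_eq[OF e])
      then show ?case unfolding full_kernel_split[OF ne] by (simp only: distrib_right mult.assoc)
    qed
  qed
  also have "\<dots> = (LINT y|M. ?m x y * f y) + (LINT y|M. of_real ?b / ?\<kappa> * (plane k x * WC x) * (WC y * cnj (plane k y) * f y))"
    by (intro Bochner_Integration.integral_add K.T_integrable f x integrable_mult_right L2_integrable_mult v)
  finally show ?thesis
    by (simp only: kernel_op_def integral_mult_right_zero)
qed

lemma singular_iff:
  assumes e: "elliptic c (sigma_of E k)" and k: "k \<in> brillouin a2 a3" "(norm k)\<^sup>2 \<noteq> E"
    and b: "\<bar>g * beta a2 a3\<bar> * amplitude c < 1"
  shows "k \<in> singular_set a2 a3 W g E \<longleftrightarrow> Phi (g * beta a2 a3) (kappa_of E k) (sigma_of E k) = kappa_of E k"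
proof -
  let ?b = "g * beta a2 a3" and ?\<kappa> = "kappa_of E k" and ?\<sigma> = "sigma_of E k"
  let ?m = "\<lambda>x y. plane k x * reg_kernel ?b ?\<kappa> ?\<sigma> x y * cnj (plane k y)"
  let ?u = "\<lambda>x. plane k x * WC x" and ?v = "\<lambda>x. WC x * cnj (plane k x)"
  have \<kappa>: "?\<kappa> \<noteq> 0" by (rule kappa_of_ne_0[OF k(2)])
  interpret R: small_kernel M "reg_kernel ?b ?\<kappa> ?\<sigma>" "weight c ?b"
    by (rule small_reg_kernel(1)[OF e Re_kappa_of \<kappa> b])
  interpret K: small_kernel M ?m "weight c ?b"
    by (rule R.small_kernel_conjugate) simp_all
  have u: "?u \<in> L2_space M" and v: "?v \<in> L2_space M"
    by (rule L2_spaceI; use W_sq_integrable in \<open>simp add: norm_mult\<close>)+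
  have "boundedly_invertible_L2 M (\<lambda>f x. f x - of_real g * Gamma_op a2 a3 W k E f x) \<longleftrightarrow>
      of_real ?b / ?\<kappa> * (LINT x|M. ?v x * neumann M ?m ?u x) \<noteq> 1"
  proof (rule K.boundedly_invertible_rank_one_iff[OF u v])
    show "f x - of_real g * Gamma_op a2 a3 W k E f x =
        f x - kernel_op M ?m f x - of_real ?b / ?\<kappa> * ?u x * (LINT y|M. ?v y * f y)"
      if "f \<in> L2_space M" "x \<in> space M" for f x
      unfolding Gamma_op_eq[OF e k(2) b that] by (simp only: diff_diff_eq)
  qed
  \<comment> \<open>The plane waves of \<open>?v\<close> and of the conjugated series cancel
    pointwise; \<open>k\<close> remains only in \<open>kappa_of\<close> and
    \<open>sigma_of\<close>.\<close>
  also have "(LINT x|M. ?v x * neumann M ?m ?u x) = (LINT x|M. WC x * neumann M (reg_kernel ?b ?\<kappa> ?\<sigma>) WC x)"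
  proof (intro Bochner_Integration.integral_cong refl)
    fix x assume x: "x \<in> space M"
    have "neumann M ?m ?u x = plane k x * neumann M (reg_kernel ?b ?\<kappa> ?\<sigma>) WC x"
      by (rule neumann_conjugate[OF plane_cnj R.N_summable[OF WC_L2 x]])
    moreover have "w * cnj (plane k x) * (plane k x * n) = w * n" for w n
      using plane_cnj[of k x] by (metis (no_types, lifting) mult.assoc mult.commute mult.left_neutral)
    ultimately show "?v x * neumann M ?m ?u x = WC x * neumann M (reg_kernel ?b ?\<kappa> ?\<sigma>) WC x"
      by (simp only:)
  qed
  also have "of_real ?b / ?\<kappa> * (LINT x|M. WC x * neumann M (reg_kernel ?b ?\<kappa> ?\<sigma>) WC x) = Phi ?b ?\<kappa> ?\<sigma> / ?\<kappa>"
    by (simp add: Phi_def)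
  finally show ?thesis
    using k \<kappa> by (simp add: singular_set_def)
qed

end

section \<open>Complex perturbation of the symbol\<close>

text \<open>With \<open>s\<close> and \<open>e\<close> the two roots, |s - e| |s + e| is the square
  of the modulus of \<open>w\<close>, and |s - e| <= |s + e| because both have nonnegative real
  part. Dividing by |s + e| instead would lose uniformity as E tends to 0.\<close>

lemma csqrt_diff_le:
  assumes "0 \<le> E"
  shows "cmod (csqrt (of_real E + w\<^sup>2) - of_real (sqrt E)) \<le> cmod w"
proof -
  let ?s = "csqrt (of_real E + w\<^sup>2)" and ?e = "complex_of_real (sqrt E)"
  have le: "cmod (s - of_real e) \<le> cmod (s + of_real e)" if "0 \<le> Re s" "0 \<le> e" for s e
  proof -
    have "(Re s - e)\<^sup>2 \<le> (Re s + e)\<^sup>2"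
      using that by (simp add: power2_eq_square algebra_simps)
    then show ?thesis by (simp add: cmod_def)
  qed
  have "(?s - ?e) * (?s + ?e) = ?s\<^sup>2 - ?e\<^sup>2"
    by (simp add: power2_eq_square algebra_simps del: csqrt.simps)
  also have "\<dots> = w\<^sup>2"
    using assms by (simp del: csqrt.simps of_real_power flip: of_real_power)
  finally have eq: "cmod (?s - ?e) * cmod (?s + ?e) = (cmod w)\<^sup>2"
    by (simp only: norm_mult[symmetric] norm_power)
  have "cmod (?s - ?e) \<le> cmod (?s + ?e)"
    using assms by (intro le Re_csqrt) simp
  then have "cmod (?s - ?e) * cmod (?s - ?e) \<le> cmod (?s - ?e) * cmod (?s + ?e)"
    by (rule mult_left_mono) simp
  then have "(cmod (?s - ?e))\<^sup>2 \<le> (cmod w)\<^sup>2"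
    unfolding eq by (simp only: power2_eq_square)
  then show ?thesis by (rule power2_le_imp_le) simp
qed

lemma norm_add_sq: "(norm (x + y))\<^sup>2 = (norm x)\<^sup>2 + 2 * (x \<bullet> y) + (norm y)\<^sup>2" for x y :: "'a::real_inner"
  by (simp add: power2_norm_eq_inner inner_add_left inner_add_right inner_commute)

context rect_lattice
begin

definition bmin :: real where
  "bmin = min ((norm (dual_vec a2))\<^sup>2) ((norm (dual_vec a3))\<^sup>2)"

definition bsum :: real where
  "bsum = norm (dual_vec a2) + norm (dual_vec a3)"

text \<open>Half the distance from \<open>E_bound\<close> to \<open>bmin / 4\<close>, the squared
  inradius of the Brillouin zone.\<close>

definition gap :: "real \<Rightarrow> real" where
  "gap \<delta> = bmin / 8 * (\<delta> / (1 + \<delta>))"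

lemma bmin_pos: "0 < bmin"
  using dual.u_nz dual.v_nz by (simp add: bmin_def)

lemma bsum_nonneg: "0 \<le> bsum"
  by (simp add: bsum_def)

lemma gap_pos: "0 < \<delta> \<Longrightarrow> 0 < gap \<delta>"
  using bmin_pos by (simp add: gap_def)

lemma E_bound_eq: "0 < \<delta> \<Longrightarrow> E_bound a2 a3 \<delta> = bmin / 4 - 2 * gap \<delta>"
  by (simp add: E_bound_def bmin_def[symmetric] gap_def field_simps)

lemma in_brillouin:
  assumes "(norm k)\<^sup>2 < bmin / 4"
  shows "k \<in> brillouin a2 a3"
proof -
  have "(norm k)\<^sup>2 < (norm (dual_vec a2) / 2)\<^sup>2" "(norm k)\<^sup>2 < (norm (dual_vec a3) / 2)\<^sup>2"
    using assms by (auto simp: bmin_def power_divide)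
  then have "norm k < norm (dual_vec a2) / 2" "norm k < norm (dual_vec a3) / 2"
    using power2_less_imp_less[of "norm k" "norm (dual_vec a2) / 2"]
      power2_less_imp_less[of "norm k" "norm (dual_vec a3) / 2"] by simp_all
  then show ?thesis unfolding brillouin_def by (rule dual.in_cell_if_small)
qed

text \<open>Since \<open>sqlen \<nu> \<ge> 1\<close>, the energy is absorbed into the multiple
  \<open>bmin / 4 - 2 * gap \<delta>\<close> of \<open>sqlen \<nu>\<close>; the remaining bound is
  uniform in \<open>k\<close> and E. The extra factor 2 is kept as a margin for the complex
  perturbation.\<close>

lemma sigma_of_ge:
  assumes \<delta>: "0 < \<delta>" and E: "E < E_bound a2 a3 \<delta>" and k: "k \<in> brillouin a2 a3" and \<nu>: "\<nu> \<noteq> (0, 0)"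
  shows "2 * gap \<delta> * sqlen \<nu> \<le> (norm (k + freq \<nu>))\<^sup>2 - E"
proof -
  have 1: "bmin / 4 * sqlen \<nu> \<le> (norm (k + freq \<nu>))\<^sup>2"
    using dual.norm_cell_shift[of k bmin "fst \<nu>" "snd \<nu>"] k bmin_pos
    by (simp add: brillouin_def freq_def bmin_def)
  have g: "0 < bmin / 4 - 2 * gap \<delta>"
    using \<delta> bmin_pos by (simp add: gap_def field_simps)
  have "E \<le> (bmin / 4 - 2 * gap \<delta>) * 1" using E by (simp add: E_bound_eq[OF \<delta>])
  also have "\<dots> \<le> (bmin / 4 - 2 * gap \<delta>) * sqlen \<nu>"
    using g sqlen_ge_1[OF \<nu>] by (intro mult_left_mono) auto
  finally show ?thesis using 1 by (simp add: algebra_simps)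
qed

lemma elliptic_sigma_of:
  assumes "0 < \<delta>" "E < E_bound a2 a3 \<delta>" "k \<in> brillouin a2 a3"
  shows "elliptic (gap \<delta>) (sigma_of E k)"
  unfolding elliptic_def
proof (intro conjI allI impI gap_pos assms)
  fix \<nu> :: "int \<times> int" assume \<nu>: "\<nu> \<noteq> (0, 0)"
  have "0 \<le> gap \<delta> * sqlen \<nu>" using gap_pos[OF assms(1)] by simp
  then show "gap \<delta> * sqlen \<nu> \<le> Re (sigma_of E k \<nu>)"
    using sigma_of_ge[OF assms \<nu>] by (simp add: sigma_of_def del: of_real_diff)
qed

text \<open>For integers the modulus is at most the square, so a perturbation of the symbol linear
  in the frequency is absorbed by \<open>sqlen\<close>.\<close>

lemma norm_freq_le:
  assumes "\<nu> \<noteq> (0, 0)"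
  shows "norm (freq \<nu>) \<le> bsum * sqlen \<nu>"
proof -
  have sq: "\<bar>real_of_int i\<bar> \<le> (real_of_int i)\<^sup>2" for i
  proof (cases "i = 0")
    case False
    then have "1 \<le> \<bar>real_of_int i\<bar>" by linarith
    then have "\<bar>real_of_int i\<bar> * 1 \<le> \<bar>real_of_int i\<bar> * \<bar>real_of_int i\<bar>" by (intro mult_left_mono) auto
    then show ?thesis by (simp add: power2_eq_square)
  qed simp
  have 1: "\<bar>real_of_int (fst \<nu>)\<bar> \<le> sqlen \<nu>" "\<bar>real_of_int (snd \<nu>)\<bar> \<le> sqlen \<nu>"
    using sq[of "fst \<nu>"] sq[of "snd \<nu>"] by (auto simp: sqlen_def intro: order_trans)
  have "norm (freq \<nu>) \<le> \<bar>real_of_int (fst \<nu>)\<bar> * norm (dual_vec a2) + \<bar>real_of_int (snd \<nu>)\<bar> * norm (dual_vec a3)"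
    unfolding freq_def by (rule order_trans[OF norm_triangle_ineq]) simp
  also have "\<dots> \<le> sqlen \<nu> * norm (dual_vec a2) + sqlen \<nu> * norm (dual_vec a3)"
    using 1 by (intro add_mono mult_right_mono) auto
  finally show ?thesis by (simp add: bsum_def algebra_simps)
qed

text \<open>
  The symbol \<open>|k + K|\<^sup>2 - E\<close> at \<open>k = (E + \<kappa>\<^sup>2)\<^sup>1\<^sup>/\<^sup>2 (cos \<theta>, sin \<theta>)\<close>, continued to complex \<open>\<kappa>\<close> and \<open>\<theta>\<close>.
\<close>

definition symbol :: "real \<Rightarrow> complex \<Rightarrow> complex \<Rightarrow> int \<times> int \<Rightarrow> complex" where
  "symbol E \<kappa> \<theta> \<nu> = \<kappa>\<^sup>2 + 2 * csqrt (of_real E + \<kappa>\<^sup>2) * (cos \<theta> * of_real (freq \<nu> $ 1) + sin \<theta> * of_real (freq \<nu> $ 2))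
     + of_real ((norm (freq \<nu>))\<^sup>2)"

lemma symbol_real:
  assumes "0 < \<kappa>" "0 < E"
  shows "symbol E (of_real \<kappa>) (of_real \<tau>) = sigma_of E (sqrt (E + \<kappa>\<^sup>2) *\<^sub>R dir \<tau>)"
    and "kappa_of E (sqrt (E + \<kappa>\<^sup>2) *\<^sub>R dir \<tau>) = of_real \<kappa>"
    and "(norm (sqrt (E + \<kappa>\<^sup>2) *\<^sub>R dir \<tau>))\<^sup>2 = E + \<kappa>\<^sup>2"
proof -
  let ?R = "sqrt (E + \<kappa>\<^sup>2)"
  have R: "0 < E + \<kappa>\<^sup>2" "?R\<^sup>2 = E + \<kappa>\<^sup>2" using assms by (auto intro: add_pos_nonneg)
  show n: "(norm (?R *\<^sub>R dir \<tau>))\<^sup>2 = E + \<kappa>\<^sup>2"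
    using R by (simp add: power_mult_distrib)
  show "kappa_of E (?R *\<^sub>R dir \<tau>) = of_real \<kappa>"
    using assms by (subst kappa_of_above) (simp_all add: n)
  have cs: "csqrt (of_real E + (of_real \<kappa>)\<^sup>2) = of_real ?R"
    using R csqrt_of_real_nonneg[of "of_real (E + \<kappa>\<^sup>2)"] by simp
  show "symbol E (of_real \<kappa>) (of_real \<tau>) = sigma_of E (?R *\<^sub>R dir \<tau>)"
  proof
    fix \<nu>
    have "(norm (?R *\<^sub>R dir \<tau> + freq \<nu>))\<^sup>2 = (norm (?R *\<^sub>R dir \<tau>))\<^sup>2 + 2 * ((?R *\<^sub>R dir \<tau>) \<bullet> freq \<nu>) + (norm (freq \<nu>))\<^sup>2"
      by (rule norm_add_sq)
    moreover have "(?R *\<^sub>R dir \<tau>) \<bullet> freq \<nu> = ?R * (cos \<tau> * freq \<nu> $ 1 + sin \<tau> * freq \<nu> $ 2)"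
      by (simp add: inner_vec_def sum_2 algebra_simps)
    ultimately have "(norm (?R *\<^sub>R dir \<tau> + freq \<nu>))\<^sup>2 - E =
        \<kappa>\<^sup>2 + 2 * ?R * (cos \<tau> * freq \<nu> $ 1 + sin \<tau> * freq \<nu> $ 2) + (norm (freq \<nu>))\<^sup>2"
      by (simp only: n)
    then show "symbol E (of_real \<kappa>) (of_real \<tau>) \<nu> = sigma_of E (?R *\<^sub>R dir \<tau>) \<nu>"
      unfolding symbol_def sigma_of_def cs by (simp add: cos_of_real sin_of_real)
  qed
qed

text \<open>At \<open>\<kappa> = 0\<close>, \<open>\<theta> = t0\<close> the symbol is at least
  \<open>2 * gap \<delta> * sqlen \<nu>\<close>, and the perturbation may use up half of that. The
  square of \<open>\<kappa>\<close> contributes at most \<open>h\<close>; the mixed term has a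
  factor 2, two components and an error of \<open>3 * h\<close> in each, whence 12.\<close>

lemma symbol_elliptic:
  assumes \<delta>: "0 < \<delta>" and E: "0 < E" "E < E_bound a2 a3 \<delta>"
    and h: "0 < h" "h \<le> 1" "h * (1 + 12 * bsum) \<le> gap \<delta>"
  obtains r where "0 < r"
    "\<And>z \<kappa>. \<lbrakk>z \<in> ball (complex_of_real t0) r; cmod \<kappa> \<le> h\<rbrakk> \<Longrightarrow> elliptic (gap \<delta>) (symbol E \<kappa> z)"
proof -
  \<comment> \<open>\<open>\<epsilon> \<le> 1\<close> bounds the perturbed cosine and sine by 2, and
    \<open>sqrt E * \<epsilon> \<le> h\<close> bounds their own error; with the error
    \<open>h\<close> of the root this makes \<open>2 * h + h\<close> in \<open>near\<close>.\<close>
  define \<epsilon> where "\<epsilon> = min 1 (h / sqrt E)"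
  have \<epsilon>: "0 < \<epsilon>" "\<epsilon> \<le> 1" "sqrt E * \<epsilon> \<le> h"
  proof -
    show "0 < \<epsilon>" "\<epsilon> \<le> 1" using h E by (auto simp: \<epsilon>_def)
    have "sqrt E * \<epsilon> \<le> sqrt E * (h / sqrt E)" using E by (intro mult_left_mono) (auto simp: \<epsilon>_def)
    then show "sqrt E * \<epsilon> \<le> h" using E by simp
  qed
  have "continuous (at (complex_of_real t0)) cos" "continuous (at (complex_of_real t0)) sin"
    by (intro continuous_intros continuous_ident)+
  then obtain r1 r2 where r: "0 < r1" "0 < r2"
      "\<And>z. dist z (complex_of_real t0) < r1 \<Longrightarrow> dist (cos z) (cos (of_real t0)) < \<epsilon>"
      "\<And>z. dist z (complex_of_real t0) < r2 \<Longrightarrow> dist (sin z) (sin (of_real t0)) < \<epsilon>"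
    using \<epsilon>(1) unfolding continuous_at_eps_delta by metis
  show thesis
  proof (rule that[of "min r1 r2"])
    show "0 < min r1 r2" using r by simp
    fix z \<kappa> assume z: "z \<in> ball (complex_of_real t0) (min r1 r2)" and \<kappa>: "cmod \<kappa> \<le> h"
    let ?s = "csqrt (of_real E + \<kappa>\<^sup>2)" and ?e = "complex_of_real (sqrt E)"
    have s: "cmod (?s - ?e) \<le> h"
      using csqrt_diff_le[of E \<kappa>] \<kappa> E by simp
    have near: "cmod (?s * f - ?e * f0) \<le> 3 * h" if "dist f f0 < \<epsilon>" "cmod f0 \<le> 1" for f f0 :: complex
    proof -
      have d: "cmod (f - f0) \<le> \<epsilon>" using that by (simp add: dist_norm)
      have f: "cmod f \<le> 2" using norm_triangle_sub[of f f0] d that \<epsilon> by linarith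
      have "?s * f - ?e * f0 = (?s - ?e) * f + ?e * (f - f0)" by (simp add: algebra_simps)
      then have "cmod (?s * f - ?e * f0) \<le> cmod (?s - ?e) * cmod f + sqrt E * cmod (f - f0)"
        using norm_triangle_ineq[of "(?s - ?e) * f" "?e * (f - f0)"] E by (simp only: norm_mult norm_of_real) simp
      also have "\<dots> \<le> h * 2 + sqrt E * \<epsilon>"
        using s f d h E by (intro add_mono mult_mono) auto
      finally show ?thesis using \<epsilon> by simp
    qed
    have c: "cmod (?s * cos z - ?e * cos (of_real t0)) \<le> 3 * h"
      using z by (intro near r) (simp_all add: dist_commute cos_of_real)
    have sn: "cmod (?s * sin z - ?e * sin (of_real t0)) \<le> 3 * h"
      using z by (intro near r) (simp_all add: dist_commute sin_of_real)
    let ?k = "sqrt E *\<^sub>R dir t0"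
    have kB: "?k \<in> brillouin a2 a3"
    proof (rule in_brillouin)
      have "(norm ?k)\<^sup>2 = E" using E by (simp add: power_mult_distrib)
      then show "(norm ?k)\<^sup>2 < bmin / 4"
        using E(2) gap_pos[OF \<delta>] by (simp add: E_bound_eq[OF \<delta>])
    qed
    show "elliptic (gap \<delta>) (symbol E \<kappa> z)"
      unfolding elliptic_def
    proof (intro conjI allI impI gap_pos \<delta>)
      fix \<nu> :: "int \<times> int" assume \<nu>: "\<nu> \<noteq> (0, 0)"
      let ?K1 = "freq \<nu> $ 1" and ?K2 = "freq \<nu> $ 2"
      have K: "\<bar>?K1\<bar> \<le> bsum * sqlen \<nu>" "\<bar>?K2\<bar> \<le> bsum * sqlen \<nu>"
        using norm_freq_le[OF \<nu>] component_le_norm_cart[of "freq \<nu>" 1] component_le_norm_cart[of "freq \<nu>" 2] by linarith+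
      define base where "base = 2 * sqrt E * (cos t0 * ?K1 + sin t0 * ?K2) + (norm (freq \<nu>))\<^sup>2"
      have "base = (norm (?k + freq \<nu>))\<^sup>2 - E"
      proof -
        have "(norm (?k + freq \<nu>))\<^sup>2 = (norm ?k)\<^sup>2 + 2 * (?k \<bullet> freq \<nu>) + (norm (freq \<nu>))\<^sup>2"
          by (rule norm_add_sq)
        moreover have "?k \<bullet> freq \<nu> = sqrt E * (cos t0 * ?K1 + sin t0 * ?K2)"
          by (simp add: inner_vec_def sum_2 algebra_simps)
        moreover have "(norm ?k)\<^sup>2 = E" using E by (simp add: power_mult_distrib)
        ultimately show ?thesis by (simp only: base_def)
      qed
      then have base: "2 * gap \<delta> * sqlen \<nu> \<le> base"
        using sigma_of_ge[OF \<delta> E(2) kB \<nu>] by simp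
      define D where "D = \<kappa>\<^sup>2 + 2 * ((?s * cos z - ?e * cos (of_real t0)) * of_real ?K1 + (?s * sin z - ?e * sin (of_real t0)) * of_real ?K2)"
      have sym: "symbol E \<kappa> z \<nu> = D + of_real base"
        by (simp add: symbol_def D_def base_def cos_of_real sin_of_real algebra_simps del: csqrt.simps)
      have "cmod D \<le> cmod (\<kappa>\<^sup>2) + cmod (2 * ((?s * cos z - ?e * cos (of_real t0)) * of_real ?K1 + (?s * sin z - ?e * sin (of_real t0)) * of_real ?K2))"
        unfolding D_def by (rule norm_triangle_ineq)
      also have "\<dots> \<le> h * 1 + 2 * (3 * h * (bsum * sqlen \<nu>) + 3 * h * (bsum * sqlen \<nu>))"
      proof (rule add_mono)
        have "cmod \<kappa> * cmod \<kappa> \<le> h * 1" using \<kappa> h by (intro mult_mono) auto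
        then show "cmod (\<kappa>\<^sup>2) \<le> h * 1" by (simp add: power2_eq_square norm_mult)
        have "cmod ((?s * cos z - ?e * cos (of_real t0)) * of_real ?K1 + (?s * sin z - ?e * sin (of_real t0)) * of_real ?K2)
          \<le> cmod (?s * cos z - ?e * cos (of_real t0)) * \<bar>?K1\<bar> + cmod (?s * sin z - ?e * sin (of_real t0)) * \<bar>?K2\<bar>"
          by (rule order_trans[OF norm_triangle_ineq]) (simp only: norm_mult norm_of_real order_refl)
        also have "\<dots> \<le> 3 * h * (bsum * sqlen \<nu>) + 3 * h * (bsum * sqlen \<nu>)"
          using c sn K h by (intro add_mono mult_mono) auto
        finally show "cmod (2 * ((?s * cos z - ?e * cos (of_real t0)) * of_real ?K1 + (?s * sin z - ?e * sin (of_real t0)) * of_real ?K2))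
          \<le> 2 * (3 * h * (bsum * sqlen \<nu>) + 3 * h * (bsum * sqlen \<nu>))"
          by (simp only: norm_mult norm_numeral mult_le_cancel_left_pos zero_less_numeral)
      qed
      also have "\<dots> \<le> h * sqlen \<nu> + 2 * (3 * h * (bsum * sqlen \<nu>) + 3 * h * (bsum * sqlen \<nu>))"
        using h sqlen_ge_1[OF \<nu>] by simp
      also have "\<dots> = h * (1 + 12 * bsum) * sqlen \<nu>" by (simp add: algebra_simps)
      also have "\<dots> \<le> gap \<delta> * sqlen \<nu>" by (intro mult_right_mono h) simp
      finally have "cmod D \<le> gap \<delta> * sqlen \<nu>" .
      then have "- (gap \<delta> * sqlen \<nu>) \<le> Re D" using abs_Re_le_cmod[of D] by linarith
      then show "gap \<delta> * sqlen \<nu> \<le> Re (symbol E \<kappa> z \<nu>)"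
        unfolding sym using base by simp
    qed
  qed
qed

lemma symbol_holomorphic:
  assumes "\<kappa> holomorphic_on D" "\<theta> holomorphic_on D" and "\<And>z. z \<in> D \<Longrightarrow> 0 < Re (of_real E + (\<kappa> z)\<^sup>2)"
  shows "(\<lambda>z. symbol E (\<kappa> z) (\<theta> z) \<nu>) holomorphic_on D"
proof -
  have "(\<lambda>z. csqrt (of_real E + (\<kappa> z)\<^sup>2)) holomorphic_on D"
    by (intro holomorphic_on_csqrt_Re_pos holomorphic_on_add holomorphic_on_const holomorphic_on_power assms)
  then show ?thesis
    unfolding symbol_def
    by (intro holomorphic_on_add holomorphic_on_mult holomorphic_on_const holomorphic_on_power
        holomorphic_on_cos' holomorphic_on_sin' assms)
qed

end

section \<open>The curve of singular points\<close>

text \<open>\<open>R - e\<close> is the square of \<open>\<mu>\<close> divided by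
  \<open>R + e\<close>, and \<open>R + e\<close> lies between \<open>2 * e\<close> and
  \<open>2 * e + 1\<close>. The squares of the end points \<open>r / 2\<close> and
  \<open>3/2 * r\<close> give the factors 1/4 and 9/8.\<close>

lemma annulus_arith:
  fixes R e \<mu> r :: real
  assumes "0 < e" "e \<le> R" "R \<le> e + 1" and sq: "(R - e) * (R + e) = \<mu>\<^sup>2" and r: "0 < r" "r / 2 < \<mu>" "\<mu> < 3/2 * r"
  shows "R - e \<in> {r\<^sup>2 / (4 * (2 * e + 1)) <..< 9/8 * r\<^sup>2 / e}"
proof -
  have "(r / 2)\<^sup>2 < \<mu>\<^sup>2" using r by (intro power_strict_mono) auto
  also have "\<dots> \<le> (R - e) * (2 * e + 1)"
    unfolding sq[symmetric] using assms by (intro mult_left_mono) auto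
  finally have "r\<^sup>2 < (R - e) * (4 * (2 * e + 1))" by (simp add: power_divide algebra_simps)
  then have lower: "r\<^sup>2 / (4 * (2 * e + 1)) < R - e"
    using assms by (subst pos_divide_less_eq) auto
  have "(R - e) * (2 * e) \<le> \<mu>\<^sup>2"
    unfolding sq[symmetric] using assms by (intro mult_left_mono) auto
  also have "\<dots> < (3/2 * r)\<^sup>2" using r by (intro power_strict_mono) auto
  finally have "(R - e) * e < 9/8 * r\<^sup>2" by (simp add: power_mult_distrib power_divide)
  then have "R - e < 9/8 * r\<^sup>2 / e"
    using assms by (subst pos_less_divide_eq) auto
  with lower show ?thesis by simp
qed

text \<open>\<open>small_norm\<close> controls the Neumann series. The two parts of
  \<open>small_root\<close> are the hypotheses on \<open>h\<close> in \<open>symbol_elliptic\<close>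
  for \<open>h = 3/2 * root0\<close>, a bound for the modulus of \<open>\<kappa>\<close> on
  \<open>disc\<close>.\<close>

locale small_coupling = potential +
  fixes \<delta> E g :: real
  assumes \<delta>: "0 < \<delta>" and E: "0 < E" "E < E_bound a2 a3 \<delta>" and g: "0 < g"
    and small_norm: "g * beta a2 a3 * amplitude (gap \<delta>) \<le> 1/9"
    and small_root: "3/2 * (g * beta a2 a3 * Q) \<le> 1"
      "3/2 * (g * beta a2 a3 * Q) * (1 + 12 * bsum) \<le> gap \<delta>"
begin

definition b :: real where "b = g * beta a2 a3"

definition root0 :: real where "root0 = b * Q"

lemma b_pos: "0 < b"
  using g dual.measure_cell_pos by (simp add: b_def beta_def brillouin_def)

lemma root0_pos: "0 < root0"
  using b_pos Q_pos by (simp add: root0_def)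

lemma amplitude_small: "b * amplitude (gap \<delta>) \<le> 1/9" "\<bar>b\<bar> * amplitude (gap \<delta>) < 1"
  using small_norm b_pos by (simp_all add: b_def)

lemma root_le: "3/2 * root0 \<le> 1" "3/2 * root0 * (1 + 12 * bsum) \<le> gap \<delta>"
  using small_root by (simp_all add: root0_def b_def)

text \<open>Its radius, half the centre, forces \<open>|Im \<kappa>| < Re \<kappa>\<close>: the disc
  stays in the open right half plane and \<open>E + \<kappa>\<^sup>2\<close> off the cut of the
  root.\<close>

abbreviation disc where "disc \<equiv> ball (complex_of_real root0) (root0 / 2)"

lemma disc:
  assumes "\<kappa> \<in> disc"
  shows "0 < Re \<kappa>" "\<kappa> \<noteq> 0" "cmod \<kappa> \<le> 3/2 * root0" "0 < Re (of_real E + \<kappa>\<^sup>2)"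
proof -
  have d: "cmod (\<kappa> - of_real root0) < root0 / 2"
    using assms by (simp add: dist_norm norm_minus_commute)
  have 1: "root0 / 2 < Re \<kappa>" "\<bar>Im \<kappa>\<bar> < root0 / 2"
    using abs_Re_le_cmod[of "\<kappa> - of_real root0"] abs_Im_le_cmod[of "\<kappa> - of_real root0"] d by auto
  show r: "0 < Re \<kappa>" using 1 root0_pos by simp
  then show "\<kappa> \<noteq> 0" by auto
  show "cmod \<kappa> \<le> 3/2 * root0"
    using norm_triangle_sub[of \<kappa> "of_real root0"] d root0_pos by simp
  have "\<bar>Im \<kappa>\<bar>\<^sup>2 \<le> (Re \<kappa>)\<^sup>2"
    using 1 by (intro power_mono) auto
  then show "0 < Re (of_real E + \<kappa>\<^sup>2)"
    using E by (simp add: Re_power2)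
qed

definition \<Phi> :: "complex \<Rightarrow> complex \<Rightarrow> complex" where
  "\<Phi> \<kappa> z = Phi b \<kappa> (symbol E \<kappa> z)"

text \<open>The neighbourhood of \<open>t0\<close> is not uniform in the angle or in E. Only the
  disc in \<open>\<kappa>\<close> is fixed, and uniqueness inside it is what later joins the local
  solutions.\<close>

lemma local_root:
  obtains r K where "0 < r" "K holomorphic_on ball (of_real t0) r"
    "\<forall>z\<in>ball (of_real t0) r. K z \<in> disc"
    "\<forall>z\<in>ball (of_real t0) r. \<forall>\<kappa>\<in>disc. \<Phi> \<kappa> z = \<kappa> \<longleftrightarrow> \<kappa> = K z"
    "\<forall>\<theta>. \<bar>\<theta> - t0\<bar> < r \<longrightarrow> K (of_real \<theta>) \<in> \<real>"
proof -
  let ?c = "gap \<delta>"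
  obtain r where r: "0 < r"
    and ell: "\<And>z \<kappa>. \<lbrakk>z \<in> ball (of_real t0) r; cmod \<kappa> \<le> 3/2 * root0\<rbrakk> \<Longrightarrow> elliptic ?c (symbol E \<kappa> z)"
    using symbol_elliptic[OF \<delta> E _ root_le, where ?t0.0 = t0] root0_pos by (metis mult_pos_pos zero_less_divide_iff zero_less_numeral)
  let ?D = "ball (complex_of_real t0) r"
  have ell': "elliptic ?c (symbol E \<kappa> z)" if "z \<in> ?D" "\<kappa> \<in> disc" for z \<kappa>
    by (rule ell[OF that(1) disc(3)[OF that(2)]])
  have bound: "cmod (\<Phi> \<kappa> z - of_real root0) \<le> root0 / 2 / 4" if "z \<in> ?D" "\<kappa> \<in> disc" for z \<kappa>
    using Phi_bound[OF ell'[OF that] less_imp_le[OF disc(1)[OF that(2)]] disc(2)[OF that(2)] less_imp_le[OF b_pos] amplitude_small(1)]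
    by (simp add: \<Phi>_def root0_def)
  have hol: "(\<lambda>z. \<Phi> (\<kappa> z) (\<theta> z)) holomorphic_on D"
    if "open D" "\<kappa> holomorphic_on D" "\<theta> holomorphic_on D" "\<And>z. z \<in> D \<Longrightarrow> \<kappa> z \<in> disc" "\<And>z. z \<in> D \<Longrightarrow> \<theta> z \<in> ?D" for \<kappa> \<theta> D
    unfolding \<Phi>_def
  proof (rule Phi_holomorphic[OF that(1) _ _ that(2) _ _ amplitude_small(2)])
    show "elliptic ?c (symbol E (\<kappa> z) (\<theta> z))" if "z \<in> D" for z
      by (rule ell') (use that \<open>\<And>z. z \<in> D \<Longrightarrow> \<kappa> z \<in> disc\<close> \<open>\<And>z. z \<in> D \<Longrightarrow> \<theta> z \<in> ?D\<close> in auto)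
    show "(\<lambda>z. symbol E (\<kappa> z) (\<theta> z) \<nu>) holomorphic_on D" for \<nu>
      by (rule symbol_holomorphic[OF that(2,3) disc(4)[OF that(4)]])
  qed (use disc(1,2)[OF that(4)] in \<open>auto simp: less_imp_le\<close>)
  obtain K where K: "K holomorphic_on ?D" "\<And>z. z \<in> ?D \<Longrightarrow> K z \<in> disc"
    "\<And>z \<kappa>. \<lbrakk>z \<in> ?D; \<kappa> \<in> disc\<rbrakk> \<Longrightarrow> \<Phi> \<kappa> z = \<kappa> \<longleftrightarrow> \<kappa> = K z"
    "\<And>z. \<lbrakk>z \<in> ?D; complex_of_real root0 \<in> \<real>; \<And>\<kappa>. \<lbrakk>\<kappa> \<in> \<real>; \<kappa> \<in> disc\<rbrakk> \<Longrightarrow> \<Phi> \<kappa> z \<in> \<real>\<rbrakk> \<Longrightarrow> K z \<in> \<real>"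
  proof (rule holomorphic_fixed_point[where \<Phi> = \<Phi> and D = ?D and ?\<kappa>0.0 = "complex_of_real root0" and \<rho> = "root0 / 2"])
    show "(\<lambda>z. \<Phi> (\<kappa> z) z) holomorphic_on ?D"
      if "\<kappa> holomorphic_on ?D" "\<And>z. z \<in> ?D \<Longrightarrow> \<kappa> z \<in> disc" for \<kappa>
      by (rule hol[OF open_ball that(1) holomorphic_on_ident that(2)])
    show "(\<lambda>\<kappa>. \<Phi> \<kappa> z) holomorphic_on disc" if "z \<in> ?D" for z
      by (rule hol[OF open_ball holomorphic_on_ident holomorphic_on_const]) (use that in auto)
  qed (use root0_pos bound in auto)
  have real: "K (of_real \<theta>) \<in> \<real>" if "\<bar>\<theta> - t0\<bar> < r" for \<theta>
  proof -
    have z: "of_real \<theta> \<in> ?D" using that by (simp add: dist_real_def abs_minus_commute[of t0])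
    show "K (of_real \<theta>) \<in> \<real>"
    proof (rule K(4)[OF z])
      fix \<kappa> assume \<kappa>: "\<kappa> \<in> \<real>" "\<kappa> \<in> disc"
      then obtain \<mu> where \<mu>: "\<kappa> = of_real \<mu>" by (auto elim: Reals_cases)
      have "0 < \<mu>" using disc(1)[OF \<kappa>(2)] by (simp add: \<mu>)
      then have "symbol E \<kappa> (of_real \<theta>) \<nu> \<in> \<real>" for \<nu>
        by (simp add: \<mu> symbol_real(1) E sigma_of_def)
      then show "\<Phi> \<kappa> (of_real \<theta>) \<in> \<real>"
        unfolding \<Phi>_def by (intro Phi_real[OF ell'[OF z \<kappa>(2)] disc(1)[OF \<kappa>(2)] \<kappa>(1) _ amplitude_small(2)])
    qed simp
  qed
  show thesis
    by (rule that[OF r K(1)]) (use K(2,3) real in blast)+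
qed

lemma ex1_root: "\<exists>!\<mu>. of_real \<mu> \<in> disc \<and> \<Phi> (of_real \<mu>) (of_real \<theta>) = of_real \<mu>"
proof -
  obtain r K where K: "0 < r" "K holomorphic_on ball (of_real \<theta>) r" "\<forall>z\<in>ball (of_real \<theta>) r. K z \<in> disc"
    "\<forall>z\<in>ball (of_real \<theta>) r. \<forall>\<kappa>\<in>disc. \<Phi> \<kappa> z = \<kappa> \<longleftrightarrow> \<kappa> = K z"
    "\<forall>\<theta>'. \<bar>\<theta>' - \<theta>\<bar> < r \<longrightarrow> K (of_real \<theta>') \<in> \<real>"
    by (rule local_root[of \<theta>])
  have z: "of_real \<theta> \<in> ball (complex_of_real \<theta>) r" using K(1) by simp
  obtain \<mu> where \<mu>: "K (of_real \<theta>) = of_real \<mu>" using K(5)[rule_format, of \<theta>] K(1) by (auto elim: Reals_cases)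
  show ?thesis
  proof (rule ex1I[of _ \<mu>])
    show "of_real \<mu> \<in> disc \<and> \<Phi> (of_real \<mu>) (of_real \<theta>) = of_real \<mu>"
      using bspec[OF K(3) z] bspec[OF bspec[OF K(4) z], of "of_real \<mu>"] by (simp only: \<mu> simp_thms)
    show "\<mu>' = \<mu>" if "of_real \<mu>' \<in> disc \<and> \<Phi> (of_real \<mu>') (of_real \<theta>) = of_real \<mu>'" for \<mu>'
      using bspec[OF bspec[OF K(4) z], of "of_real \<mu>'"] that by (simp only: \<mu> of_real_eq_iff simp_thms)
  qed
qed

text \<open>On the real axis each local holomorphic solution coincides with this function, by
  uniqueness in \<open>disc\<close>; analyticity at every angle is inherited from them.\<close>

definition root :: "real \<Rightarrow> real" where
  "root \<theta> = (THE \<mu>. of_real \<mu> \<in> disc \<and> \<Phi> (of_real \<mu>) (of_real \<theta>) = of_real \<mu>)"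

lemma root: "of_real (root \<theta>) \<in> disc" "\<Phi> (of_real (root \<theta>)) (of_real \<theta>) = of_real (root \<theta>)"
  using theI'[OF ex1_root[of \<theta>]] by (simp_all only: root_def simp_thms)

lemma root_unique:
  "of_real \<mu> \<in> disc \<Longrightarrow> \<Phi> (of_real \<mu>) (of_real \<theta>) = of_real \<mu> \<Longrightarrow> \<mu> = root \<theta>"
  using ex1_root[of \<theta>] root[of \<theta>] by blast

lemma root_bounds: "root0 / 2 < root \<theta>" "root \<theta> < 3/2 * root0" "0 < root \<theta>" "root \<theta> \<le> 1"
proof -
  have "\<bar>root0 - root \<theta>\<bar> < root0 / 2" using root(1)[of \<theta>] by (simp add: dist_real_def)
  then show "root0 / 2 < root \<theta>" "root \<theta> < 3/2 * root0" by linarith+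
  then show "0 < root \<theta>" "root \<theta> \<le> 1" using root0_pos root_le by linarith+
qed

definition radius :: "real \<Rightarrow> real" where "radius \<theta> = sqrt (E + (root \<theta>)\<^sup>2)"

sublocale polar_curve radius
proof
  show "0 < radius \<theta>" for \<theta>
    using E by (simp add: radius_def add_pos_nonneg)
  show "radius \<theta> = radius \<theta>'" if "dir \<theta> = dir \<theta>'" for \<theta> \<theta>'
  proof -
    have "\<Phi> \<kappa> (of_real \<theta>) = \<Phi> \<kappa> (of_real \<theta>')" for \<kappa>
      using that by (simp add: \<Phi>_def symbol_def[abs_def] dir_eq_iff cos_of_real sin_of_real)
    then have "root \<theta> = root \<theta>'"
      using root[of \<theta>] by (intro root_unique) simp_all
    then show ?thesis by (simp add: radius_def)
  qed
  show "extends_holomorphically radius \<theta>" for \<theta>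
  proof -
    obtain r K where K: "0 < r" "K holomorphic_on ball (of_real \<theta>) r"
      "\<forall>z\<in>ball (of_real \<theta>) r. K z \<in> disc"
      "\<forall>z\<in>ball (of_real \<theta>) r. \<forall>\<kappa>\<in>disc. \<Phi> \<kappa> z = \<kappa> \<longleftrightarrow> \<kappa> = K z"
      "\<forall>\<theta>'. \<bar>\<theta>' - \<theta>\<bar> < r \<longrightarrow> K (of_real \<theta>') \<in> \<real>"
      by (rule local_root[of \<theta>])
    have root_K: "K (of_real \<theta>') = of_real (root \<theta>')" if "\<bar>\<theta>' - \<theta>\<bar> < r" for \<theta>'
    proof -
      have "of_real \<theta>' \<in> ball (complex_of_real \<theta>) r"
        using that by (simp add: dist_real_def abs_minus_commute[of \<theta>])
      from bspec[OF bspec[OF K(4) this] root(1)[of \<theta>']] root(2)[of \<theta>'] show ?thesis by (simp only: simp_thms)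
    qed
    have "(\<lambda>z. csqrt (of_real E + (K z)\<^sup>2)) holomorphic_on ball (of_real \<theta>) r"
      using disc(4)[OF bspec[OF K(3)]]
      by (intro holomorphic_on_csqrt_Re_pos holomorphic_on_add holomorphic_on_const holomorphic_on_power K)
    moreover have "csqrt (of_real E + (K (of_real \<theta>'))\<^sup>2) = of_real (radius \<theta>')" if "\<bar>\<theta>' - \<theta>\<bar> < r" for \<theta>'
    proof -
      have "of_real E + (K (of_real \<theta>'))\<^sup>2 = complex_of_real (E + (root \<theta>')\<^sup>2)"
        by (simp add: root_K[OF that])
      moreover have "csqrt (complex_of_real (E + (root \<theta>')\<^sup>2)) = of_real (radius \<theta>')"
        using E by (subst csqrt_of_real_nonneg) (auto simp: radius_def simp del: of_real_add)
      ultimately show ?thesis by (simp only:)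
    qed
    ultimately show ?thesis
      unfolding extends_holomorphically_def using K(1)
      by (intro exI[of _ "\<lambda>z. csqrt (of_real E + (K z)\<^sup>2)"] exI[of _ r]) simp
  qed
qed

lemma gamma_eq: "\<gamma> \<theta> = sqrt (E + (root \<theta>)\<^sup>2) *\<^sub>R dir \<theta>"
  by (simp add: \<gamma>_def radius_def)

text \<open>As \<open>root \<theta> \<le> 1\<close>, its square is at most
  \<open>root \<theta>\<close> and thus below the reserve \<open>2 * gap \<delta>\<close> that
  \<open>E_bound\<close> leaves under \<open>bmin / 4\<close>.\<close>

lemma gamma_in_brillouin: "\<gamma> \<theta> \<in> brillouin a2 a3"
proof (rule in_brillouin)
  have "(root \<theta>)\<^sup>2 \<le> root \<theta> * 1"
    unfolding power2_eq_square using root_bounds[of \<theta>] by (intro mult_left_mono) auto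
  also have "\<dots> \<le> 3/2 * root0 * 1" using root_bounds[of \<theta>] by simp
  also have "\<dots> \<le> 3/2 * root0 * (1 + 12 * bsum)" using root0_pos bsum_nonneg by (intro mult_left_mono) auto
  also have "\<dots> \<le> gap \<delta>" by (rule root_le)
  also have "\<dots> < 2 * gap \<delta>" using gap_pos[OF \<delta>] by simp
  finally have "(root \<theta>)\<^sup>2 < 2 * gap \<delta>" .
  then show "(norm (\<gamma> \<theta>))\<^sup>2 < bmin / 4"
    unfolding gamma_eq symbol_real(3)[OF root_bounds(3) E(1)] using E by (simp add: E_bound_eq[OF \<delta>])
qed

lemma singular_set_eq: "singular_set a2 a3 W g E = range \<gamma>"
proof
  show "range \<gamma> \<subseteq> singular_set a2 a3 W g E"
  proof
    fix k assume "k \<in> range \<gamma>"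
    then obtain \<theta> where k: "k = \<gamma> \<theta>" by blast
    note sym = symbol_real[OF root_bounds(3)[of \<theta>] E(1)]
    have kB: "k \<in> brillouin a2 a3" by (simp add: k gamma_in_brillouin)
    have "(norm k)\<^sup>2 \<noteq> E" unfolding k gamma_eq sym(3) using root_bounds[of \<theta>] by simp
    moreover have "Phi b (kappa_of E k) (sigma_of E k) = kappa_of E k"
      using root(2)[of \<theta>] unfolding k gamma_eq sym(2) sym(1)[symmetric] \<Phi>_def .
    ultimately show "k \<in> singular_set a2 a3 W g E"
      using singular_iff[OF elliptic_sigma_of[OF \<delta> E(2) kB] kB, of g] amplitude_small(2)
      by (simp add: b_def)
  qed
  show "singular_set a2 a3 W g E \<subseteq> range \<gamma>"
  proof
    fix k assume k: "k \<in> singular_set a2 a3 W g E"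
    then have kB: "k \<in> brillouin a2 a3" "(norm k)\<^sup>2 \<noteq> E" by (simp_all add: singular_set_def)
    note ell = elliptic_sigma_of[OF \<delta> E(2) kB(1)]
    have eq: "Phi b (kappa_of E k) (sigma_of E k) = kappa_of E k"
      using singular_iff[OF ell kB, of g] amplitude_small(2) k by (simp add: b_def)
    \<comment> \<open>Nothing is known yet about the position of \<open>kappa_of E k\<close>, but
      the bound for \<open>Phi\<close> holds on the whole closed right half plane. The equation
      itself therefore puts it into \<open>disc\<close>, and no singular point is missed.\<close>
    have "cmod (kappa_of E k - of_real root0) \<le> root0 / 8"
      using Phi_bound[OF ell Re_kappa_of kappa_of_ne_0[OF kB(2)] less_imp_le[OF b_pos] amplitude_small(1)]
      by (simp add: eq root0_def)
    then have in_disc: "kappa_of E k \<in> disc"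
      using root0_pos by (simp add: dist_norm norm_minus_commute)
    have above: "E < (norm k)\<^sup>2"
    proof (rule ccontr)
      assume "\<not> E < (norm k)\<^sup>2"
      then have "Re (kappa_of E k) = 0" by (intro kappa_of_below) simp
      with disc(1)[OF in_disc] show False by simp
    qed
    define \<mu> where "\<mu> = sqrt ((norm k)\<^sup>2 - E)"
    have \<mu>: "kappa_of E k = of_real \<mu>" "0 < \<mu>" "\<mu>\<^sup>2 = (norm k)\<^sup>2 - E"
      using above by (simp_all add: \<mu>_def kappa_of_above)
    obtain \<theta> where \<theta>: "k = norm k *\<^sub>R dir \<theta>" by (rule vec2_polar)
    have "norm k = sqrt (E + \<mu>\<^sup>2)" by (simp add: \<mu>(3))
    then have k_eq: "k = sqrt (E + \<mu>\<^sup>2) *\<^sub>R dir \<theta>" using \<theta> by simp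
    have "sigma_of E k = symbol E (of_real \<mu>) (of_real \<theta>)"
      unfolding symbol_real(1)[OF \<mu>(2) E(1)] k_eq[symmetric] ..
    then have "\<Phi> (of_real \<mu>) (of_real \<theta>) = of_real \<mu>"
      using eq by (simp only: \<Phi>_def \<mu>(1))
    then have "\<mu> = root \<theta>" using in_disc by (intro root_unique) (simp_all only: \<mu>(1))
    then have "k = \<gamma> \<theta>" using k_eq by (simp only: gamma_eq)
    then show "k \<in> range \<gamma>" by blast
  qed
qed

lemma gamma_in_annulus:
  "\<gamma> \<theta> \<in> annulus (sqrt E + (beta a2 a3 * Q)\<^sup>2 / (4 * (2 * sqrt E + 1)) * g\<^sup>2)
                  (sqrt E + 9/8 * (beta a2 a3 * Q)\<^sup>2 / sqrt E * g\<^sup>2)"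
proof -
  let ?\<mu> = "root \<theta>" and ?R = "sqrt (E + (root \<theta>)\<^sup>2)" and ?e = "sqrt E"
  have e: "0 < ?e" using E by simp
  have R: "norm (\<gamma> \<theta>) = ?R"
    using norm_\<gamma>[of \<theta>] by (simp only: radius_def)
  have R2: "?R\<^sup>2 = E + ?\<mu>\<^sup>2" and e2: "?e\<^sup>2 = E" using E by simp_all
  have Re: "?e \<le> ?R" by simp
  \<comment> \<open>\<open>root \<theta> \<le> 1\<close> is used in place of a bound proportional to
    \<open>g\<close>, so that the inner annulus constant does not depend on
    \<open>g\<close>.\<close>
  have R1: "?R \<le> ?e + 1"
  proof -
    have "E + ?\<mu>\<^sup>2 \<le> (?e + ?\<mu>)\<^sup>2"
      using e root_bounds(3)[of \<theta>] unfolding power2_sum e2 by simp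
    then have "?R \<le> ?e + ?\<mu>"
      using e root_bounds(3)[of \<theta>] by (intro real_le_lsqrt) auto
    then show ?thesis using root_bounds(4)[of \<theta>] by linarith
  qed
  have "(?R - ?e) * (?R + ?e) = ?R\<^sup>2 - ?e\<^sup>2"
    by (simp only: power2_eq_square square_diff_square_factored mult.commute)
  also have "\<dots> = ?\<mu>\<^sup>2" unfolding R2 e2 by simp
  finally have sq: "(?R - ?e) * (?R + ?e) = ?\<mu>\<^sup>2" .
  have r0: "root0\<^sup>2 = (beta a2 a3 * Q)\<^sup>2 * g\<^sup>2"
    by (simp only: root0_def b_def power_mult_distrib mult_ac)
  have "?R - ?e \<in> {root0\<^sup>2 / (4 * (2 * ?e + 1)) <..< 9/8 * root0\<^sup>2 / ?e}"
    by (rule annulus_arith[OF e Re R1 sq root0_pos root_bounds(1,2)])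
  then show ?thesis
    unfolding annulus_def R mem_Collect_eq r0 by (simp add: mult_ac)
qed

lemma conclusion:
  defines "\<Omega> \<equiv> annulus (sqrt E + (beta a2 a3 * Q)\<^sup>2 / (4 * (2 * sqrt E + 1)) * g\<^sup>2)
                  (sqrt E + 9/8 * (beta a2 a3 * Q)\<^sup>2 / sqrt E * g\<^sup>2)"
  shows "compact (singular_set a2 a3 W g E)" "analytic_1manifold (singular_set a2 a3 W g E)"
    "singular_set a2 a3 W g E \<subseteq> \<Omega>"
    "\<exists>\<gamma>. simple_path \<gamma> \<and> pathfinish \<gamma> = pathstart \<gamma> \<and> path_image \<gamma> = singular_set a2 a3 W g E \<and>
       \<not> (\<exists>p\<in>\<Omega>. homotopic_loops \<Omega> \<gamma> (\<lambda>t. p))"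
proof -
  show "compact (singular_set a2 a3 W g E)"
    unfolding singular_set_eq path_image_loop[symmetric] by (rule compact_path_image[OF path_loop])
  show "analytic_1manifold (singular_set a2 a3 W g E)"
    unfolding singular_set_eq by (rule manifold)
  show "singular_set a2 a3 W g E \<subseteq> \<Omega>"
    unfolding singular_set_eq \<Omega>_def using gamma_in_annulus by blast
  have "0 \<notin> \<Omega>"
    using E by (auto simp: \<Omega>_def annulus_def not_less intro!: add_nonneg_nonneg mult_nonneg_nonneg divide_nonneg_nonneg)
  then show "\<exists>\<gamma>. simple_path \<gamma> \<and> pathfinish \<gamma> = pathstart \<gamma> \<and> path_image \<gamma> = singular_set a2 a3 W g E \<and>
       \<not> (\<exists>p\<in>\<Omega>. homotopic_loops \<Omega> \<gamma> (\<lambda>t. p))"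
    unfolding singular_set_eq using simple_loop closed_loop path_image_loop loop_not_null_homotopic by blast
qed

end

section \<open>Decay of the potential and choice of the coupling threshold\<close>

lemma nn_integral_decay_finite:
  assumes \<eta>: "0 < \<eta>"
  shows "(\<integral>\<^sup>+y. ennreal ((1 + \<bar>y\<bar>) powr (- 1 - \<eta>)) \<partial>lborel) < \<infinity>"
proof -
  have "(\<integral>\<^sup>+y. ennreal ((1 + \<bar>y\<bar>) powr (- 1 - \<eta>)) * indicator {0..} y \<partial>lborel) = ennreal (1 / \<eta>)"
  proof -
    have lim: "((\<lambda>y. - ((1 + y) powr (- \<eta>)) / \<eta>) \<longlongrightarrow> - 0 / \<eta>) at_top"
    proof (intro tendsto_intros)
      show "((\<lambda>y. (1 + y) powr (- \<eta>)) \<longlongrightarrow> 0) at_top"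
        using \<eta> by (intro tendsto_neg_powr filterlim_tendsto_add_at_top[OF tendsto_const] filterlim_ident) auto
    qed (use \<eta> in auto)
    have der: "((\<lambda>y. - ((1 + y) powr (- \<eta>)) / \<eta>) has_real_derivative (1 + \<bar>y\<bar>) powr (- 1 - \<eta>)) (at y)" if "0 \<le> y" for y
    proof -
      have "((\<lambda>y. - ((1 + y) powr (- \<eta>)) / \<eta>) has_real_derivative - (- \<eta> * (1 + y) powr (- \<eta> - 1) * 1) / \<eta>) (at y)"
        using that by (intro DERIV_cdivide DERIV_minus DERIV_powr[THEN DERIV_cong]) (auto intro!: derivative_eq_intros simp: powr_diff)
      moreover have "- \<eta> - 1 = - 1 - \<eta>" by simp
      ultimately show ?thesis using that \<eta> by simp
    qed
    show ?thesis
      using nn_integral_FTC_atLeast[OF _ der _ lim] by simp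
  qed
  then show ?thesis
    by (subst nn_integral_even) (auto simp: ennreal_mult_less_top)
qed

text \<open>The weight costs two powers: \<open>- (3 + \<eta>) + 2 = - 1 - \<eta>\<close> is still
  integrable on the line, and the cell has finite area.\<close>

lemma (in rect_lattice) integrable_decay:
  assumes [measurable]: "W \<in> borel_measurable (strip_measure a2 a3)" and \<eta>: "0 < \<eta>"
    and decay: "AE x in strip_measure a2 a3. \<bar>W x\<bar> \<le> C * (1 + \<bar>fst x\<bar>) powr (- (3 + \<eta>) / 2)"
  shows "integrable (strip_measure a2 a3) (\<lambda>x. (W x * (1 + \<bar>fst x\<bar>))\<^sup>2)"
proof (rule integrableI_bounded)
  have [measurable]: "fst \<in> borel_measurable (strip_measure a2 a3)"
    unfolding strip_measure_def by (rule measurable_restrict_space1) simp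
  show "(\<lambda>x. (W x * (1 + \<bar>fst x\<bar>))\<^sup>2) \<in> borel_measurable (strip_measure a2 a3)" by measurable
  have "AE x in strip_measure a2 a3. ennreal (norm ((W x * (1 + \<bar>fst x\<bar>))\<^sup>2)) \<le> ennreal (C\<^sup>2) * ennreal ((1 + \<bar>fst x\<bar>) powr (- 1 - \<eta>))"
    using decay
  proof eventually_elim
    case (elim x)
    let ?q = "1 + \<bar>fst x\<bar>"
    have q: "0 < ?q" by simp
    have "(W x)\<^sup>2 \<le> (C * ?q powr (- (3 + \<eta>) / 2))\<^sup>2"
      using power_mono[OF elim, of 2] by simp
    then have "(W x)\<^sup>2 * ?q\<^sup>2 \<le> (C * ?q powr (- (3 + \<eta>) / 2))\<^sup>2 * ?q\<^sup>2"
      by (intro mult_right_mono) auto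
    also have "\<dots> = C\<^sup>2 * ((?q powr (- (3 + \<eta>) / 2)) powr 2 * ?q powr 2)"
      using q by (simp add: power_mult_distrib powr_numeral)
    also have "(?q powr (- (3 + \<eta>) / 2)) powr 2 * ?q powr 2 = ?q powr (- 1 - \<eta>)"
    proof -
      have "- (3 + \<eta>) / 2 * 2 + 2 = - 1 - \<eta>" by (simp add: field_simps)
      then show ?thesis by (simp only: powr_powr powr_add[symmetric])
    qed
    finally have "(W x * ?q)\<^sup>2 \<le> C\<^sup>2 * ?q powr (- 1 - \<eta>)"
      by (simp only: power_mult_distrib)
    then have "ennreal (norm ((W x * ?q)\<^sup>2)) \<le> ennreal (C\<^sup>2 * ?q powr (- 1 - \<eta>))"
      by (intro ennreal_leI) simp
    then show ?case by (simp only: ennreal_mult zero_le_power2 powr_ge_zero)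
  qed
  then have "(\<integral>\<^sup>+x. ennreal (norm ((W x * (1 + \<bar>fst x\<bar>))\<^sup>2)) \<partial>strip_measure a2 a3) \<le>
      (\<integral>\<^sup>+x. ennreal (C\<^sup>2) * ennreal ((1 + \<bar>fst x\<bar>) powr (- 1 - \<eta>)) \<partial>strip_measure a2 a3)"
    by (rule nn_integral_mono_AE)
  also have "\<dots> = ennreal (C\<^sup>2) * (\<integral>\<^sup>+x. ennreal ((1 + \<bar>fst x\<bar>) powr (- 1 - \<eta>)) \<partial>strip_measure a2 a3)"
    by (rule nn_integral_cmult) measurable
  also have "(\<integral>\<^sup>+x. ennreal ((1 + \<bar>fst x\<bar>) powr (- 1 - \<eta>)) \<partial>strip_measure a2 a3) =
      (\<integral>\<^sup>+y1. \<integral>\<^sup>+p. ennreal ((1 + \<bar>y1\<bar>) powr (- 1 - \<eta>)) * indicator (cell a2 a3) p \<partial>lborel \<partial>lborel)"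
    using nn_integral_strip[of "\<lambda>x. ennreal ((1 + \<bar>fst x\<bar>) powr (- 1 - \<eta>))"] by simp
  also have "\<dots> = (\<integral>\<^sup>+y1. ennreal ((1 + \<bar>y1\<bar>) powr (- 1 - \<eta>)) \<partial>lborel) * emeasure lborel (cell a2 a3)"
    by (simp add: nn_integral_cmult_indicator nn_integral_multc)
  also have "ennreal (C\<^sup>2) * \<dots> < \<infinity>"
    using nn_integral_decay_finite[OF \<eta>] emeasure_cell by (simp add: ennreal_mult_less_top)
  finally show "(\<integral>\<^sup>+x. ennreal (norm ((W x * (1 + \<bar>fst x\<bar>))\<^sup>2)) \<partial>strip_measure a2 a3) < \<infinity>" .
qed

theorem theorem1p1:
  fixes a2 a3 :: "real^2" and W :: "real \<times> (real^2) \<Rightarrow> real" and \<delta> :: real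
  assumes "a2 \<noteq> 0" and "a3 \<noteq> 0" and "a2 \<bullet> a3 = 0"
    and "\<delta> > 0"
    and "W \<in> borel_measurable (strip_measure a2 a3)"
    and "\<exists>C. AE x in strip_measure a2 a3. \<bar>W x\<bar> \<le> C"
    and "AE x in strip_measure a2 a3. W x \<ge> 0"
    and "\<not> (AE x in strip_measure a2 a3. W x = 0)"
    and "\<exists>\<eta>>0. \<exists>C. AE x in strip_measure a2 a3.
           \<bar>W x\<bar> \<le> C * (1 + \<bar>fst x\<bar>) powr (- (3 + \<eta>) / 2)"
  shows "\<exists>g0>0. \<forall>E. 0 < E \<and> E < E_bound a2 a3 \<delta> \<longrightarrow>
           (\<exists>c_minus>0. \<exists>c_plus>0. \<forall>g. 0 < g \<and> g < g0 \<longrightarrow>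
              (let C = singular_set a2 a3 W g E;
                   \<Omega> = annulus (sqrt E + c_minus * g\<^sup>2) (sqrt E + c_plus * g\<^sup>2)
               in compact C \<and> analytic_1manifold C \<and> C \<subseteq> \<Omega> \<and>
                  (\<exists>\<gamma>. simple_path \<gamma> \<and> pathfinish \<gamma> = pathstart \<gamma> \<and> path_image \<gamma> = C \<and>
                       \<not> (\<exists>p\<in>\<Omega>. homotopic_loops \<Omega> \<gamma> (\<lambda>t. p)))))"
proof -
  interpret rect_lattice a2 a3
    by unfold_locales (use assms(1-3) in auto)
  obtain B where B: "AE x in strip_measure a2 a3. \<bar>W x\<bar> \<le> B" using assms(6) by blast
  obtain \<eta> C where "0 < \<eta>" and C: "AE x in strip_measure a2 a3. \<bar>W x\<bar> \<le> C * (1 + \<bar>fst x\<bar>) powr (- (3 + \<eta>) / 2)"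
    using assms(9) by blast
  interpret potential a2 a3 W B
    by unfold_locales (use assms(5,8) B integrable_decay[OF assms(5) \<open>0 < \<eta>\<close> C] in auto)
  let ?\<beta> = "beta a2 a3"
  have \<beta>: "0 < ?\<beta>"
    using dual.measure_cell_pos by (simp add: beta_def brillouin_def)
  have gap: "0 < gap \<delta>" by (rule gap_pos[OF assms(4)])
  \<comment> \<open>The summand 1 makes \<open>x1\<close> positive without a lower bound for the
    amplitude, so that it can be a denominator of \<open>g0\<close>.\<close>
  define x1 where "x1 = 9 * (?\<beta> * (amplitude (gap \<delta>) + 1))"
  define x2 where "x2 = 3/2 * (?\<beta> * Q)"
  define x3 where "x3 = 3/2 * (?\<beta> * Q) * (1 + 12 * bsum)"
  have amp: "0 \<le> amplitude (gap \<delta>)"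
    using kernel_const_nonneg[OF gap] A_nonneg by (simp add: amplitude_def)
  have x: "0 < x1" "0 < x2" "0 < x3"
    using \<beta> amp Q_pos bsum_nonneg by (auto simp: x1_def x2_def x3_def intro!: mult_pos_pos add_pos_nonneg add_nonneg_pos)
  \<comment> \<open>The three thresholds are built from the lattice, \<open>\<delta>\<close> and
    bounds for \<open>W\<close>; the energy does not occur, so \<open>g0\<close> can be fixed before
    it.\<close>
  define g0 where "g0 = min (1 / x1) (min (1 / x2) (gap \<delta> / x3))"
  have g0: "0 < g0" using x gap by (simp add: g0_def)
  have coupling: "small_coupling a2 a3 W B \<delta> E g"
    if E: "0 < E" "E < E_bound a2 a3 \<delta>" and g: "0 < g" "g < g0" for E g
  proof -
    have gx: "g * x1 \<le> 1" "g * x2 \<le> 1" "g * x3 \<le> gap \<delta>"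
      using g x by (auto simp: g0_def pos_less_divide_eq less_imp_le)
    have "g * ?\<beta> * amplitude (gap \<delta>) \<le> g * ?\<beta> * (amplitude (gap \<delta>) + 1)"
      using g \<beta> by (intro mult_left_mono) auto
    moreover have "g * x1 = 9 * (g * ?\<beta> * (amplitude (gap \<delta>) + 1))"
      by (simp only: x1_def mult_ac)
    ultimately have 1: "g * ?\<beta> * amplitude (gap \<delta>) \<le> 1/9"
      using gx(1) by linarith
    have 2: "3/2 * (g * ?\<beta> * Q) \<le> 1" "3/2 * (g * ?\<beta> * Q) * (1 + 12 * bsum) \<le> gap \<delta>"
      using gx(2,3) by (simp_all add: x2_def x3_def mult_ac)
    show ?thesis
      by unfold_locales (use assms(4) E g 1 2 in auto)
  qed
  show ?thesis
  proof (rule exI[of _ g0], intro conjI g0 allI impI)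
    fix E assume E: "0 < E \<and> E < E_bound a2 a3 \<delta>"
    \<comment> \<open>The bounds of \<open>annulus_arith\<close> for
      \<open>r = g * ?\<beta> * Q\<close> with \<open>g\<^sup>2\<close> split off. They depend on E,
      and \<open>?d\<close> grows without bound as E tends to 0.\<close>
    let ?c = "(?\<beta> * Q)\<^sup>2 / (4 * (2 * sqrt E + 1))" and ?d = "9/8 * (?\<beta> * Q)\<^sup>2 / sqrt E"
    have c: "0 < ?c" "0 < ?d"
      using E \<beta> Q_pos by (auto intro!: divide_pos_pos mult_pos_pos add_pos_pos zero_less_power)
    show "\<exists>c_minus>0. \<exists>c_plus>0. \<forall>g. 0 < g \<and> g < g0 \<longrightarrow>
              (let C = singular_set a2 a3 W g E;
                   \<Omega> = annulus (sqrt E + c_minus * g\<^sup>2) (sqrt E + c_plus * g\<^sup>2)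
               in compact C \<and> analytic_1manifold C \<and> C \<subseteq> \<Omega> \<and>
                  (\<exists>\<gamma>. simple_path \<gamma> \<and> pathfinish \<gamma> = pathstart \<gamma> \<and> path_image \<gamma> = C \<and>
                       \<not> (\<exists>p\<in>\<Omega>. homotopic_loops \<Omega> \<gamma> (\<lambda>t. p))))"
      unfolding Let_def
    proof (rule exI[of _ ?c], intro conjI c(1), rule exI[of _ ?d], intro conjI c(2) allI impI)
      fix g assume "0 < g \<and> g < g0"
      with E have "small_coupling a2 a3 W B \<delta> E g" by (intro coupling) auto
      from small_coupling.conclusion[OF this]
      show "compact (singular_set a2 a3 W g E)" "analytic_1manifold (singular_set a2 a3 W g E)"
        "singular_set a2 a3 W g E \<subseteq> annulus (sqrt E + ?c * g\<^sup>2) (sqrt E + ?d * g\<^sup>2)"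
        "\<exists>\<gamma>. simple_path \<gamma> \<and> pathfinish \<gamma> = pathstart \<gamma> \<and> path_image \<gamma> = singular_set a2 a3 W g E \<and>
          \<not> (\<exists>p\<in>annulus (sqrt E + ?c * g\<^sup>2) (sqrt E + ?d * g\<^sup>2).
            homotopic_loops (annulus (sqrt E + ?c * g\<^sup>2) (sqrt E + ?d * g\<^sup>2)) \<gamma> (\<lambda>t. p))"
        by blast+
    qed
  qed
qed

end
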